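(* Let $G$ be a compact abelian group with normalized Haar measure $\mu$, let $\hat G$ be its Pontryagin dual, and let $|||\cdot|||$ be a unitarily invariant norm on the ideal $J\subseteq B(H)$. For $A_\theta\in L^2(G;J)$ and $k\in\hat G$, the operators $$B_k=\int_G\overline{k(\theta)}A_\theta\,d\mu(\theta)$$ are well defined, and $$\sum_{k\in\hat G}|B_k|^2=\int_G|A_\theta|^2\,d\mu(\theta),$$ where the series on the left-hand side converges strongly.
   Context: $H$ is a separable complex Hilbert space, $B(H)$ the bounded linear operators on $H$, and $|A|=(A^*A)^{1/2}$. The Haar measure $\mu$ of the compact abelian group $G$ is normalized by $\mu(G)=1$. $\hat G$ is the (discrete) group of continuous homomorphisms $k:G\to\{z\in\mathbb C: |z|=1\}$. A unitarily invariant norm $|||\cdot|||$ is a norm defined on a norm ideal $J=J_{|||\cdot|||}$ of $B(H)$ such that $|||UAV|||=|||A|||$ for all $A\in J$ and all unitary $U,V\in B(H)$, normalized so that $|||A|||=\|A\|$ for all rank one operators ($\|\cdot\|$ is the operator norm). $J$ is complete in this norm; it consists of compact operators, except when the norm is equivalent to the operator norm, which is defined on all of $B(H)$. For a Banach space $X$, $L^p(G;X)$ is the Bochner space of (classes of) strongly measurable $f:G\to X$ with $\int_G\|f\|_X^p\,d\mu<\infty$; integrals of operator-valued functions are Bochner integrals. Sums over $\hat G$ are unordered: limits of the net of partial sums over finite subsets $\Delta\subseteq\hat G$ directed by inclusion. Strong convergence means convergence in the strong operator topology. *)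

theory Defs
  imports "HOL-Analysis.Analysis"
begin

section \<open>Separable complex Hilbert spaces\<close>

text \<open>
  The inner product is linear in the first argument. The remaining laws of a complex vector space
  (such as the one for multiplication by 1) follow from those of the underlying real vector space
  by \<open>scaleR_scaleC\<close>.
\<close>

class separable_chilbert_space = banach +
  fixes scaleC :: "complex \<Rightarrow> 'a \<Rightarrow> 'a" (infixr "*\<^sub>C" 75)
    and cinner :: "'a \<Rightarrow> 'a \<Rightarrow> complex"
  assumes scaleC_add_right: "c *\<^sub>C (x + y) = c *\<^sub>C x + c *\<^sub>C y"
    and scaleC_add_left: "(c + d) *\<^sub>C x = c *\<^sub>C x + d *\<^sub>C x"
    and scaleC_scaleC: "c *\<^sub>C d *\<^sub>C x = (c * d) *\<^sub>C x"
    and scaleR_scaleC: "r *\<^sub>R x = complex_of_real r *\<^sub>C x"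
    and cinner_commute: "cinner x y = cnj (cinner y x)"
    and cinner_add_left: "cinner (x + y) z = cinner x z + cinner y z"
    and cinner_scaleC_left: "cinner (c *\<^sub>C x) y = c * cinner x y"
    and cinner_self: "cinner x x = complex_of_real ((norm x)\<^sup>2)"
    and separable: "\<exists>D. countable D \<and> (\<forall>x. \<forall>e>0. \<exists>d\<in>D. dist d x < e)"

lemma norm_scaleC: "norm (c *\<^sub>C x) = cmod c * norm (x :: 'a::separable_chilbert_space)"
proof -
  have "complex_of_real ((norm (c *\<^sub>C x))\<^sup>2) = cinner (c *\<^sub>C x) (c *\<^sub>C x)"
    by (simp add: cinner_self)
  also have "\<dots> = c * cnj (cinner (c *\<^sub>C x) x)"
    by (metis cinner_commute cinner_scaleC_left)
  also have "\<dots> = (c * cnj c) * complex_of_real ((norm x)\<^sup>2)"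
    by (simp add: cinner_scaleC_left cinner_self)
  also have "\<dots> = complex_of_real ((cmod c * norm x)\<^sup>2)"
    by (simp only: complex_norm_square[symmetric] power_mult_distrib of_real_mult of_real_power)
  finally have "(norm (c *\<^sub>C x))\<^sup>2 = (cmod c * norm x)\<^sup>2"
    using of_real_eq_iff by blast
  then show ?thesis by (simp add: power2_eq_iff_nonneg)
qed

instance separable_chilbert_space \<subseteq> second_countable_topology
proof
  obtain D :: "'a set" where D: "countable D" "\<And>x e. e > 0 \<Longrightarrow> \<exists>d\<in>D. dist d x < e"
    using separable by blast
  define B where "B = (\<lambda>(d, q). ball d q) ` (D \<times> (\<rat> \<inter> {0<..} :: real set))"
  have "countable B"
    unfolding B_def using D(1) countable_rat by (intro countable_image countable_SIGMA) auto
  moreover have "topological_basis B"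
  proof (rule topological_basisI)
    show "open b" if "b \<in> B" for b using that by (auto simp: B_def)
  next
    fix U :: "'a set" and x assume "open U" "x \<in> U"
    then obtain e where e: "e > 0" "ball x e \<subseteq> U" by (meson open_contains_ball)
    obtain q where q: "q \<in> \<rat>" "0 < q" "q < e / 2"
      using Rats_dense_in_real[of 0 "e / 2"] e by auto
    obtain d where d: "d \<in> D" "dist d x < q" using D(2) q by blast
    have "ball d q \<subseteq> ball x e"
    proof
      fix y assume "y \<in> ball d q"
      then have "dist x y < q + q"
        using d(2) dist_triangle[of x y d] by (simp add: dist_commute)
      then show "y \<in> ball x e" using q(3) by simp
    qed
    then show "\<exists>b\<in>B. x \<in> b \<and> b \<subseteq> U"
      using d q e by (intro bexI[of _ "ball d q"]) (auto simp: B_def)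
  qed
  ultimately show "\<exists>B :: 'a set set. countable B \<and> open = generate_topology B"
    using topological_basis_imp_subbasis by blast
qed


section \<open>Operators\<close>

text \<open>
  The type \<open>'h \<Rightarrow>\<^sub>L 'h\<close> consists of the real-linear bounded operators; \<open>BH\<close> singles out
  the complex-linear ones. Its \<open>norm\<close> is the operator norm.
\<close>

definition BH :: "('h::separable_chilbert_space \<Rightarrow>\<^sub>L 'h) set" where
  "BH = {A. \<forall>c x. blinfun_apply A (c *\<^sub>C x) = c *\<^sub>C blinfun_apply A x}"

lift_definition op_scaleC ::
    "complex \<Rightarrow> ('h::separable_chilbert_space \<Rightarrow>\<^sub>L 'h) \<Rightarrow> 'h \<Rightarrow>\<^sub>L 'h"
  is "\<lambda>c A x. c *\<^sub>C A x"
proof -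
  fix c :: complex and A :: "'h \<Rightarrow> 'h" assume A: "bounded_linear A"
  have "bounded_linear (\<lambda>x :: 'h. c *\<^sub>C x)"
    by (rule bounded_linear_intro[where K = "cmod c"])
       (simp_all add: scaleC_add_right scaleR_scaleC scaleC_scaleC norm_scaleC mult.commute)
  from bounded_linear_compose[OF this A] show "bounded_linear (\<lambda>x. c *\<^sub>C A x)" .
qed

definition op_adjoint ::
    "('h::separable_chilbert_space \<Rightarrow>\<^sub>L 'h) \<Rightarrow> 'h \<Rightarrow>\<^sub>L 'h" where
  "op_adjoint A = (THE B. B \<in> BH \<and>
     (\<forall>x y. cinner (blinfun_apply A x) y = cinner x (blinfun_apply B y)))"

definition op_unitary :: "('h::separable_chilbert_space \<Rightarrow>\<^sub>L 'h) \<Rightarrow> bool" where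
  "op_unitary U \<longleftrightarrow> U \<in> BH \<and>
     op_adjoint U o\<^sub>L U = id_blinfun \<and> U o\<^sub>L op_adjoint U = id_blinfun"

definition op_positive :: "('h::separable_chilbert_space \<Rightarrow>\<^sub>L 'h) \<Rightarrow> bool" where
  "op_positive P \<longleftrightarrow> P \<in> BH \<and> (\<forall>x. cinner (blinfun_apply P x) x \<in> \<real>\<^sub>\<ge>\<^sub>0)"

definition op_sqrt :: "('h::separable_chilbert_space \<Rightarrow>\<^sub>L 'h) \<Rightarrow> 'h \<Rightarrow>\<^sub>L 'h" where
  "op_sqrt T = (THE P. op_positive P \<and> P o\<^sub>L P = T)"

definition op_abs :: "('h::separable_chilbert_space \<Rightarrow>\<^sub>L 'h) \<Rightarrow> 'h \<Rightarrow>\<^sub>L 'h" where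
  "op_abs A = op_sqrt (op_adjoint A o\<^sub>L A)"

definition op_rank_one :: "('h::separable_chilbert_space \<Rightarrow>\<^sub>L 'h) \<Rightarrow> bool" where
  "op_rank_one A \<longleftrightarrow> A \<in> BH \<and>
     (\<exists>u. u \<noteq> 0 \<and> range (blinfun_apply A) = range (\<lambda>c. c *\<^sub>C u))"

definition op_compact :: "('h::separable_chilbert_space \<Rightarrow>\<^sub>L 'h) \<Rightarrow> bool" where
  "op_compact A \<longleftrightarrow> A \<in> BH \<and> compact (closure (blinfun_apply A ` cball 0 1))"


section \<open>Unitarily invariant norms\<close>

text \<open>
  \<open>N\<close> is the norm on the ideal \<open>J\<close>; its values outside \<open>J\<close> are irrelevant. The ideal being closed
  under complex scaling follows from \<open>ideal\<close>. Rank one operators are required to lie in \<open>J\<close>, which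
  only excludes the zero ideal. The alternative \<open>J = BH\<close> in \<open>compact_or_BH\<close> comes with equivalence
  of \<open>N\<close> and the operator norm.
\<close>

locale unitarily_invariant_norm =
  fixes J :: "('h::separable_chilbert_space \<Rightarrow>\<^sub>L 'h) set"
    and N :: "('h \<Rightarrow>\<^sub>L 'h) \<Rightarrow> real"
  assumes subset_BH: "J \<subseteq> BH"
    and zero_mem: "0 \<in> J"
    and add_mem: "\<lbrakk>A \<in> J; B \<in> J\<rbrakk> \<Longrightarrow> A + B \<in> J"
    and ideal: "\<lbrakk>A \<in> J; X \<in> BH; Y \<in> BH\<rbrakk> \<Longrightarrow> X o\<^sub>L A o\<^sub>L Y \<in> J"
    and nonneg: "A \<in> J \<Longrightarrow> 0 \<le> N A"
    and eq_zero_iff: "A \<in> J \<Longrightarrow> N A = 0 \<longleftrightarrow> A = 0"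
    and triangle: "\<lbrakk>A \<in> J; B \<in> J\<rbrakk> \<Longrightarrow> N (A + B) \<le> N A + N B"
    and scale: "A \<in> J \<Longrightarrow> N (op_scaleC c A) = cmod c * N A"
    and unitary_inv: "\<lbrakk>A \<in> J; op_unitary U; op_unitary V\<rbrakk> \<Longrightarrow> N (U o\<^sub>L A o\<^sub>L V) = N A"
    and rank_one: "op_rank_one A \<Longrightarrow> A \<in> J \<and> N A = norm A"
    and complete: "\<lbrakk>\<And>n::nat. S n \<in> J; \<And>e. e > 0 \<Longrightarrow> \<exists>M. \<forall>m\<ge>M. \<forall>n\<ge>M. N (S m - S n) < e\<rbrakk>
      \<Longrightarrow> \<exists>L\<in>J. (\<lambda>n. N (S n - L)) \<longlonglongrightarrow> 0"
    and compact_or_BH: "(\<forall>A\<in>J. op_compact A) \<or>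
      (J = BH \<and> (\<exists>c>0. \<exists>C. \<forall>A\<in>J. c * norm A \<le> N A \<and> N A \<le> C * norm A))"


section \<open>Bochner integration in a normed space given by a carrier set\<close>

text \<open>
  The Bochner integral of the library is restricted to types with a second countable topology and
  to the norm of that type. Here \<open>X\<close> is a real subspace of the type \<open>'b\<close>, normed by \<open>N\<close>, and need
  not be separable. Apart from strong measurability, \<open>has_bochner_integral_in\<close> follows
  the library's \<open>has_bochner_integral\<close>. Finiteness of the measure of the support of simple functions
  is contained in \<open>simple_bochner_integrable\<close>.
\<close>

definition strongly_measurable_in ::
    "'a measure \<Rightarrow> 'b::real_vector set \<Rightarrow> ('b \<Rightarrow> real) \<Rightarrow> ('a \<Rightarrow> 'b) \<Rightarrow> bool" where
  "strongly_measurable_in M X N f \<longleftrightarrow> f \<in> space M \<rightarrow> X \<and>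
     (\<exists>s. (\<forall>n::nat. Bochner_Integration.simple_bochner_integrable M (s n) \<and> s n \<in> space M \<rightarrow> X) \<and>
          (AE x in M. (\<lambda>n. N (f x - s n x)) \<longlonglongrightarrow> 0))"

definition has_bochner_integral_in ::
    "'a measure \<Rightarrow> 'b::real_vector set \<Rightarrow> ('b \<Rightarrow> real) \<Rightarrow> ('a \<Rightarrow> 'b) \<Rightarrow> 'b \<Rightarrow> bool" where
  "has_bochner_integral_in M X N f I \<longleftrightarrow> strongly_measurable_in M X N f \<and> I \<in> X \<and>
     (\<exists>s. (\<forall>n::nat. Bochner_Integration.simple_bochner_integrable M (s n) \<and> s n \<in> space M \<rightarrow> X) \<and>
          (\<lambda>n. \<integral>\<^sup>+x. ennreal (N (f x - s n x)) \<partial>M) \<longlonglongrightarrow> 0 \<and>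
          (\<lambda>n. N (Bochner_Integration.simple_bochner_integral M (s n) - I)) \<longlonglongrightarrow> 0)"

definition bochner_integrable_in ::
    "'a measure \<Rightarrow> 'b::real_vector set \<Rightarrow> ('b \<Rightarrow> real) \<Rightarrow> ('a \<Rightarrow> 'b) \<Rightarrow> bool" where
  "bochner_integrable_in M X N f \<longleftrightarrow> (\<exists>I. has_bochner_integral_in M X N f I)"

definition bochner_integral_in ::
    "'a measure \<Rightarrow> 'b::real_vector set \<Rightarrow> ('b \<Rightarrow> real) \<Rightarrow> ('a \<Rightarrow> 'b) \<Rightarrow> 'b" where
  "bochner_integral_in M X N f = (THE I. has_bochner_integral_in M X N f I)"

text \<open>Representatives of the classes in the Bochner space of square integrable functions.\<close>

definition L2_in ::
    "'a measure \<Rightarrow> 'b::real_vector set \<Rightarrow> ('b \<Rightarrow> real) \<Rightarrow> ('a \<Rightarrow> 'b) set" where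
  "L2_in M X N = {f. strongly_measurable_in M X N f \<and> (\<integral>\<^sup>+x. ennreal ((N (f x))\<^sup>2) \<partial>M) < \<infinity>}"


section \<open>Compact abelian groups\<close>

text \<open>
  Groups are written additively. For groups which are not second countable, regularity
  is not automatic and is part of the notion of Haar measure.
\<close>

locale normalized_haar_measure =
  fixes \<mu> :: "'g::{topological_ab_group_add, t2_space} measure"
  assumes sets_eq: "sets \<mu> = sets borel"
    and normalized: "emeasure \<mu> UNIV = 1"
    and translation_inv: "E \<in> sets borel \<Longrightarrow> emeasure \<mu> ((\<lambda>x. a + x) ` E) = emeasure \<mu> E"
    and outer_regular: "E \<in> sets borel \<Longrightarrow>
      emeasure \<mu> E = (INF U\<in>{U. open U \<and> E \<subseteq> U}. emeasure \<mu> U)"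
    and inner_regular: "open U \<Longrightarrow>
      emeasure \<mu> U = (SUP K\<in>{K. compact K \<and> K \<subseteq> U}. emeasure \<mu> K)"

definition dual_group :: "('g::{topological_ab_group_add, t2_space} \<Rightarrow> complex) set" where
  "dual_group = {k. continuous_on UNIV k \<and> (\<forall>x y. k (x + y) = k x * k y) \<and> (\<forall>x. cmod (k x) = 1)}"

definition fourier_coefficient ::
    "'g::{topological_ab_group_add, t2_space} measure \<Rightarrow>
     ('h::separable_chilbert_space \<Rightarrow>\<^sub>L 'h) set \<Rightarrow> (('h \<Rightarrow>\<^sub>L 'h) \<Rightarrow> real) \<Rightarrow>
     ('g \<Rightarrow> 'h \<Rightarrow>\<^sub>L 'h) \<Rightarrow> ('g \<Rightarrow> complex) \<Rightarrow> 'h \<Rightarrow>\<^sub>L 'h" where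
  "fourier_coefficient \<mu> J N A k =
     bochner_integral_in \<mu> J N (\<lambda>\<theta>. op_scaleC (cnj (k \<theta>)) (A \<theta>))"

end

theory Submission
  imports Defs "HOL-Complex_Analysis.Great_Picard"
begin

text \<open>
  Applied to a vector \<open>x\<close>, the identity reads \<open>\<Sum> \<parallel>B\<^sub>k x\<parallel>\<^sup>2 = \<integral> \<parallel>A\<^sub>\<theta> x\<parallel>\<^sup>2 d\<theta>\<close>, since \<open>\<parallel>|B| x\<parallel> = \<parallel>B x\<parallel>\<close>. This is
  Parseval's identity for the function \<open>\<theta> \<mapsto> A\<^sub>\<theta> x\<close> with values in the Hilbert space, whose Fourier coefficients
  are \<open>B\<^sub>k x\<close>. The remainder \<open>R\<close> of the operator series is positive by Bessel's inequality and dominated by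
  the integral \<open>D\<close>, so that \<open>\<parallel>R x\<parallel>\<^sup>2 \<le> \<parallel>D\<parallel> \<langle>R x, x\<rangle>\<close> by the Cauchy-Schwarz inequality for the
  form of \<open>R\<close>. Hence convergence of the quadratic forms implies strong convergence (\<open>strong_limit_of_forms\<close>).

  Operators. Existence and uniqueness of positive square roots give \<open>|A|\<^sup>2 = A\<^sup>*A\<close>. A Hermitian contraction \<open>X\<close> is
  the mean of the unitaries \<open>X \<plusminus> \<i> sqrt (1 - X\<^sup>2)\<close>, from which it follows that a unitarily invariant norm satisfies
  \<open>N (X A) \<le> 2 \<parallel>X\<parallel> N A\<close> (\<open>N_compose_left_le\<close>), and compression to rank one gives \<open>\<parallel>A\<parallel> \<le> N A\<close>
  (\<open>norm_le_N\<close>). The first estimate makes \<open>|A\<^sub>\<theta>|\<^sup>2\<close> strongly measurable and integrable in the ideal. The second one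
  allows integrals in the ideal to be computed vector by vector (\<open>bochner_integral_in_modification\<close>).

  Completeness of the characters. By the theorem of Stone and Weierstrass and the regularity of Haar measure,
  trigonometric polynomials are dense in mean square as soon as the characters separate points. Given \<open>a \<noteq> 0\<close>,
  take a continuous function \<open>f\<close> with \<open>f 0 \<noteq> f a\<close>, put \<open>\<phi> = f - f(\<cdot> + a)\<close>, and consider the functions
  \<open>h\<^sub>u(x) = \<langle>(\<phi> * u)(\<cdot> + x), u\<rangle>\<close> for continuous \<open>u\<close> with \<open>\<parallel>u\<parallel>\<^sub>2 \<le> 1\<close>. They are equicontinuous, so that some
  uniform limit \<open>h\<close> of them has maximal norm. Replacing \<open>u\<close> by \<open>u \<plusminus> z u(\<cdot> + b)\<close>, with \<open>z\<close> unimodular, decomposes \<open>h\<close>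
  in a convex way, and strict convexity of the norm implies that \<open>z h(\<cdot> + b) + cnj z h(\<cdot> - b)\<close> is a multiple of
  \<open>h\<close>. With \<open>z = 1\<close> and \<open>z = \<i>\<close> it follows that all translates of \<open>h\<close> are multiples of \<open>h\<close>, and \<open>h\<close> is
  a multiple of a character \<open>c\<close>. If \<open>c a = 1\<close>, then all \<open>h\<^sub>u\<close>, and with them \<open>h\<close>, would be orthogonal to \<open>c\<close>
  by the choice of \<open>\<phi>\<close>, which is absurd (\<open>characters_separate_points\<close>). This variational
  argument takes the place of the spectral theorem for compact operators.
\<close>

section \<open>Complex Hilbert spaces\<close>

lemma cinner_add_right:
  "cinner x (y + z) = cinner x y + cinner x (z :: 'a::separable_chilbert_space)"
  by (metis cinner_commute cinner_add_left complex_cnj_add)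

lemma cinner_scaleC_right:
  "cinner x (c *\<^sub>C y) = cnj c * cinner x (y :: 'a::separable_chilbert_space)"
  by (metis cinner_commute cinner_scaleC_left complex_cnj_mult)

lemma cinner_scaleR_left:
  "cinner (r *\<^sub>R x) y = r *\<^sub>R cinner x (y :: 'a::separable_chilbert_space)"
  by (simp add: scaleR_scaleC cinner_scaleC_left scaleR_conv_of_real)

lemma cinner_scaleR_right:
  "cinner x (r *\<^sub>R y) = r *\<^sub>R cinner x (y :: 'a::separable_chilbert_space)"
  by (simp add: scaleR_scaleC cinner_scaleC_right scaleR_conv_of_real)

lemma Re_cinner_self: "Re (cinner x x) = (norm (x :: 'a::separable_chilbert_space))\<^sup>2"
  by (simp add: cinner_self)

lemma norm_cinner_self: "cmod (cinner x x) = (norm (x :: 'a::separable_chilbert_space))\<^sup>2"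
  unfolding cinner_self norm_of_real by simp

lemma Re_cinner_commute: "Re (cinner x y) = Re (cinner y (x :: 'a::separable_chilbert_space))"
  by (subst cinner_commute) simp

lemma norm_add_square:
  "(norm (x + y))\<^sup>2 = (norm x)\<^sup>2 + (norm y)\<^sup>2 + 2 * Re (cinner x (y :: 'a::separable_chilbert_space))"
proof -
  have "(norm (x + y))\<^sup>2 = Re (cinner (x + y) (x + y))"
    by (simp only: Re_cinner_self)
  also have "\<dots> = Re (cinner x x) + Re (cinner y y) + 2 * Re (cinner x y)"
    using Re_cinner_commute[of y x] by (simp add: cinner_add_left cinner_add_right)
  finally show ?thesis
    by (simp add: Re_cinner_self)
qed

lemma scaleC_neg_one: "(-1) *\<^sub>C x = - (x :: 'a::separable_chilbert_space)"
  using scaleR_scaleC[of "-1" x] by simp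

lemma scaleC_one [simp]: "1 *\<^sub>C x = (x :: 'a::separable_chilbert_space)"
  using scaleR_scaleC[of 1 x] by simp

lemma bounded_bilinear_scaleC:
  "bounded_bilinear (scaleC :: complex \<Rightarrow> 'a \<Rightarrow> 'a::separable_chilbert_space)"
proof
  show "\<exists>K. \<forall>a b. norm (a *\<^sub>C (b::'a)) \<le> norm a * norm b * K"
    by (intro exI[of _ 1]) (simp add: norm_scaleC)
qed (simp_all add: scaleC_add_left scaleC_add_right scaleR_scaleC scaleC_scaleC
      scaleR_conv_of_real mult.commute)

interpretation scaleC: bounded_bilinear "scaleC :: complex \<Rightarrow> 'a \<Rightarrow> 'a::separable_chilbert_space"
  by (rule bounded_bilinear_scaleC)

lemma BH_scaleC: "A \<in> BH \<Longrightarrow> blinfun_apply A (c *\<^sub>C x) = c *\<^sub>C blinfun_apply A x"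
  by (simp add: BH_def)

lemma id_blinfun_BH [simp]: "id_blinfun \<in> BH"
  by (simp add: BH_def)

lemma zero_BH [simp]: "0 \<in> BH"
  by (simp add: BH_def scaleC.zero_right)

lemma add_BH: "A \<in> BH \<Longrightarrow> B \<in> BH \<Longrightarrow> A + B \<in> BH"
  by (simp add: BH_def blinfun.add_left scaleC_add_right)

lemma minus_BH: "A \<in> BH \<Longrightarrow> B \<in> BH \<Longrightarrow> A - B \<in> BH"
  by (simp add: BH_def blinfun.diff_left scaleC.diff_right)

lemma scaleR_BH: "A \<in> BH \<Longrightarrow> r *\<^sub>R A \<in> BH"
  by (simp add: BH_def blinfun.scaleR_left scaleR_scaleC scaleC_scaleC mult.commute)

lemma compose_BH: "A \<in> BH \<Longrightarrow> B \<in> BH \<Longrightarrow> A o\<^sub>L B \<in> BH"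
  by (simp add: BH_def)

lemma op_scaleC_BH: "A \<in> BH \<Longrightarrow> op_scaleC c A \<in> BH"
  by (simp add: BH_def op_scaleC.rep_eq scaleC_scaleC mult.commute)

lemma op_scaleC_of_real: "op_scaleC (complex_of_real r) A = r *\<^sub>R A"
  by (rule blinfun_eqI) (simp add: op_scaleC.rep_eq blinfun.scaleR_left scaleR_scaleC)

lemmas compose_add_left = bounded_bilinear.add_left[OF bounded_bilinear_blinfun_compose]
lemmas compose_add_right = bounded_bilinear.add_right[OF bounded_bilinear_blinfun_compose]
lemmas compose_diff_left = bounded_bilinear.diff_left[OF bounded_bilinear_blinfun_compose]
lemmas compose_diff_right = bounded_bilinear.diff_right[OF bounded_bilinear_blinfun_compose]
lemmas compose_scaleR_left = bounded_bilinear.scaleR_left[OF bounded_bilinear_blinfun_compose]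
lemmas compose_scaleR_right = bounded_bilinear.scaleR_right[OF bounded_bilinear_blinfun_compose]

lemma compose_assoc: "(A o\<^sub>L B) o\<^sub>L C = A o\<^sub>L (B o\<^sub>L C)"
  by (rule blinfun_eqI) simp

lemma compose_id [simp]: "A o\<^sub>L id_blinfun = A" "id_blinfun o\<^sub>L A = A"
  by (rule blinfun_eqI, simp)+

text \<open>Polarization: a sesquilinear form with real values on the diagonal is Hermitian.\<close>

lemma op_positive_hermitian:
  fixes P :: "'h::separable_chilbert_space \<Rightarrow>\<^sub>L 'h"
  assumes "op_positive P"
  shows "cinner (P x) y = cinner x (P y)"
proof -
  let ?q = "\<lambda>x y. cinner (P x) y"
  have P: "P \<in> BH" and real: "Im (?q x x) = 0" for x
    using assms by (auto simp: op_positive_def complex_nonneg_Reals_iff)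
  have "Im (?q (x + c *\<^sub>C y) (x + c *\<^sub>C y)) = Im (cnj c * ?q x y + c * ?q y x)" for c
    using real[of x] real[of y]
    by (simp add: blinfun.add_right BH_scaleC[OF P] cinner_add_left cinner_add_right
        cinner_scaleC_left cinner_scaleC_right algebra_simps)
  then have *: "Im (cnj c * ?q x y + c * ?q y x) = 0" for c
    using real by metis
  have "?q x y = cnj (?q y x)"
    using *[of 1] *[of \<i>] by (simp add: complex_eq_iff)
  then show ?thesis
    by (subst cinner_commute) simp
qed

lemma op_positive_Re_nonneg: "op_positive P \<Longrightarrow> 0 \<le> Re (cinner (P x) x)"
  by (auto simp: op_positive_def complex_nonneg_Reals_iff)

lemma op_positive_BH: "op_positive P \<Longrightarrow> P \<in> BH"
  by (simp add: op_positive_def)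

lemma op_positive_Cauchy_Schwarz:
  fixes P :: "'h::separable_chilbert_space \<Rightarrow>\<^sub>L 'h"
  assumes "op_positive P"
  shows "(cmod (cinner (P x) y))\<^sup>2
    \<le> Re (cinner (P x) x) * Re (cinner (P y) y)"
proof -
  let ?q = "\<lambda>x y. cinner (P x) y"
  define c where "c = ?q x y"
  define a b m where "a = Re (?q x x)" and "b = Re (?q y y)" and "m = (cmod c)\<^sup>2"
  have P: "P \<in> BH"
    using assms by (rule op_positive_BH)
  have yx: "?q y x = cnj c"
    unfolding c_def using op_positive_hermitian[OF assms, of y x] cinner_commute by metis
  have quadratic: "0 \<le> a - 2 * s * m + s\<^sup>2 * m * b" for s :: real
  proof -
    let ?t = "complex_of_real s * c"
    have "?q (x - ?t *\<^sub>C y) (x - ?t *\<^sub>C y)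
        = ?q x x - (cnj ?t * c + ?t * cnj c) + ?t * cnj ?t * ?q y y"
    proof -
      have e: "x - ?t *\<^sub>C y = x + (- ?t) *\<^sub>C y"
        by (simp add: scaleC.minus_left)
      show ?thesis unfolding e
        by (simp add: blinfun.add_right BH_scaleC[OF P] cinner_add_left cinner_add_right
          cinner_scaleC_left cinner_scaleC_right yx c_def[symmetric] algebra_simps)
    qed
    also have "?t * cnj ?t = complex_of_real (s\<^sup>2 * m)"
      using complex_norm_square[of c] by (simp add: m_def power2_eq_square)
    also have "cnj ?t * c + ?t * cnj c = complex_of_real (2 * s * m)"
      using complex_norm_square[of c] by (simp add: m_def)
    finally have "Re (?q (x - ?t *\<^sub>C y) (x - ?t *\<^sub>C y)) = a - 2 * s * m + s\<^sup>2 * m * b"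
      by (simp add: a_def b_def)
    then show ?thesis
      using op_positive_Re_nonneg[OF assms] by metis
  qed
  have b: "b \<ge> 0" and m: "m \<ge> 0"
    using op_positive_Re_nonneg[OF assms] by (auto simp: b_def m_def)
  have "m \<le> a * b"
  proof (cases "b = 0")
    case True
    have "m = 0"
    proof (rule ccontr)
      assume "m \<noteq> 0"
      then show False
        using quadratic[of "(a + 1) / (2 * m)"] True by simp
    qed
    then show ?thesis using True by simp
  next
    case False
    then show ?thesis
      using quadratic[of "1 / b"] b by (simp add: field_simps power2_eq_square)
  qed
  then show ?thesis
    by (simp add: a_def b_def m_def c_def)
qed

lemma op_positive_id: "op_positive (id_blinfun :: 'h::separable_chilbert_space \<Rightarrow>\<^sub>L 'h)"
  by (simp add: op_positive_def cinner_self complex_nonneg_Reals_iff)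

lemma norm_cinner_le: "cmod (cinner x y) \<le> norm x * norm (y :: 'a::separable_chilbert_space)"
proof -
  have "(cmod (cinner x y))\<^sup>2 \<le> (norm x * norm y)\<^sup>2"
    using op_positive_Cauchy_Schwarz[OF op_positive_id, of x y]
    by (simp add: Re_cinner_self power_mult_distrib)
  then show ?thesis
    by (rule power2_le_imp_le) simp
qed

lemma norm_cinner_blinfun_le:
  fixes A :: "'h::separable_chilbert_space \<Rightarrow>\<^sub>L 'h"
  shows "cmod (cinner (A x) y) \<le> norm A * norm x * norm y"
  by (rule order_trans[OF norm_cinner_le mult_right_mono[OF norm_blinfun norm_ge_zero]])

lemma bounded_bilinear_cinner:
  "bounded_bilinear (cinner :: 'a \<Rightarrow> 'a::separable_chilbert_space \<Rightarrow> complex)"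
proof
  show "\<exists>K. \<forall>a b. norm (cinner (a::'a) b) \<le> norm a * norm b * K"
    by (intro exI[of _ 1]) (simp add: norm_cinner_le)
qed (simp_all add: cinner_add_left cinner_add_right cinner_scaleR_left cinner_scaleR_right)

interpretation cinner: bounded_bilinear
  "cinner :: 'a \<Rightarrow> 'a::separable_chilbert_space \<Rightarrow> complex"
  by (rule bounded_bilinear_cinner)

lemma cinner_extensionality:
  assumes "\<And>y. cinner x y = cinner x' (y :: 'a::separable_chilbert_space)"
  shows "x = x'"
proof -
  have "cinner (x - x') (x - x') = 0"
    using assms by (simp add: cinner.diff_left)
  then show ?thesis by (simp add: cinner_self)
qed

lemma cinner_extensionality_right:
  assumes "\<And>x. cinner x y = cinner x (y' :: 'a::separable_chilbert_space)"
  shows "y = y'"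
  using assms by (intro cinner_extensionality) (metis cinner_commute)

text \<open>
  The representing vector of a functional \<open>\<phi>\<close> minimizes \<open>\<parallel>z\<parallel>\<^sup>2 - 2 Re (\<phi> z)\<close>: the parallelogram law
  makes minimizing sequences Cauchy, and the first variation at a minimum is the claim.
\<close>

theorem Riesz_representation:
  fixes \<phi> :: "'a::separable_chilbert_space \<Rightarrow> complex"
  assumes "bounded_linear \<phi>" and hom: "\<And>c x. \<phi> (c *\<^sub>C x) = c * \<phi> x"
  shows "\<exists>z. \<forall>x. \<phi> x = cinner x z"
proof -
  interpret \<phi>: bounded_linear \<phi> by fact
  obtain K where K: "\<And>x. norm (\<phi> x) \<le> norm x * K"
    using \<phi>.bounded by blast
  define F where "F z = (norm z)\<^sup>2 - 2 * Re (\<phi> z)" for z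
  have lower: "- K\<^sup>2 \<le> F z" for z
  proof -
    have "Re (\<phi> z) \<le> norm z * K"
      using K[of z] complex_Re_le_cmod[of "\<phi> z"] by linarith
    moreover have "0 \<le> (norm z - K)\<^sup>2" by simp
    ultimately show ?thesis
      by (simp add: F_def power2_diff)
  qed
  define I where "I = Inf (range F)"
  have bdd: "bdd_below (range F)"
    using lower by (auto intro!: bdd_belowI[of _ "- K\<^sup>2"])
  have I: "I \<le> F z" for z
    unfolding I_def using bdd by (simp add: cInf_lower)
  have "\<exists>z. F z < I + 1 / real (Suc n)" for n
    using cInf_lessD[of "range F" "I + 1 / real (Suc n)"] unfolding I_def by auto
  then obtain z where z: "\<And>n. F (z n) < I + 1 / real (Suc n)"
    by metis
  have midpoint: "(norm (x - y))\<^sup>2 \<le> 2 * F x + 2 * F y - 4 * I" for x y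
  proof -
    let ?m = "(1/2) *\<^sub>R (x + y)"
    have "(norm ?m)\<^sup>2 = (norm (x + y))\<^sup>2 / 4"
      by (simp add: power2_eq_square)
    moreover have "Re (\<phi> ?m) = (Re (\<phi> x) + Re (\<phi> y)) / 2"
      by (simp add: \<phi>.scaleR \<phi>.add)
    ultimately have "4 * F ?m = (norm (x + y))\<^sup>2 - 4 * Re (\<phi> x) - 4 * Re (\<phi> y)"
      unfolding F_def by argo
    moreover have "(norm (x - y))\<^sup>2 = (norm x)\<^sup>2 + (norm y)\<^sup>2 - 2 * Re (cinner x y)"
      using norm_add_square[of x "- y"] by (simp only: cinner.minus_right norm_minus_cancel) simp
    ultimately show ?thesis
      using I[of ?m] norm_add_square[of x y] unfolding F_def by argo
  qed
  have "Cauchy z"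
  proof (rule metric_CauchyI)
    fix e :: real assume e: "e > 0"
    then obtain M where M: "4 / real (Suc M) < e\<^sup>2"
      using reals_Archimedean[of "e\<^sup>2 / 4"] by (auto simp: field_simps)
    have "dist (z m) (z n) < e" if "m \<ge> M" "n \<ge> M" for m n
    proof -
      have *: "F (z k) < I + 1 / real (Suc M)" if "k \<ge> M" for k
        using z[of k] that frac_le[of 1 1 "real (Suc M)" "real (Suc k)"] by simp
      have "(norm (z m - z n))\<^sup>2 < e\<^sup>2"
        using midpoint[of "z m" "z n"] *[OF that(1)] *[OF that(2)] M by simp
      then show ?thesis
        using e by (simp add: dist_norm power2_less_imp_less)
    qed
    then show "\<exists>M. \<forall>m\<ge>M. \<forall>n\<ge>M. dist (z m) (z n) < e" by blast
  qed
  then obtain w where w: "z \<longlonglongrightarrow> w"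
    by (auto simp: Cauchy_convergent_iff convergent_def)
  have "(\<lambda>n. F (z n)) \<longlonglongrightarrow> F w"
    unfolding F_def by (intro tendsto_intros \<phi>.tendsto w)
  moreover have "(\<lambda>n. I + 1 / real (Suc n)) \<longlonglongrightarrow> I + 0"
    by (intro tendsto_add tendsto_const LIMSEQ_Suc[OF lim_1_over_n])
  ultimately have "F w \<le> I + 0"
    using z by (intro LIMSEQ_le[where X = "\<lambda>n. F (z n)"]) (auto intro: less_imp_le)
  then have min: "F w \<le> F y" for y
    using I[of y] by linarith
  have ReE: "Re (\<phi> x) = Re (cinner x w)" for x
  proof -
    have *: "0 \<le> t\<^sup>2 * (norm x)\<^sup>2 + 2 * t * (Re (cinner x w) - Re (\<phi> x))" for t :: real
    proof -
      have "F (w + t *\<^sub>R x) = F w + t\<^sup>2 * (norm x)\<^sup>2 + 2 * t * (Re (cinner x w) - Re (\<phi> x))"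
        unfolding F_def norm_add_square using Re_cinner_commute[of x w]
        by (simp add: \<phi>.add \<phi>.scaleR cinner_scaleR_right power_mult_distrib algebra_simps)
      then show ?thesis using min[of "w + t *\<^sub>R x"] by simp
    qed
    define d where "d = Re (cinner x w) - Re (\<phi> x)"
    define q where "q = 1 + (norm x)\<^sup>2"
    have q: "q > 0" by (simp add: q_def add_pos_nonneg)
    define r where "r = d / q"
    have d: "d = r * q"
      using q by (simp add: r_def)
    have "0 \<le> (- r)\<^sup>2 * (norm x)\<^sup>2 + 2 * (- r) * d"
      unfolding d_def by (rule *)
    also have "\<dots> = - (r\<^sup>2 * (1 + q))"
      unfolding d by (simp add: q_def algebra_simps power2_eq_square)
    finally have "r\<^sup>2 * (1 + q) \<le> 0"
      by simp
    then have "d = 0"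
      using q by (auto simp: d mult_le_0_iff)
    then show ?thesis by (simp add: d_def)
  qed
  have "\<phi> x = cinner x w" for x
    using ReE[of x] ReE[of "\<i> *\<^sub>C x"]
    by (simp add: hom cinner_scaleC_left complex_eq_iff)
  then show ?thesis by blast
qed

section \<open>Adjoints\<close>

lemma op_adjoint_exists:
  assumes A: "A \<in> (BH :: ('h::separable_chilbert_space \<Rightarrow>\<^sub>L 'h) set)"
  shows "\<exists>!B. B \<in> BH \<and> (\<forall>x y. cinner (A x) y = cinner x (B y))"
proof -
  have "\<exists>z. \<forall>x. cinner (A x) y = cinner x z" for y
    by (rule Riesz_representation)
       (simp_all add: BH_scaleC[OF A] cinner_scaleC_left
          bounded_linear_compose[OF cinner.bounded_linear_left blinfun.bounded_linear_right])
  then obtain b where b: "\<And>x y. cinner (A x) y = cinner x (b y)"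
    by metis
  have add: "b (y + z) = b y + b z" for y z
    by (rule cinner_extensionality_right) (simp add: b[symmetric] cinner_add_right)
  have scale: "b (c *\<^sub>C y) = c *\<^sub>C b y" for c y
    by (rule cinner_extensionality_right) (simp add: b[symmetric] cinner_scaleC_right)
  have "norm (b y) \<le> norm y * norm A" for y
  proof -
    have "(norm (b y))\<^sup>2 = cmod (cinner (b y) (b y))"
      by (simp add: cinner_self norm_power)
    also have "\<dots> = cmod (cinner (A (b y)) y)"
      by (simp add: b)
    also have "\<dots> \<le> norm A * norm (b y) * norm y"
      by (rule norm_cinner_blinfun_le)
    finally have "norm (b y) * norm (b y) \<le> norm (b y) * (norm y * norm A)"
      by (simp add: power2_eq_square mult_ac)
    then show ?thesis
      by (cases "norm (b y) = 0") (simp_all add: mult_le_cancel_left)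
  qed
  then have "bounded_linear b"
    by (intro bounded_linear_intro[of _ "norm A"]) (simp_all add: add scaleR_scaleC scale)
  then have "Blinfun b \<in> BH \<and> (\<forall>x y. cinner (A x) y = cinner x (Blinfun b y))"
    by (simp add: BH_def bounded_linear_Blinfun_apply scale b)
  moreover have "B = B'" if "\<forall>x y. cinner (A x) y = cinner x (B y)"
    "\<forall>x y. cinner (A x) y = cinner x (B' y)" for B B' :: "'h \<Rightarrow>\<^sub>L 'h"
    using that by (intro blinfun_eqI cinner_extensionality_right) metis
  ultimately show ?thesis by blast
qed

lemma op_adjoint_spec:
  assumes "A \<in> BH"
  shows "op_adjoint A \<in> BH \<and>
    (\<forall>x y. cinner (A x) y = cinner x (op_adjoint A y))"
  unfolding op_adjoint_def by (rule theI') (rule op_adjoint_exists[OF assms])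

lemma op_adjoint_BH: "A \<in> BH \<Longrightarrow> op_adjoint A \<in> BH"
  by (simp add: op_adjoint_spec)

lemma cinner_op_adjoint:
  assumes "A \<in> BH"
  shows "cinner x (op_adjoint A y) = cinner (A x) y"
  using op_adjoint_spec[OF assms] by simp

lemma cinner_op_adjoint_left:
  assumes "A \<in> BH"
  shows "cinner (op_adjoint A x) y = cinner x (A y)"
  using cinner_op_adjoint[OF assms, of y x] by (metis cinner_commute)

lemma op_adjoint_eqI:
  fixes A B :: "'h::separable_chilbert_space \<Rightarrow>\<^sub>L 'h"
  assumes "A \<in> BH" "\<And>x y. cinner (A x) y = cinner x (B y)"
  shows "op_adjoint A = B"
proof (rule blinfun_eqI, rule cinner_extensionality_right)
  fix y x
  show "cinner x (op_adjoint A y) = cinner x (B y)"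
    using cinner_op_adjoint[OF assms(1)] assms(2) by metis
qed

lemma op_adjoint_diff:
  "A \<in> BH \<Longrightarrow> B \<in> BH \<Longrightarrow> op_adjoint (A - B) = op_adjoint A - op_adjoint B"
  by (rule op_adjoint_eqI)
     (simp_all add: minus_BH blinfun.diff_left cinner.diff_left cinner.diff_right cinner_op_adjoint)

lemma norm_op_adjoint_le:
  assumes "A \<in> BH"
  shows "norm (op_adjoint A) \<le> norm A"
proof (rule norm_blinfun_bound)
  show "norm (op_adjoint A y) \<le> norm A * norm y" for y
  proof -
    define b where "b = (op_adjoint A) y"
    have "cinner b b = cinner (A b) y"
      unfolding b_def by (rule cinner_op_adjoint[OF assms])
    then have "(norm b)\<^sup>2 = cmod (cinner (A b) y)"
      using norm_cinner_self[of b] by (simp only:)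
    also have "\<dots> \<le> norm A * norm b * norm y"
      by (rule norm_cinner_blinfun_le)
    finally have "norm b * norm b \<le> norm b * (norm A * norm y)"
      by (simp add: power2_eq_square mult_ac)
    then show ?thesis
      unfolding b_def[symmetric] by (cases "norm b = 0") (simp_all add: mult_le_cancel_left)
  qed
qed simp

lemma cinner_adjoint_compose_self:
  assumes "A \<in> BH"
  shows "cinner ((op_adjoint A o\<^sub>L A) x) x
    = complex_of_real ((norm (A x))\<^sup>2)"
  using cinner_op_adjoint_left[OF assms, of "A x" x] by (simp add: cinner_self)

lemma adjoint_compose_self_positive:
  assumes "A \<in> BH"
  shows "op_positive (op_adjoint A o\<^sub>L A)"
  unfolding op_positive_def cinner_adjoint_compose_self[OF assms]
  using assms by (simp add: compose_BH op_adjoint_BH complex_nonneg_Reals_iff)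

section \<open>Positive square roots\<close>

definition op_hermitian :: "('h::separable_chilbert_space \<Rightarrow>\<^sub>L 'h) \<Rightarrow> bool" where
  "op_hermitian A \<longleftrightarrow> A \<in> BH \<and>
     (\<forall>x y. cinner (A x) y = cinner x (A y))"

lemma op_hermitian_BH: "op_hermitian A \<Longrightarrow> A \<in> BH"
  by (simp add: op_hermitian_def)

lemma op_hermitianD:
  "op_hermitian A \<Longrightarrow> cinner (A x) y = cinner x (A y)"
  by (simp add: op_hermitian_def)

lemma op_positive_imp_hermitian: "op_positive P \<Longrightarrow> op_hermitian P"
  unfolding op_hermitian_def using op_positive_BH op_positive_hermitian by blast

lemma op_hermitian_add: "op_hermitian A \<Longrightarrow> op_hermitian B \<Longrightarrow> op_hermitian (A + B)"
  unfolding op_hermitian_def by (simp add: add_BH blinfun.add_left cinner_add_left cinner_add_right)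

lemma op_hermitian_diff: "op_hermitian A \<Longrightarrow> op_hermitian B \<Longrightarrow> op_hermitian (A - B)"
  unfolding op_hermitian_def
  by (simp add: minus_BH blinfun.diff_left cinner.diff_left cinner.diff_right)

lemma op_hermitian_scaleR: "op_hermitian A \<Longrightarrow> op_hermitian (r *\<^sub>R A)"
  unfolding op_hermitian_def
  by (simp add: scaleR_BH blinfun.scaleR_left cinner_scaleR_left cinner_scaleR_right)

lemma op_hermitian_square:
  assumes "op_hermitian A"
  shows "op_hermitian (A o\<^sub>L A)"
  unfolding op_hermitian_def
  by (simp add: compose_BH op_hermitian_BH[OF assms] op_hermitianD[OF assms])

lemma op_hermitian_id: "op_hermitian id_blinfun"
  by (simp add: op_hermitian_def)

lemma op_hermitian_zero: "op_hermitian 0"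
  by (simp add: op_hermitian_def cinner.zero_left cinner.zero_right)

lemma op_hermitian_cinner_real:
  assumes "op_hermitian A"
  shows "Im (cinner (A x) x) = 0"
proof -
  have "cinner (A x) x = cnj (cinner (A x) x)"
    using op_hermitianD[OF assms, of x x] cinner_commute by metis
  then have "Im (cinner (A x) x) = Im (cnj (cinner (A x) x))"
    by (rule arg_cong)
  then show ?thesis
    by simp
qed

lemma op_positiveI:
  assumes "op_hermitian A" "\<And>x. 0 \<le> Re (cinner (A x) x)"
  shows "op_positive A"
  unfolding op_positive_def
  using assms(2) op_hermitian_cinner_real[OF assms(1)] op_hermitian_BH[OF assms(1)]
  by (auto simp: complex_nonneg_Reals_iff)

lemma Re_cinner_blinfun_le:
  fixes A :: "'h::separable_chilbert_space \<Rightarrow>\<^sub>L 'h"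
  shows "Re (cinner (A x) x) \<le> norm A * (norm x)\<^sup>2"
  using norm_cinner_blinfun_le[of A x x] complex_Re_le_cmod[of "cinner (A x) x"]
  by (simp add: power2_eq_square mult.assoc)

text \<open>This is the Cauchy-Schwarz inequality for the form of \<open>P\<close> at \<open>x\<close> and \<open>P x\<close>.\<close>

lemma op_positive_norm_square_le:
  fixes P :: "'h::separable_chilbert_space \<Rightarrow>\<^sub>L 'h"
  assumes P: "op_positive P"
    and bound: "\<And>x. Re (cinner (P x) x) \<le> K * (norm x)\<^sup>2"
  shows "(norm (P x))\<^sup>2 \<le> K * Re (cinner (P x) x)"
proof -
  define y where "y = P x"
  define r where "r = Re (cinner y x)"
  have r: "0 \<le> r"
    unfolding r_def y_def by (rule op_positive_Re_nonneg[OF P])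
  have "(cmod (cinner y y))\<^sup>2 \<le> r * Re (cinner (P y) y)"
    unfolding y_def r_def by (rule op_positive_Cauchy_Schwarz[OF P])
  also have "\<dots> \<le> r * (K * (norm y)\<^sup>2)"
    by (intro mult_left_mono bound r)
  finally have le: "(norm y)\<^sup>2 * (norm y)\<^sup>2 \<le> (norm y)\<^sup>2 * (K * r)"
    unfolding norm_cinner_self by (simp add: power2_eq_square mult_ac)
  show ?thesis
  proof (cases "y = 0")
    case True
    then show ?thesis
      unfolding y_def[symmetric] by (simp add: cinner.zero_left)
  next
    case False
    then have "(norm y)\<^sup>2 \<le> K * r"
      by (intro mult_left_le_imp_le[OF le]) simp
    then show ?thesis
      unfolding y_def[symmetric] r_def[symmetric] .
  qed
qed

text \<open>
  The sequence approximates \<open>1 - sqrt (1 - S)\<close>. Applied to numbers in place of operators, it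
  dominates itself: the increments at an operator of norm at most 1 are bounded by
  the increments at the number 1, whose partial sums telescope and are at most 1.
\<close>

primrec sqrt_iteration :: "('h::separable_chilbert_space \<Rightarrow>\<^sub>L 'h) \<Rightarrow> nat \<Rightarrow> 'h \<Rightarrow>\<^sub>L 'h" where
  "sqrt_iteration S 0 = 0"
| "sqrt_iteration S (Suc n) = (1/2) *\<^sub>R (S + (sqrt_iteration S n o\<^sub>L sqrt_iteration S n))"

primrec sqrt_majorant :: "nat \<Rightarrow> real" where
  "sqrt_majorant 0 = 0"
| "sqrt_majorant (Suc n) = (1 + (sqrt_majorant n)\<^sup>2) / 2"

lemma sqrt_majorant_bounds: "0 \<le> sqrt_majorant n" "sqrt_majorant n \<le> 1"
proof -
  show "0 \<le> sqrt_majorant n" for n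
    by (induction n) simp_all
  then show "sqrt_majorant n \<le> 1"
    by (induction n) (simp_all add: power_le_one)
qed

lemma incseq_sqrt_majorant: "incseq sqrt_majorant"
proof (rule incseq_SucI)
  fix n
  have "0 \<le> (1 - sqrt_majorant n)\<^sup>2" by simp
  then show "sqrt_majorant n \<le> sqrt_majorant (Suc n)"
    by (simp add: power2_diff)
qed

lemma sqrt_iteration_hermitian: "op_hermitian S \<Longrightarrow> op_hermitian (sqrt_iteration S n)"
  by (induction n)
     (simp_all add: op_hermitian_zero op_hermitian_scaleR op_hermitian_add op_hermitian_square)

lemma sqrt_iteration_commute:
  assumes "C o\<^sub>L S = S o\<^sub>L C"
  shows "C o\<^sub>L sqrt_iteration S n = sqrt_iteration S n o\<^sub>L C"
proof (induction n)
  case 0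
  show ?case
    by (rule blinfun_eqI) (simp add: blinfun.zero_right)
next
  case (Suc n)
  let ?Y = "sqrt_iteration S n"
  have "C o\<^sub>L (?Y o\<^sub>L ?Y) = (?Y o\<^sub>L ?Y) o\<^sub>L C"
    using Suc by (metis compose_assoc)
  then show ?case
    using assms
    by (simp add: compose_scaleR_left compose_scaleR_right compose_add_left compose_add_right)
qed

lemma norm_compose_le: "norm A \<le> a \<Longrightarrow> norm B \<le> b \<Longrightarrow> norm (A o\<^sub>L B) \<le> a * b"
  by (meson norm_blinfun_compose mult_mono norm_ge_zero order_trans)

lemma norm_sqrt_iteration:
  assumes "norm S \<le> 1"
  shows "norm (sqrt_iteration S n) \<le> sqrt_majorant n"
proof (induction n)
  case (Suc n)
  have "norm (S + (sqrt_iteration S n o\<^sub>L sqrt_iteration S n))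
      \<le> norm S + norm (sqrt_iteration S n o\<^sub>L sqrt_iteration S n)"
    by (rule norm_triangle_ineq)
  also have "\<dots> \<le> 1 + sqrt_majorant n * sqrt_majorant n"
    by (intro add_mono assms norm_compose_le Suc)
  finally show ?case
    by (simp add: power2_eq_square)
qed simp

lemma norm_sqrt_iteration_Suc_diff:
  assumes "norm S \<le> 1"
  shows "norm (sqrt_iteration S (Suc n) - sqrt_iteration S n)
    \<le> sqrt_majorant (Suc n) - sqrt_majorant n"
proof (induction n)
  case 0
  then show ?case using assms by simp
next
  case (Suc n)
  define Y Z where "Y = sqrt_iteration S n" and "Z = sqrt_iteration S (Suc n)"
  define y z where "y = sqrt_majorant n" and "z = sqrt_majorant (Suc n)"
  have comm: "Y o\<^sub>L Z = Z o\<^sub>L Y"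
    unfolding Z_def Y_def
    by (rule sqrt_iteration_commute, rule sqrt_iteration_commute[symmetric]) (rule refl)
  have "sqrt_iteration S (Suc (Suc n)) - sqrt_iteration S (Suc n)
      = (1/2) *\<^sub>R ((S + (Z o\<^sub>L Z)) - (S + (Y o\<^sub>L Y)))"
    unfolding sqrt_iteration.simps(2)[of S "Suc n"] Z_def[symmetric]
    unfolding scaleR_diff_right Y_def Z_def by simp
  also have "\<dots> = (1/2) *\<^sub>R ((Z + Y) o\<^sub>L (Z - Y))"
    by (simp add: compose_add_left compose_diff_right comm)
  finally have "norm (sqrt_iteration S (Suc (Suc n)) - sqrt_iteration S (Suc n))
      = 1/2 * norm ((Z + Y) o\<^sub>L (Z - Y))"
    by simp
  also have "norm ((Z + Y) o\<^sub>L (Z - Y)) \<le> (z + y) * (z - y)"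
  proof (rule norm_compose_le)
    show "norm (Z + Y) \<le> z + y"
      using norm_sqrt_iteration[OF assms] unfolding Z_def Y_def z_def y_def
      by (meson add_mono norm_triangle_ineq order_trans)
    show "norm (Z - Y) \<le> z - y"
      using Suc unfolding Z_def Y_def z_def y_def .
  qed
  also have "1/2 * ((z + y) * (z - y)) = sqrt_majorant (Suc (Suc n)) - sqrt_majorant (Suc n)"
    unfolding sqrt_majorant.simps(2)[of "Suc n"] z_def[symmetric]
    by (simp add: z_def y_def[symmetric] field_simps power2_eq_square)
  finally show ?case by simp
qed

lemma Cauchy_sqrt_iteration:
  assumes "norm S \<le> 1"
  shows "Cauchy (sqrt_iteration S)"
proof -
  have le: "dist (sqrt_iteration S m) (sqrt_iteration S n) \<le> dist (sqrt_majorant m) (sqrt_majorant n)"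
    if "m \<le> n" for m n
    using that
  proof (induction n rule: dec_induct)
    case (step n)
    have "dist (sqrt_iteration S m) (sqrt_iteration S (Suc n))
        \<le> dist (sqrt_iteration S m) (sqrt_iteration S n)
          + norm (sqrt_iteration S (Suc n) - sqrt_iteration S n)"
      by (metis dist_norm dist_commute dist_triangle)
    also have "\<dots> \<le> (sqrt_majorant n - sqrt_majorant m) + (sqrt_majorant (Suc n) - sqrt_majorant n)"
      using step norm_sqrt_iteration_Suc_diff[OF assms, of n] incseqD[OF incseq_sqrt_majorant, of m n]
      by (intro add_mono) (simp_all add: dist_real_def)
    also have "\<dots> = dist (sqrt_majorant m) (sqrt_majorant (Suc n))"
      using incseqD[OF incseq_sqrt_majorant, of m "Suc n"] step(1) by (simp add: dist_real_def)
    finally show ?case .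
  qed simp
  have "Cauchy sqrt_majorant"
    using incseq_sqrt_majorant sqrt_majorant_bounds
    by (intro convergent_Cauchy Bseq_monoseq_convergent)
       (auto simp: incseq_imp_monoseq intro!: BseqI[of 1])
  show ?thesis
  proof (rule metric_CauchyI)
    fix e :: real assume "e > 0"
    then obtain M where M: "\<And>m n. m \<ge> M \<Longrightarrow> n \<ge> M \<Longrightarrow> dist (sqrt_majorant m) (sqrt_majorant n) < e"
      using metric_CauchyD[OF \<open>Cauchy sqrt_majorant\<close>] by blast
    have "dist (sqrt_iteration S m) (sqrt_iteration S n) < e" if "m \<ge> M" "n \<ge> M" for m n
      using le[of m n] le[of n m] M[OF that] by (cases "m \<le> n") (simp_all add: dist_commute)
    then show "\<exists>M. \<forall>m\<ge>M. \<forall>n\<ge>M. dist (sqrt_iteration S m) (sqrt_iteration S n) < e"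
      by blast
  qed
qed

lemma op_hermitian_limit:
  assumes "\<And>n. op_hermitian (Y n)" "Y \<longlonglongrightarrow> L"
  shows "op_hermitian L"
proof -
  have lim: "(\<lambda>n. (Y n) x) \<longlonglongrightarrow> L x" for x
    by (intro tendsto_intros assms(2))
  have "L (c *\<^sub>C x) = c *\<^sub>C L x" for c x
  proof (rule LIMSEQ_unique[OF lim])
    show "(\<lambda>n. (Y n) (c *\<^sub>C x)) \<longlonglongrightarrow> c *\<^sub>C L x"
      using scaleC.tendsto[OF tendsto_const lim] BH_scaleC[OF op_hermitian_BH[OF assms(1)]] by simp
  qed
  moreover have "cinner (L x) y = cinner x (L y)" for x y
  proof (rule LIMSEQ_unique)
    show "(\<lambda>n. cinner (Y n x) y) \<longlonglongrightarrow> cinner (L x) y"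
      by (intro cinner.tendsto tendsto_const lim)
    show "(\<lambda>n. cinner (Y n x) y) \<longlonglongrightarrow> cinner x (L y)"
      unfolding op_hermitianD[OF assms(1)] by (intro cinner.tendsto tendsto_const lim)
  qed
  ultimately show ?thesis
    unfolding op_hermitian_def BH_def by blast
qed

text \<open>
  A root is constructed together with its commutant: roots of an operator are compared by means of
  the fact that one of them commutes with everything that commutes with the operator.
\<close>

lemma positive_root_contraction:
  fixes T :: "'h::separable_chilbert_space \<Rightarrow>\<^sub>L 'h"
  assumes T: "op_positive T" and "norm T \<le> 1"
  shows "\<exists>P. op_positive P \<and> P o\<^sub>L P = T \<and> (\<forall>C. C o\<^sub>L T = T o\<^sub>L C \<longrightarrow> C o\<^sub>L P = P o\<^sub>L C)"
proof -
  define S where "S = id_blinfun - T"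
  have S: "op_hermitian S"
    unfolding S_def by (intro op_hermitian_diff op_hermitian_id op_positive_imp_hermitian T)
  have Sx: "Re (cinner (S x) x) = (norm x)\<^sup>2 - Re (cinner (T x) x)" for x
    by (simp add: S_def blinfun.diff_left cinner.diff_left Re_cinner_self)
  have posS: "op_positive S"
  proof (rule op_positiveI[OF S])
    fix x :: 'h
    have "norm T * (norm x)\<^sup>2 \<le> 1 * (norm x)\<^sup>2"
      using assms(2) by (intro mult_right_mono) auto
    then show "0 \<le> Re (cinner (S x) x)"
      using Sx[of x] Re_cinner_blinfun_le[of T x] by linarith
  qed
  have S1: "Re (cinner (S x) x) \<le> 1 * (norm x)\<^sup>2" for x
    using Sx[of x] op_positive_Re_nonneg[OF T, of x] by simp
  have normS: "norm S \<le> 1"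
  proof (rule norm_blinfun_bound)
    fix x :: 'h
    have "(norm (S x))\<^sup>2 \<le> (norm x)\<^sup>2"
      using op_positive_norm_square_le[OF posS S1, of x] S1[of x] by linarith
    then show "norm (S x) \<le> 1 * norm x"
      by (simp add: power2_le_iff_abs_le)
  qed simp
  obtain Y where Y: "sqrt_iteration S \<longlonglongrightarrow> Y"
    using Cauchy_sqrt_iteration[OF normS] by (auto simp: Cauchy_convergent_iff convergent_def)
  have hermY: "op_hermitian Y"
    by (rule op_hermitian_limit[OF sqrt_iteration_hermitian[OF S] Y])
  have normY: "norm Y \<le> 1"
    by (rule Lim_norm_ubound[OF _ Y])
       (auto intro!: always_eventually order_trans[OF norm_sqrt_iteration[OF normS]] sqrt_majorant_bounds)
  have fixpoint: "Y = (1/2) *\<^sub>R (S + (Y o\<^sub>L Y))"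
  proof (rule LIMSEQ_unique[OF LIMSEQ_Suc[OF Y]])
    show "(\<lambda>n. sqrt_iteration S (Suc n)) \<longlonglongrightarrow> (1/2) *\<^sub>R (S + (Y o\<^sub>L Y))"
      unfolding sqrt_iteration.simps
      by (intro tendsto_scaleR tendsto_add tendsto_const
          bounded_bilinear.tendsto[OF bounded_bilinear_blinfun_compose] Y)
  qed
  define P where "P = id_blinfun - Y"
  have "op_positive P"
  proof (rule op_positiveI)
    show "op_hermitian P"
      unfolding P_def by (intro op_hermitian_diff op_hermitian_id hermY)
    fix x :: 'h
    have "norm Y * (norm x)\<^sup>2 \<le> 1 * (norm x)\<^sup>2"
      using normY by (intro mult_right_mono) auto
    then have "Re (cinner (Y x) x) \<le> (norm x)\<^sup>2"
      using Re_cinner_blinfun_le[of Y x] by linarith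
    then show "0 \<le> Re (cinner (P x) x)"
      by (simp add: P_def blinfun.diff_left cinner.diff_left Re_cinner_self)
  qed
  moreover have "P o\<^sub>L P = T"
  proof -
    have "P o\<^sub>L P = id_blinfun - 2 *\<^sub>R Y + (Y o\<^sub>L Y)"
      unfolding P_def by (simp add: compose_diff_left compose_diff_right scaleR_2)
    also have "2 *\<^sub>R Y = S + (Y o\<^sub>L Y)"
      by (subst fixpoint) simp
    finally show ?thesis
      by (simp add: S_def)
  qed
  moreover have "C o\<^sub>L P = P o\<^sub>L C" if C: "C o\<^sub>L T = T o\<^sub>L C" for C
  proof -
    have CS: "C o\<^sub>L S = S o\<^sub>L C"
      unfolding S_def using C by (simp add: compose_diff_left compose_diff_right)
    have "C o\<^sub>L Y = Y o\<^sub>L C"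
    proof (rule LIMSEQ_unique)
      show "(\<lambda>n. C o\<^sub>L sqrt_iteration S n) \<longlonglongrightarrow> (C o\<^sub>L Y)"
        by (intro bounded_bilinear.tendsto[OF bounded_bilinear_blinfun_compose] tendsto_const Y)
      show "(\<lambda>n. C o\<^sub>L sqrt_iteration S n) \<longlonglongrightarrow> (Y o\<^sub>L C)"
        unfolding sqrt_iteration_commute[OF CS]
        by (intro bounded_bilinear.tendsto[OF bounded_bilinear_blinfun_compose] tendsto_const Y)
    qed
    then show ?thesis
      unfolding P_def by (simp add: compose_diff_left compose_diff_right)
  qed
  ultimately show ?thesis by blast
qed

lemma op_positive_scaleR:
  assumes "op_positive P" "0 \<le> r"
  shows "op_positive (r *\<^sub>R P)"
  by (rule op_positiveI)
     (simp_all add: op_hermitian_scaleR op_positive_imp_hermitian[OF assms(1)] blinfun.scaleR_left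
        cinner_scaleR_left op_positive_Re_nonneg[OF assms(1)] assms(2))

lemma positive_root_commuting:
  fixes T :: "'h::separable_chilbert_space \<Rightarrow>\<^sub>L 'h"
  assumes T: "op_positive T"
  shows "\<exists>P. op_positive P \<and> P o\<^sub>L P = T \<and> (\<forall>C. C o\<^sub>L T = T o\<^sub>L C \<longrightarrow> C o\<^sub>L P = P o\<^sub>L C)"
proof -
  define c where "c = norm T + 1"
  have c: "c > 0"
    by (simp add: c_def add_nonneg_pos)
  have "op_positive (inverse c *\<^sub>R T)" "norm (inverse c *\<^sub>R T) \<le> 1"
    using c by (simp_all add: op_positive_scaleR T c_def divide_simps)
  then obtain P where P: "op_positive P" "P o\<^sub>L P = inverse c *\<^sub>R T"
    and comm: "\<And>C. C o\<^sub>L (inverse c *\<^sub>R T) = (inverse c *\<^sub>R T) o\<^sub>L C \<Longrightarrow> C o\<^sub>L P = P o\<^sub>L C"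
    using positive_root_contraction[of "inverse c *\<^sub>R T"] by blast
  have "op_positive (sqrt c *\<^sub>R P)"
    using c by (intro op_positive_scaleR P) simp
  moreover have "(sqrt c *\<^sub>R P) o\<^sub>L (sqrt c *\<^sub>R P) = T"
  proof -
    have "sqrt c * (sqrt c * inverse c) = 1"
      using c by (simp flip: mult.assoc)
    then show ?thesis
      unfolding compose_scaleR_left compose_scaleR_right P(2) scaleR_scaleR by simp
  qed
  moreover have "C o\<^sub>L (sqrt c *\<^sub>R P) = (sqrt c *\<^sub>R P) o\<^sub>L C" if "C o\<^sub>L T = T o\<^sub>L C" for C
    using comm[of C] that by (simp add: compose_scaleR_left compose_scaleR_right)
  ultimately show ?thesis by blast
qed

lemma op_positive_apply_eq_zero:
  assumes "op_positive P" "Re (cinner (P x) x) = 0"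
  shows "P x = 0"
  using op_positive_norm_square_le[OF assms(1) Re_cinner_blinfun_le, of x] assms(2) by simp

text \<open>
  Since \<open>(P + Q) (P - Q) = 0\<close>, the forms of \<open>P\<close> and \<open>Q\<close>, both nonnegative, vanish on the range of \<open>P - Q\<close>.
  Hence \<open>(P - Q)\<^sup>2 = 0\<close>.
\<close>

lemma positive_root_unique:
  fixes P Q :: "'h::separable_chilbert_space \<Rightarrow>\<^sub>L 'h"
  assumes P: "op_positive P" and Q: "op_positive Q" and eq: "P o\<^sub>L P = Q o\<^sub>L Q"
    and comm: "Q o\<^sub>L P = P o\<^sub>L Q"
  shows "P = Q"
proof (rule blinfun_eqI)
  fix x
  define D where "D = P - Q"
  define y where "y = D x"
  have "(P + Q) o\<^sub>L D = 0"
    unfolding D_def by (simp add: compose_add_left compose_diff_right eq comm)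
  then have "(P + Q) y = 0"
    unfolding y_def by (metis blinfun_apply_blinfun_compose blinfun.zero_left)
  then have "cinner (P y + Q y) y = 0"
    by (simp add: blinfun.add_left cinner.zero_left)
  then have "Re (cinner (P y) y + cinner (Q y) y) = 0"
    unfolding cinner_add_left by simp
  then have "Re (cinner (P y) y) + Re (cinner (Q y) y) = 0"
    by simp
  then have "Re (cinner (P y) y) = 0" "Re (cinner (Q y) y) = 0"
    using op_positive_Re_nonneg[OF P, of y] op_positive_Re_nonneg[OF Q, of y] by linarith+
  then have "P y = 0" "Q y = 0"
    using op_positive_apply_eq_zero[OF P] op_positive_apply_eq_zero[OF Q] by blast+
  then have "D y = 0"
    by (simp add: D_def blinfun.diff_left)
  moreover have "op_hermitian D"
    unfolding D_def by (intro op_hermitian_diff op_positive_imp_hermitian P Q)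
  ultimately have "cinner y y = 0"
    using op_hermitianD[of D x y] by (simp add: y_def cinner.zero_right)
  then have "y = 0"
    by (simp add: cinner_self)
  then show "P x = Q x"
    by (simp add: y_def D_def blinfun.diff_left)
qed

lemma op_sqrt_spec:
  assumes "op_positive T"
  shows "op_positive (op_sqrt T) \<and> op_sqrt T o\<^sub>L op_sqrt T = T"
  unfolding op_sqrt_def
proof (rule theI')
  obtain P where P: "op_positive P" "P o\<^sub>L P = T"
    and comm: "\<And>C. C o\<^sub>L T = T o\<^sub>L C \<Longrightarrow> C o\<^sub>L P = P o\<^sub>L C"
    using positive_root_commuting[OF assms] by blast
  have "Q = P" if Q: "op_positive Q" "Q o\<^sub>L Q = T" for Q
  proof -
    have "Q o\<^sub>L T = T o\<^sub>L Q"
      unfolding Q(2)[symmetric] by (rule compose_assoc[symmetric])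
    then show ?thesis
      using positive_root_unique[OF P(1) Q(1)] comm P(2) Q(2) by metis
  qed
  then show "\<exists>!P. op_positive P \<and> P o\<^sub>L P = T"
    using P by blast
qed

lemma op_abs_compose_self:
  assumes "A \<in> BH"
  shows "op_abs A o\<^sub>L op_abs A = op_adjoint A o\<^sub>L A"
  unfolding op_abs_def using op_sqrt_spec[OF adjoint_compose_self_positive[OF assms]] by blast

section \<open>Unitarily invariant norms\<close>

lemma op_unitaryI:
  fixes U V :: "'h::separable_chilbert_space \<Rightarrow>\<^sub>L 'h"
  assumes "U \<in> BH" "\<And>x y. cinner (U x) y = cinner x (V y)"
    and "\<And>x. V (U x) = x" "\<And>x. U (V x) = x"
  shows "op_unitary U"
proof -
  have "op_adjoint U = V"
    by (rule op_adjoint_eqI[OF assms(1,2)])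
  moreover have "V o\<^sub>L U = id_blinfun" "U o\<^sub>L V = id_blinfun"
    by (rule blinfun_eqI, simp add: assms(3,4))+
  ultimately show ?thesis
    unfolding op_unitary_def using assms(1) by simp
qed

lemma op_unitary_id: "op_unitary (id_blinfun :: 'h::separable_chilbert_space \<Rightarrow>\<^sub>L 'h)"
  by (rule op_unitaryI[where V = id_blinfun]) simp_all

text \<open>The unitaries are \<open>X \<plusminus> \<i> sqrt (1 - X\<^sup>2)\<close>, as for real numbers in the unit interval.\<close>

lemma hermitian_contraction_mean_of_unitaries:
  fixes X :: "'h::separable_chilbert_space \<Rightarrow>\<^sub>L 'h"
  assumes X: "op_hermitian X" and "norm X \<le> 1"
  shows "\<exists>U V. op_unitary U \<and> op_unitary V \<and> X = (1/2) *\<^sub>R (U + V)"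
proof -
  define T where "T = id_blinfun - (X o\<^sub>L X)"
  have "op_positive T"
  proof (rule op_positiveI)
    show "op_hermitian T"
      unfolding T_def by (intro op_hermitian_diff op_hermitian_id op_hermitian_square X)
    fix x :: 'h
    have "norm (X x) \<le> 1 * norm x"
      using norm_blinfun[of X x] mult_right_mono[OF assms(2), of "norm x"] by simp
    then have "(norm (X x))\<^sup>2 \<le> (norm x)\<^sup>2"
      by (simp add: power_mono)
    moreover have "cinner (X (X x)) x
        = cinner (X x) (X x)"
      by (rule op_hermitianD[OF X])
    ultimately show "0 \<le> Re (cinner (T x) x)"
      by (simp add: T_def blinfun.diff_left cinner.diff_left Re_cinner_self)
  qed
  then obtain R where R: "op_positive R" "R o\<^sub>L R = T"
    and comm: "\<And>C. C o\<^sub>L T = T o\<^sub>L C \<Longrightarrow> C o\<^sub>L R = R o\<^sub>L C"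
    using positive_root_commuting by blast
  have "X o\<^sub>L T = T o\<^sub>L X"
    unfolding T_def by (simp add: compose_diff_left compose_diff_right compose_assoc)
  then have XR: "X (R x) = R (X x)" for x
    using comm by (metis blinfun_apply_blinfun_compose)
  have RR: "R (R x) = x - X (X x)" for x
    using arg_cong[OF R(2), of "\<lambda>B. blinfun_apply B x"] by (simp add: T_def blinfun.diff_left)
  note X_BH = op_hermitian_BH[OF X] and R_BH = op_positive_BH[OF R(1)]
  define U V where "U = X + op_scaleC \<i> R" and "V = X - op_scaleC \<i> R"
  have U: "U x = X x + \<i> *\<^sub>C R x"
    and V: "V x = X x - \<i> *\<^sub>C R x" for x
    by (simp_all add: U_def V_def blinfun.add_left blinfun.diff_left op_scaleC.rep_eq)
  have UV_BH: "U \<in> BH" "V \<in> BH"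
    unfolding U_def V_def by (intro add_BH minus_BH op_scaleC_BH X_BH R_BH)+
  have adj: "cinner (U x) y = cinner x (V y)" for x y
    unfolding U V cinner_add_left cinner.diff_right cinner_scaleC_left cinner_scaleC_right
      op_hermitianD[OF X, of x y] op_positive_hermitian[OF R(1), of x y] by simp
  have adj': "cinner (V x) y = cinner x (U y)" for x y
    using adj[of y x] by (metis cinner_commute)
  have VU: "V (U x) = x" for x
    unfolding U V blinfun.add_right BH_scaleC[OF X_BH] BH_scaleC[OF R_BH] XR RR
    by (simp add: scaleC_add_right scaleC.diff_right scaleC_scaleC scaleC_neg_one scaleC.minus_left)
  have UV: "U (V x) = x" for x
    unfolding U V blinfun.diff_right BH_scaleC[OF X_BH] BH_scaleC[OF R_BH] XR RR
    by (simp add: scaleC_add_right scaleC.diff_right scaleC_scaleC scaleC_neg_one scaleC.minus_left)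
  have "op_unitary U" "op_unitary V"
    by (rule op_unitaryI[OF UV_BH(1) adj VU UV], rule op_unitaryI[OF UV_BH(2) adj' UV VU])
  moreover have "X = (1/2) *\<^sub>R (U + V)"
    unfolding U_def V_def by (simp flip: scaleR_2)
  ultimately show ?thesis by blast
qed

lift_definition rank_one_projection :: "'h::separable_chilbert_space \<Rightarrow> 'h \<Rightarrow>\<^sub>L 'h"
  is "\<lambda>u x. cinner x u *\<^sub>C u"
  by (rule bounded_linear_compose[OF scaleC.bounded_linear_left cinner.bounded_linear_left])

lemma rank_one_projection_BH: "rank_one_projection u \<in> BH"
  by (simp add: BH_def rank_one_projection.rep_eq cinner_scaleC_left scaleC_scaleC)

text \<open>A reflection is unitary, hence a rank one projection is a mean of unitaries too.\<close>

lemma rank_one_projection_mean_of_unitaries: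
  fixes u :: "'h::separable_chilbert_space"
  assumes "norm u = 1"
  shows "\<exists>U. op_unitary U \<and> rank_one_projection u = (1/2) *\<^sub>R (id_blinfun + U)"
proof -
  let ?P = "rank_one_projection u"
  define U where "U = 2 *\<^sub>R ?P - id_blinfun"
  have U: "U x = 2 *\<^sub>R (cinner x u *\<^sub>C u) - x" for x
    by (simp add: U_def blinfun.diff_left blinfun.scaleR_left rank_one_projection.rep_eq)
  have uu: "cinner u u = 1"
    by (simp add: cinner_self assms)
  have Uu: "U u = u"
    by (simp add: U uu scaleR_2)
  have BH: "U \<in> BH"
    unfolding U_def by (intro minus_BH scaleR_BH rank_one_projection_BH id_blinfun_BH)
  have adj: "cinner (U x) y = cinner x (U y)" for x y
    unfolding U cinner.diff_left cinner.diff_right cinner_scaleR_left cinner_scaleR_right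
      cinner_scaleC_left cinner_scaleC_right using cinner_commute[of u y] by (simp add: mult.commute)
  have UU: "U (U x) = x" for x
    unfolding U[of x] blinfun.diff_right blinfun.scaleR_right BH_scaleC[OF BH] Uu
    unfolding U[of x] by simp
  have "op_unitary U"
    by (rule op_unitaryI[OF BH adj UU UU])
  moreover have "?P = (1/2) *\<^sub>R (id_blinfun + U)"
    by (simp add: U_def)
  ultimately show ?thesis by blast
qed

context unitarily_invariant_norm
begin

lemma compose_left_mem: "A \<in> J \<Longrightarrow> X \<in> BH \<Longrightarrow> X o\<^sub>L A \<in> J"
  using ideal[of A X id_blinfun] by simp

lemma compose_right_mem: "A \<in> J \<Longrightarrow> X \<in> BH \<Longrightarrow> A o\<^sub>L X \<in> J"
  using ideal[of A id_blinfun X] by simp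

lemma mem_BH: "A \<in> J \<Longrightarrow> A \<in> BH"
  using subset_BH by blast

lemma op_scaleC_mem:
  assumes "A \<in> J"
  shows "op_scaleC c A \<in> J"
proof -
  have "op_scaleC c id_blinfun o\<^sub>L A = op_scaleC c A"
    by (rule blinfun_eqI) (simp add: op_scaleC.rep_eq)
  then show ?thesis
    using compose_left_mem[OF assms op_scaleC_BH[OF id_blinfun_BH]] by metis
qed

lemma scaleR_mem: "A \<in> J \<Longrightarrow> r *\<^sub>R A \<in> J"
  using op_scaleC_mem[of A "complex_of_real r"] by (simp add: op_scaleC_of_real)

lemma N_scaleR: "A \<in> J \<Longrightarrow> N (r *\<^sub>R A) = \<bar>r\<bar> * N A"
  using scale[of A "complex_of_real r"] by (simp add: op_scaleC_of_real)

lemma minus_mem: "A \<in> J \<Longrightarrow> - A \<in> J"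
  using scaleR_mem[of A "-1"] by simp

lemma N_minus: "A \<in> J \<Longrightarrow> N (- A) = N A"
  using N_scaleR[of A "-1"] by simp

lemma diff_mem: "A \<in> J \<Longrightarrow> B \<in> J \<Longrightarrow> A - B \<in> J"
  using add_mem[of A "- B"] minus_mem[of B] by simp

lemma N_diff_le: "A \<in> J \<Longrightarrow> B \<in> J \<Longrightarrow> N (A - B) \<le> N A + N B"
  using triangle[of A "- B"] minus_mem[of B] N_minus[of B] by simp

lemma N_diff_commute: "A \<in> J \<Longrightarrow> B \<in> J \<Longrightarrow> N (A - B) = N (B - A)"
  using N_minus[OF diff_mem, of A B] by simp

lemma N_diff_triangle:
  "A \<in> J \<Longrightarrow> B \<in> J \<Longrightarrow> C \<in> J \<Longrightarrow> N (A - C) \<le> N (A - B) + N (B - C)"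
  using triangle[of "A - B" "B - C"] diff_mem by simp

lemma N_le_add_diff: "A \<in> J \<Longrightarrow> B \<in> J \<Longrightarrow> N A \<le> N B + N (A - B)"
  using triangle[of B "A - B"] diff_mem by simp

lemma abs_N_diff_le:
  assumes "A \<in> J" "B \<in> J"
  shows "\<bar>N A - N B\<bar> \<le> N (A - B)"
  using N_le_add_diff[OF assms] N_le_add_diff[OF assms(2,1)] N_diff_commute[OF assms] by linarith

lemma N_zero: "N 0 = 0"
  using eq_zero_iff zero_mem by blast

lemma sum_mem: "(\<And>i. i \<in> I \<Longrightarrow> f i \<in> J) \<Longrightarrow> sum f I \<in> J"
  by (induction I rule: infinite_finite_induct) (simp_all add: zero_mem add_mem)

lemma N_sum_le:
  "(\<And>i. i \<in> I \<Longrightarrow> f i \<in> J) \<Longrightarrow> N (sum f I) \<le> (\<Sum>i\<in>I. N (f i))"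
proof (induction I rule: infinite_finite_induct)
  case (insert i I)
  have "N (f i + sum f I) \<le> N (f i) + N (sum f I)"
    using insert.prems by (intro triangle sum_mem) auto
  then show ?case
    using insert by simp
qed (simp_all add: N_zero)

lemma N_mean_le: "A \<in> J \<Longrightarrow> B \<in> J \<Longrightarrow> N A \<le> a \<Longrightarrow> N B \<le> a \<Longrightarrow> N ((1/2) *\<^sub>R (A + B)) \<le> a"
  using triangle[of A B] add_mem[of A B] by (simp add: N_scaleR)

lemma op_unitary_BH: "op_unitary U \<Longrightarrow> U \<in> BH"
  by (simp add: op_unitary_def)

lemma N_unitary_left: "A \<in> J \<Longrightarrow> op_unitary U \<Longrightarrow> N (U o\<^sub>L A) = N A"
  using unitary_inv[of A U id_blinfun] op_unitary_id by simp

lemma N_unitary_right: "A \<in> J \<Longrightarrow> op_unitary U \<Longrightarrow> N (A o\<^sub>L U) = N A"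
  using unitary_inv[of A id_blinfun U] op_unitary_id by simp

lemma N_mean_unitary_left_le:
  assumes "A \<in> J" "op_unitary U" "op_unitary V"
  shows "N ((1/2) *\<^sub>R (U + V) o\<^sub>L A) \<le> N A"
  unfolding compose_scaleR_left compose_add_left using assms
  by (intro N_mean_le compose_left_mem op_unitary_BH) (simp_all add: N_unitary_left)

lemma N_mean_unitary_right_le:
  assumes "A \<in> J" "op_unitary U" "op_unitary V"
  shows "N (A o\<^sub>L (1/2) *\<^sub>R (U + V)) \<le> N A"
  unfolding compose_scaleR_right compose_add_right using assms
  by (intro N_mean_le compose_right_mem op_unitary_BH) (simp_all add: N_unitary_right)

text \<open>
  Compressing \<open>A\<close> to one-dimensional subspaces on both sides does not increase the norm and leads
  to a rank one operator, where the norm is known.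
\<close>

lemma norm_le_N:
  assumes A: "A \<in> J"
  shows "norm A \<le> N A"
proof (rule norm_blinfun_bound)
  show "0 \<le> N A"
    using A by (rule nonneg)
  fix x
  define y where "y = A x"
  show "norm (A x) \<le> N A * norm x"
  proof (cases "y = 0")
    case True
    then show ?thesis
      using nonneg[OF A] by (simp add: y_def)
  next
    case False
    then have x: "norm x > 0"
      by (auto simp: y_def blinfun.zero_right)
    define u v where "u = x /\<^sub>R norm x" and "v = y /\<^sub>R norm y"
    have unit: "norm u = 1" "norm v = 1"
      using x False by (simp_all add: u_def v_def)
    have v: "v \<noteq> 0"
      using unit by auto
    define a where "a = cinner (A u) v"
    have Au: "A u = (norm y / norm x) *\<^sub>R v"
      using False by (simp add: u_def v_def blinfun.scaleR_right y_def divide_inverse mult.commute)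
    have a: "a = complex_of_real (norm y / norm x)"
      unfolding a_def Au cinner_scaleR_left by (simp add: cinner_self unit scaleR_conv_of_real)
    have a0: "a \<noteq> 0"
      using False x by (simp add: a)
    obtain U V where U: "op_unitary U" "rank_one_projection v = (1/2) *\<^sub>R (id_blinfun + U)"
      and V: "op_unitary V" "rank_one_projection u = (1/2) *\<^sub>R (id_blinfun + V)"
      using rank_one_projection_mean_of_unitaries unit by metis
    define B where "B = rank_one_projection v o\<^sub>L A o\<^sub>L rank_one_projection u"
    have B: "B w = (cinner w u * a) *\<^sub>C v" for w
      by (simp add: B_def rank_one_projection.rep_eq BH_scaleC[OF mem_BH[OF A]] cinner_scaleC_left a_def)
    have "B \<in> BH"
      unfolding B_def by (intro compose_BH rank_one_projection_BH mem_BH A)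
    moreover have "range (blinfun_apply B) = range (\<lambda>c. c *\<^sub>C v)"
    proof (intro equalityI image_subsetI)
      show "B w \<in> range (\<lambda>c. c *\<^sub>C v)" for w
        unfolding B by blast
      show "c *\<^sub>C v \<in> range (blinfun_apply B)" for c
      proof (rule range_eqI)
        show "c *\<^sub>C v = B ((c / a) *\<^sub>C u)"
          unfolding B cinner_scaleC_left using a0 by (simp add: cinner_self unit)
      qed
    qed
    ultimately have "op_rank_one B"
      unfolding op_rank_one_def using v by blast
    then have NB: "N B = norm B"
      using rank_one by blast
    have "norm y / norm x = norm (B u)"
      unfolding B norm_scaleC a by (simp add: cinner_self unit norm_divide)
    also have "\<dots> \<le> norm B"
      using norm_blinfun[of B u] by (simp add: unit)
    also have "\<dots> \<le> N (rank_one_projection v o\<^sub>L A)"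
      unfolding NB[symmetric] unfolding B_def V(2)
      by (intro N_mean_unitary_right_le compose_left_mem A rank_one_projection_BH op_unitary_id V)
    also have "\<dots> \<le> N A"
      unfolding U(2) by (intro N_mean_unitary_left_le A op_unitary_id U)
    finally show ?thesis
      using x by (simp add: y_def field_simps)
  qed
qed

lemma N_hermitian_contraction_left_le:
  assumes "A \<in> J" "op_hermitian X" "norm X \<le> 1"
  shows "N (X o\<^sub>L A) \<le> N A"
  using hermitian_contraction_mean_of_unitaries[OF assms(2,3)] N_mean_unitary_left_le[OF assms(1)]
  by blast

text \<open>
  The factor 2 comes from treating the real and the imaginary part of \<open>X\<close> separately. The optimal
  constant is 1, but any constant serves here.
\<close>

lemma N_compose_left_le:
  assumes A: "A \<in> J" and X: "X \<in> BH"
  shows "N (X o\<^sub>L A) \<le> 2 * norm X * N A"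
proof -
  have unit: "N (X o\<^sub>L A) \<le> 2 * N A" if X: "X \<in> BH" and norm: "norm X \<le> 1" for X
  proof -
    let ?X' = "op_adjoint X"
    note X' = op_adjoint_BH[OF X]
    define R I where "R = (1/2) *\<^sub>R (X + ?X')" and "I = (1/2) *\<^sub>R op_scaleC (-\<i>) (X - ?X')"
    have norm': "norm ?X' \<le> 1"
      using norm_op_adjoint_le[OF X] norm by linarith
    have norm_scale: "norm (op_scaleC c B) \<le> cmod c * norm B" for c and B :: "'h \<Rightarrow>\<^sub>L 'h"
      by (rule norm_blinfun_bound)
        (simp_all add: op_scaleC.rep_eq norm_scaleC mult.assoc mult_left_mono norm_blinfun)
    have R: "op_hermitian R"
      unfolding op_hermitian_def R_def
      by (simp add: scaleR_BH add_BH X X' blinfun.scaleR_left blinfun.add_left cinner_scaleR_left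
          cinner_scaleR_right cinner_add_left cinner_add_right cinner_op_adjoint[OF X]
          cinner_op_adjoint_left[OF X])
    have I: "op_hermitian I"
      unfolding op_hermitian_def I_def
      by (simp add: scaleR_BH minus_BH op_scaleC_BH X X' blinfun.scaleR_left blinfun.diff_left
          op_scaleC.rep_eq cinner_scaleR_left cinner_scaleR_right cinner.diff_left cinner.diff_right
          cinner_scaleC_left cinner_scaleC_right cinner_op_adjoint[OF X]
          cinner_op_adjoint_left[OF X] algebra_simps)
    have "norm R \<le> 1"
      using norm_triangle_ineq[of X ?X'] norm norm' by (simp add: R_def)
    moreover have "norm I \<le> 1"
      using norm_scale[of "-\<i>" "X - ?X'"] norm_triangle_ineq4[of X ?X'] norm norm'
      by (simp add: I_def)
    ultimately have le: "N (R o\<^sub>L A) \<le> N A" "N (I o\<^sub>L A) \<le> N A"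
      using R I A N_hermitian_contraction_left_le by blast+
    have mem: "R o\<^sub>L A \<in> J" "I o\<^sub>L A \<in> J"
      using R I A by (simp_all add: compose_left_mem op_hermitian_BH)
    have "X o\<^sub>L A = (R o\<^sub>L A) + op_scaleC \<i> (I o\<^sub>L A)"
    proof (rule blinfun_eqI)
      fix x
      let ?y = "X (A x)" and ?z = "blinfun_apply ?X' (A x)"
      have "\<i> *\<^sub>C (1/2) *\<^sub>R (-\<i>) *\<^sub>C (?y - ?z) = (1/2) *\<^sub>R (?y - ?z)"
        by (simp add: scaleR_scaleC scaleC_scaleC)
      then have "((R o\<^sub>L A) + op_scaleC \<i> (I o\<^sub>L A)) x
          = (1/2) *\<^sub>R (?y + ?z) + (1/2) *\<^sub>R (?y - ?z)"
        by (simp add: R_def I_def blinfun.add_left blinfun.scaleR_left blinfun.diff_left op_scaleC.rep_eq)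
      also have "\<dots> = ?y"
        unfolding scaleR_add_right[symmetric] by (simp flip: scaleR_2)
      finally show "(X o\<^sub>L A) x = ((R o\<^sub>L A) + op_scaleC \<i> (I o\<^sub>L A)) x"
        by simp
    qed
    then have "N (X o\<^sub>L A) \<le> N (R o\<^sub>L A) + N (op_scaleC \<i> (I o\<^sub>L A))"
      using triangle[OF mem(1) op_scaleC_mem[OF mem(2)]] by simp
    also have "\<dots> \<le> N A + N A"
      using le scale[OF mem(2), of \<i>] by simp
    finally show ?thesis by simp
  qed
  show ?thesis
  proof (cases "X = 0")
    case True
    have "0 o\<^sub>L A = 0"
      by (rule blinfun_eqI) simp
    then show ?thesis
      using True by (simp add: N_zero)
  next
    case False
    let ?X = "X /\<^sub>R norm X"
    have "X o\<^sub>L A = norm X *\<^sub>R (?X o\<^sub>L A)"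
      using False by (simp add: compose_scaleR_left)
    then have "N (X o\<^sub>L A) = norm X * N (?X o\<^sub>L A)"
      using N_scaleR[OF compose_left_mem[OF A scaleR_BH[OF X]], of "norm X" "inverse (norm X)"] by simp
    also have "\<dots> \<le> norm X * (2 * N A)"
      using False by (intro mult_left_mono unit scaleR_BH X) simp_all
    finally show ?thesis
      by (simp add: mult_ac)
  qed
qed

end

section \<open>Bochner integration in a norm ideal\<close>

lemma (in finite_measure) simple_bochner_integrable_iff:
  "Bochner_Integration.simple_bochner_integrable M f \<longleftrightarrow> simple_function M f"
  by (auto simp: Bochner_Integration.simple_bochner_integrable.simps)

context unitarily_invariant_norm
begin

definition approximating_sequence :: "'a measure \<Rightarrow> (nat \<Rightarrow> 'a \<Rightarrow> 'h \<Rightarrow>\<^sub>L 'h) \<Rightarrow> ('a \<Rightarrow> 'h \<Rightarrow>\<^sub>L 'h) \<Rightarrow> bool" where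
  "approximating_sequence M s g \<longleftrightarrow> g \<in> space M \<rightarrow> J \<and>
     (\<forall>n. simple_function M (s n) \<and> s n \<in> space M \<rightarrow> J) \<and>
     (\<forall>x\<in>space M. (\<lambda>n. N (g x - s n x)) \<longlonglongrightarrow> 0)"

lemma approximating_sequenceD:
  assumes "approximating_sequence M s g"
  shows "x \<in> space M \<Longrightarrow> g x \<in> J" "simple_function M (s n)" "x \<in> space M \<Longrightarrow> s n x \<in> J"
    "x \<in> space M \<Longrightarrow> (\<lambda>n. N (g x - s n x)) \<longlonglongrightarrow> 0"
  using assms by (auto simp: approximating_sequence_def)

text \<open>
  Values on a null set are changed to 0, which makes the approximation hold everywhere. This gives
  measurability of the norm and of the vector-valued functions derived from \<open>g\<close>, even if the measure is
  not complete.
\<close>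

lemma strongly_measurable_modification:
  assumes "strongly_measurable_in M J N f"
  shows "\<exists>g s. (AE x in M. f x = g x) \<and> approximating_sequence M s g"
proof -
  obtain s where f: "f \<in> space M \<rightarrow> J"
    and s: "\<And>n. Bochner_Integration.simple_bochner_integrable M (s n)" "\<And>n. s n \<in> space M \<rightarrow> J"
    and lim: "AE x in M. (\<lambda>n. N (f x - s n x)) \<longlonglongrightarrow> 0"
    using assms unfolding strongly_measurable_in_def by blast
  obtain Z where Z: "{x \<in> space M. \<not> (\<lambda>n. N (f x - s n x)) \<longlonglongrightarrow> 0} \<subseteq> Z" "Z \<in> null_sets M"
    using lim by (auto elim!: AE_E intro: null_setsI)
  define g where "g x = (if x \<in> Z then 0 else f x)" for x
  define t where "t n x = (if x \<in> Z then 0 else s n x)" for n x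
  have sets: "Z \<inter> space M \<in> sets M"
    using Z(2) by auto
  have "simple_function M (t n)" for n
    unfolding t_def
    by (intro simple_function_If_set simple_function_const sets)
       (use s(1) in \<open>auto elim: Bochner_Integration.simple_bochner_integrable.cases\<close>)
  moreover have "g \<in> space M \<rightarrow> J" "t n \<in> space M \<rightarrow> J" for n
    using f s(2) zero_mem by (simp_all add: g_def t_def Pi_iff)
  moreover have "(\<lambda>n. N (g x - t n x)) \<longlonglongrightarrow> 0" if "x \<in> space M" for x
    using Z(1) that by (auto simp: g_def t_def N_zero)
  ultimately have "approximating_sequence M t g"
    unfolding approximating_sequence_def by blast
  moreover have "AE x in M. f x = g x"
    using AE_not_in[OF Z(2)] by eventually_elim (simp add: g_def)
  ultimately show ?thesis by blast
qed

lemma approximating_sequence_N_tendsto: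
  assumes "approximating_sequence M s g" "x \<in> space M"
  shows "(\<lambda>n. N (s n x)) \<longlonglongrightarrow> N (g x)"
proof (rule LIM_zero_cancel, rule Lim_null_comparison)
  note D = approximating_sequenceD[OF assms(1)]
  show "\<forall>\<^sub>F n in sequentially. norm (N (s n x) - N (g x)) \<le> N (g x - s n x)"
  proof (rule always_eventually, rule allI)
    fix n
    show "norm (N (s n x) - N (g x)) \<le> N (g x - s n x)"
      using abs_N_diff_le[OF D(1)[OF assms(2)] D(3)[OF assms(2)], of n]
      by (simp add: abs_minus_commute)
  qed
  show "(\<lambda>n. N (g x - s n x)) \<longlonglongrightarrow> 0"
    by (rule D(4)[OF assms(2)])
qed

lemma borel_measurable_N_simple: "simple_function M s \<Longrightarrow> (\<lambda>x. N (s x)) \<in> borel_measurable M"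
  by (rule borel_measurable_simple_function, rule simple_function_compose1)

lemma approximating_sequence_N_measurable:
  assumes "approximating_sequence M s g"
  shows "(\<lambda>x. N (g x)) \<in> borel_measurable M"
  by (rule borel_measurable_LIMSEQ_real[OF approximating_sequence_N_tendsto[OF assms]
        borel_measurable_N_simple[OF approximating_sequenceD(2)[OF assms]]])

lemma approximating_sequence_diff_simple:
  assumes "approximating_sequence M s g" "simple_function M t" "t \<in> space M \<rightarrow> J"
  shows "approximating_sequence M (\<lambda>n x. s n x - t x) (\<lambda>x. g x - t x)"
  using assms diff_mem unfolding approximating_sequence_def
  by (auto intro!: simple_function_compose2 simp: Pi_iff)

lemma approximating_sequence_apply_measurable:
  assumes "approximating_sequence M s g"
  shows "(\<lambda>\<theta>. (g \<theta>) x) \<in> borel_measurable M"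
proof (rule borel_measurable_LIMSEQ_metric)
  note D = approximating_sequenceD[OF assms]
  show "(\<lambda>\<theta>. (s n \<theta>) x) \<in> borel_measurable M" for n
    by (rule borel_measurable_simple_function, rule simple_function_compose1[OF D(2)])
  fix \<theta> assume \<theta>: "\<theta> \<in> space M"
  show "(\<lambda>n. (s n \<theta>) x) \<longlonglongrightarrow> (g \<theta>) x"
  proof (rule LIM_zero_cancel, rule Lim_null_comparison)
    show "\<forall>\<^sub>F n in sequentially. norm ((s n \<theta>) x - (g \<theta>) x)
        \<le> N (g \<theta> - s n \<theta>) * norm x"
    proof (rule always_eventually, rule allI)
      fix n
      have "norm ((g \<theta> - s n \<theta>) x) \<le> norm (g \<theta> - s n \<theta>) * norm x"
        by (rule norm_blinfun)
      also have "\<dots> \<le> N (g \<theta> - s n \<theta>) * norm x"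
        using D \<theta> by (intro mult_right_mono norm_le_N diff_mem) auto
      finally show "norm ((s n \<theta>) x - (g \<theta>) x)
          \<le> N (g \<theta> - s n \<theta>) * norm x"
        by (simp add: blinfun.diff_left norm_minus_commute)
    qed
    show "(\<lambda>n. N (g \<theta> - s n \<theta>) * norm x) \<longlonglongrightarrow> 0"
      using D(4)[OF \<theta>] by (rule tendsto_mult_left_zero)
  qed
qed

lemma simple_bochner_integral_mem:
  "simple_function M s \<Longrightarrow> s \<in> space M \<rightarrow> J \<Longrightarrow> Bochner_Integration.simple_bochner_integral M s \<in> J"
  unfolding simple_bochner_integral_def by (intro sum_mem scaleR_mem) auto

lemma N_simple_bochner_integral_le:
  assumes "Bochner_Integration.simple_bochner_integrable M s" "s \<in> space M \<rightarrow> J"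
  shows "ennreal (N (Bochner_Integration.simple_bochner_integral M s)) \<le> (\<integral>\<^sup>+x. ennreal (N (s x)) \<partial>M)"
proof -
  let ?n = "\<lambda>x. \<bar>N (s x)\<bar>"
  have int: "Bochner_Integration.simple_bochner_integrable M ?n"
    by (rule simple_bochner_integrable_compose2[OF _ assms(1) assms(1)]) (simp add: N_zero)
  have "N (Bochner_Integration.simple_bochner_integral M s)
      \<le> (\<Sum>y\<in>s ` space M. N (measure M {x\<in>space M. s x = y} *\<^sub>R y))"
    unfolding simple_bochner_integral_def using assms(2) by (intro N_sum_le scaleR_mem) auto
  also have "\<dots> = (\<Sum>y\<in>s ` space M. measure M {x\<in>space M. s x = y} *\<^sub>R \<bar>N y\<bar>)"
    using assms(2) nonneg by (intro sum.cong) (auto simp: N_scaleR Pi_iff)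
  also have "\<dots> = Bochner_Integration.simple_bochner_integral M ?n"
    using assms(1) by (intro simple_bochner_integral_partition[OF int, symmetric])
      (auto elim: Bochner_Integration.simple_bochner_integrable.cases)
  finally have "ennreal (N (Bochner_Integration.simple_bochner_integral M s)) \<le> ennreal (Bochner_Integration.simple_bochner_integral M ?n)"
    by (rule ennreal_leI)
  also have "\<dots> = (\<integral>\<^sup>+x. ennreal (?n x) \<partial>M)"
    by (intro simple_bochner_integral_eq_nn_integral int) simp
  also have "\<dots> = (\<integral>\<^sup>+x. ennreal (N (s x)) \<partial>M)"
    using assms(2) nonneg by (intro nn_integral_cong) (auto simp: Pi_iff)
  finally show ?thesis .
qed

text \<open>
  Truncating the approximation at twice the norm of its limit gives domination, hence convergence
  of the integrals in mean.
\<close>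

lemma approximating_sequence_in_mean:
  assumes approx: "approximating_sequence M s g" and fin: "(\<integral>\<^sup>+x. ennreal (N (g x)) \<partial>M) < \<infinity>"
  shows "\<exists>t. approximating_sequence M t g \<and> (\<lambda>n. \<integral>\<^sup>+x. ennreal (N (g x - t n x)) \<partial>M) \<longlonglongrightarrow> 0"
proof -
  note D = approximating_sequenceD[OF approx]
  note meas = approximating_sequence_N_measurable[OF approx]
  define t where "t n x = (if N (s n x) \<le> 2 * N (g x) then s n x else 0)" for n x
  have tJ: "t n x \<in> J" if "x \<in> space M" for n x
    using D(3)[OF that] zero_mem by (simp add: t_def)
  have "simple_function M (t n)" for n
    unfolding t_def
    by (intro simple_function_If D(2) simple_function_const borel_measurable_le
        borel_measurable_N_simple borel_measurable_times borel_measurable_const meas)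
  moreover have t_lim: "(\<lambda>n. N (g x - t n x)) \<longlonglongrightarrow> 0" if x: "x \<in> space M" for x
  proof (cases "N (g x) = 0")
    case True
    have "t n x = 0" for n
      unfolding t_def using True nonneg[OF D(3)[OF x], of n] eq_zero_iff[OF D(3)[OF x], of n] by auto
    then show ?thesis
      using True by simp
  next
    case False
    then have "N (g x) < 2 * N (g x)"
      using nonneg[OF D(1)[OF x]] by simp
    then have "\<forall>\<^sub>F n in sequentially. N (s n x) < 2 * N (g x)"
      by (rule order_tendstoD(2)[OF approximating_sequence_N_tendsto[OF approx x]])
    then have "\<forall>\<^sub>F n in sequentially. N (g x - s n x) = N (g x - t n x)"
      by eventually_elim (simp add: t_def)
    then show ?thesis
      by (rule Lim_transform_eventually[OF D(4)[OF x]])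
  qed
  ultimately have t: "approximating_sequence M t g"
    unfolding approximating_sequence_def using D(1) tJ by blast
  have meas_diff: "(\<lambda>x. N (g x - t n x)) \<in> borel_measurable M" for n
    by (rule approximating_sequence_N_measurable[OF approximating_sequence_diff_simple[OF approx]])
       (use approximating_sequenceD[OF t] in auto)
  have "(\<lambda>n. \<integral>\<^sup>+x. ennreal (N (g x - t n x)) \<partial>M) \<longlonglongrightarrow> (\<integral>\<^sup>+x. 0 \<partial>M)"
  proof (rule nn_integral_dominated_convergence[where w = "\<lambda>x. 3 * ennreal (N (g x))"])
    show "AE x in M. ennreal (N (g x - t n x)) \<le> 3 * ennreal (N (g x))" for n
    proof (rule AE_I2)
      fix x assume x: "x \<in> space M"
      have "N (t n x) \<le> 2 * N (g x)"
        using nonneg[OF D(1)[OF x]] by (simp add: t_def N_zero)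
      then have "N (g x - t n x) \<le> 3 * N (g x)"
        using N_diff_le[OF D(1)[OF x] tJ[OF x], of n] by linarith
      then show "ennreal (N (g x - t n x)) \<le> 3 * ennreal (N (g x))"
        using nonneg[OF D(1)[OF x]] by (metis ennreal_leI ennreal_mult ennreal_numeral zero_le_numeral)
    qed
    show "(\<integral>\<^sup>+x. 3 * ennreal (N (g x)) \<partial>M) < \<infinity>"
      using fin meas by (simp add: nn_integral_cmult ennreal_mult_less_top)
    show "AE x in M. (\<lambda>n. ennreal (N (g x - t n x))) \<longlonglongrightarrow> 0"
      using t_lim by (intro AE_I2) (metis ennreal_0 tendsto_ennrealI)
  qed (use meas meas_diff in measurable)
  then show ?thesis
    using t by auto
qed

text \<open>The integrals of the approximating simple functions converge by completeness of the ideal.\<close>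

lemma has_bochner_integral_in_exists:
  assumes "finite_measure M" and approx: "approximating_sequence M s g"
    and fin: "(\<integral>\<^sup>+x. ennreal (N (g x)) \<partial>M) < \<infinity>"
  shows "\<exists>I. has_bochner_integral_in M J N g I"
proof -
  interpret finite_measure M by fact
  obtain t where t: "approximating_sequence M t g"
    and lim: "(\<lambda>n. \<integral>\<^sup>+x. ennreal (N (g x - t n x)) \<partial>M) \<longlonglongrightarrow> 0"
    using approximating_sequence_in_mean[OF approx fin] by blast
  note D = approximating_sequenceD[OF t]
  let ?S = "\<lambda>n. Bochner_Integration.simple_bochner_integral M (t n)"
  have SJ: "?S n \<in> J" for n
    using D by (intro simple_bochner_integral_mem) auto
  have meas: "(\<lambda>x. ennreal (N (g x - t n x))) \<in> borel_measurable M" for n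
    using approximating_sequence_N_measurable[OF approximating_sequence_diff_simple[OF t]] D by auto
  have le: "ennreal (N (?S m - ?S n))
      \<le> (\<integral>\<^sup>+x. ennreal (N (g x - t m x)) \<partial>M) + (\<integral>\<^sup>+x. ennreal (N (g x - t n x)) \<partial>M)" for m n
  proof -
    have "?S m - ?S n = Bochner_Integration.simple_bochner_integral M (\<lambda>x. t m x - t n x)"
      by (intro simple_bochner_integral_diff[symmetric]) (simp_all add: simple_bochner_integrable_iff D)
    then have "ennreal (N (?S m - ?S n)) \<le> (\<integral>\<^sup>+x. ennreal (N (t m x - t n x)) \<partial>M)"
      using N_simple_bochner_integral_le[of M "\<lambda>x. t m x - t n x"] D diff_mem
      by (simp add: simple_bochner_integrable_iff simple_function_diff)
    also have "\<dots> \<le> (\<integral>\<^sup>+x. ennreal (N (g x - t m x)) + ennreal (N (g x - t n x)) \<partial>M)"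
    proof (rule nn_integral_mono)
      fix x assume x: "x \<in> space M"
      have "N (t m x - t n x) \<le> N (g x - t m x) + N (g x - t n x)"
        using N_diff_triangle[OF D(3) D(1) D(3), OF x x x, of m n] N_diff_commute[OF D(3) D(1), OF x x, of m]
        by simp
      then show "ennreal (N (t m x - t n x)) \<le> ennreal (N (g x - t m x)) + ennreal (N (g x - t n x))"
        using nonneg[OF diff_mem[OF D(1) D(3)], OF x x]
        by (simp add: ennreal_leI flip: ennreal_plus)
    qed
    also have "\<dots> = (\<integral>\<^sup>+x. ennreal (N (g x - t m x)) \<partial>M) + (\<integral>\<^sup>+x. ennreal (N (g x - t n x)) \<partial>M)"
      by (intro nn_integral_add meas)
    finally show ?thesis .
  qed
  have "\<exists>K. \<forall>m\<ge>K. \<forall>n\<ge>K. N (?S m - ?S n) < e" if e: "e > 0" for e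
  proof -
    have "\<forall>\<^sub>F n in sequentially. (\<integral>\<^sup>+x. ennreal (N (g x - t n x)) \<partial>M) < ennreal (e / 2)"
      using e by (intro order_tendstoD(2)[OF lim]) simp
    then obtain K where K: "\<And>n. n \<ge> K \<Longrightarrow> (\<integral>\<^sup>+x. ennreal (N (g x - t n x)) \<partial>M) < ennreal (e / 2)"
      by (auto simp: eventually_sequentially)
    have "N (?S m - ?S n) < e" if "m \<ge> K" "n \<ge> K" for m n
    proof -
      have "ennreal (N (?S m - ?S n)) < ennreal (e / 2) + ennreal (e / 2)"
        using le[of m n] add_strict_mono[OF K[OF that(1)] K[OF that(2)]] by (rule le_less_trans)
      also have "\<dots> = ennreal e"
        using e by (simp flip: ennreal_plus)
      finally show ?thesis
        using nonneg[OF diff_mem[OF SJ SJ]] by (simp add: ennreal_less_iff)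
    qed
    then show ?thesis by blast
  qed
  from complete[OF SJ this] obtain I where I: "I \<in> J" "(\<lambda>n. N (?S n - I)) \<longlonglongrightarrow> 0"
    by blast
  have simple: "\<forall>n. Bochner_Integration.simple_bochner_integrable M (t n) \<and> t n \<in> space M \<rightarrow> J"
    using D by (auto simp: simple_bochner_integrable_iff)
  have "strongly_measurable_in M J N g"
    unfolding strongly_measurable_in_def using simple D(1,4) by (blast intro: AE_I2)
  then show ?thesis
    unfolding has_bochner_integral_in_def using simple lim I by blast
qed

lemma strongly_measurable_in_cong_AE:
  assumes "strongly_measurable_in M J N f" "AE x in M. f x = g x" "g \<in> space M \<rightarrow> J"
  shows "strongly_measurable_in M J N g"
proof -
  obtain s where s: "\<forall>n::nat. Bochner_Integration.simple_bochner_integrable M (s n) \<and> s n \<in> space M \<rightarrow> J"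
    and lim: "AE x in M. (\<lambda>n. N (f x - s n x)) \<longlonglongrightarrow> 0"
    using assms(1) unfolding strongly_measurable_in_def by blast
  have "AE x in M. (\<lambda>n. N (g x - s n x)) \<longlonglongrightarrow> 0"
    using lim assms(2) by eventually_elim simp
  then show ?thesis
    unfolding strongly_measurable_in_def using s assms(3) by blast
qed

lemma has_bochner_integral_in_cong_AE:
  assumes "has_bochner_integral_in M J N f I" "AE x in M. f x = g x" "g \<in> space M \<rightarrow> J"
  shows "has_bochner_integral_in M J N g I"
proof -
  have f: "strongly_measurable_in M J N f" "I \<in> J"
    using assms(1) unfolding has_bochner_integral_in_def by blast+
  obtain s where s: "\<forall>n::nat. Bochner_Integration.simple_bochner_integrable M (s n) \<and> s n \<in> space M \<rightarrow> J"
    and lim: "(\<lambda>n. \<integral>\<^sup>+x. ennreal (N (f x - s n x)) \<partial>M) \<longlonglongrightarrow> 0"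
      "(\<lambda>n. N (Bochner_Integration.simple_bochner_integral M (s n) - I)) \<longlonglongrightarrow> 0"
    using assms(1) unfolding has_bochner_integral_in_def by blast
  have "(\<integral>\<^sup>+x. ennreal (N (f x - s n x)) \<partial>M) = (\<integral>\<^sup>+x. ennreal (N (g x - s n x)) \<partial>M)" for n
    using assms(2) by (intro nn_integral_cong_AE) (auto elim: eventually_mono)
  then show ?thesis
    using lim s f(2) strongly_measurable_in_cong_AE[OF f(1) assms(2,3)]
    unfolding has_bochner_integral_in_def by auto
qed

lemma has_bochner_integral_in_apply:
  assumes "has_bochner_integral_in M J N g I"
    and meas: "(\<lambda>\<theta>. (g \<theta>) x) \<in> borel_measurable M"
  shows "has_bochner_integral M (\<lambda>\<theta>. (g \<theta>) x) (I x)"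
proof -
  have g: "g \<in> space M \<rightarrow> J" and I: "I \<in> J"
    using assms(1) by (auto simp: has_bochner_integral_in_def strongly_measurable_in_def)
  obtain s where s: "\<And>n. Bochner_Integration.simple_bochner_integrable M (s n)" "\<And>n. s n \<in> space M \<rightarrow> J"
    and lim: "(\<lambda>n. \<integral>\<^sup>+x. ennreal (N (g x - s n x)) \<partial>M) \<longlonglongrightarrow> 0"
      "(\<lambda>n. N (Bochner_Integration.simple_bochner_integral M (s n) - I)) \<longlonglongrightarrow> 0"
    using assms(1) unfolding has_bochner_integral_in_def by blast
  have norm_apply: "norm (A x) \<le> N A * norm x" if "A \<in> J" for A
    using norm_blinfun[of A x] mult_right_mono[OF norm_le_N[OF that], of "norm x"] by simp
  show ?thesis
  proof (rule has_bochner_integral.intros[OF meas, where s = "\<lambda>n \<theta>. (s n \<theta>) x"])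
    show "Bochner_Integration.simple_bochner_integrable M (\<lambda>\<theta>. (s n \<theta>) x)" for n
      by (rule simple_bochner_integrable_compose2[OF _ s(1) s(1), where p = "\<lambda>A B. blinfun_apply A x"]) simp
    show "(\<lambda>n. \<integral>\<^sup>+\<theta>. norm ((g \<theta>) x - (s n \<theta>) x) \<partial>M) \<longlonglongrightarrow> 0"
    proof (rule tendsto_sandwich[where f = "\<lambda>_. 0"
          and h = "\<lambda>n. ennreal (norm x) * (\<integral>\<^sup>+\<theta>. ennreal (N (g \<theta> - s n \<theta>)) \<partial>M)"])
      show "\<forall>\<^sub>F n in sequentially. (\<integral>\<^sup>+\<theta>. norm ((g \<theta>) x - (s n \<theta>) x) \<partial>M)
          \<le> ennreal (norm x) * (\<integral>\<^sup>+\<theta>. ennreal (N (g \<theta> - s n \<theta>)) \<partial>M)"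
      proof (rule always_eventually, rule allI)
        fix n
        \<comment> \<open>The constant \<open>norm x\<close> is taken out of an integral with measurable integrand, as
          \<open>N (g \<theta> - s n \<theta>)\<close> may depend on \<open>\<theta>\<close> in a non-measurable way.\<close>
        show "(\<integral>\<^sup>+\<theta>. norm ((g \<theta>) x - (s n \<theta>) x) \<partial>M)
            \<le> ennreal (norm x) * (\<integral>\<^sup>+\<theta>. ennreal (N (g \<theta> - s n \<theta>)) \<partial>M)"
        proof (cases "x = 0")
          case False
          let ?h = "\<lambda>\<theta>. norm ((g \<theta>) x - (s n \<theta>) x)"
          have sn: "(\<lambda>\<theta>. (s n \<theta>) x) \<in> borel_measurable M"
            by (rule borel_measurable_simple_function,
                rule simple_function_compose1[where g = "\<lambda>A. blinfun_apply A x"],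
                rule Bochner_Integration.simple_bochner_integrable.cases[OF s(1)])
          have "(\<integral>\<^sup>+\<theta>. ?h \<theta> \<partial>M) = (\<integral>\<^sup>+\<theta>. ennreal (norm x) * ennreal (?h \<theta> / norm x) \<partial>M)"
            using False by (simp flip: ennreal_mult')
          also have "\<dots> = ennreal (norm x) * (\<integral>\<^sup>+\<theta>. ennreal (?h \<theta> / norm x) \<partial>M)"
            using meas sn by (intro nn_integral_cmult) simp
          also have "\<dots> \<le> ennreal (norm x) * (\<integral>\<^sup>+\<theta>. ennreal (N (g \<theta> - s n \<theta>)) \<partial>M)"
          proof (intro mult_left_mono nn_integral_mono ennreal_leI)
            fix \<theta> assume "\<theta> \<in> space M"
            then have "g \<theta> - s n \<theta> \<in> J"
              using g s(2) by (intro diff_mem) auto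
            then show "?h \<theta> / norm x \<le> N (g \<theta> - s n \<theta>)"
              using norm_apply[of "g \<theta> - s n \<theta>"] False by (simp add: divide_le_eq blinfun.diff_left)
          qed simp
          finally show ?thesis .
        qed (simp add: blinfun.zero_right)
      qed
      show "(\<lambda>n. ennreal (norm x) * (\<integral>\<^sup>+\<theta>. ennreal (N (g \<theta> - s n \<theta>)) \<partial>M)) \<longlonglongrightarrow> 0"
        using ennreal_tendsto_cmult[OF _ lim(1), of "ennreal (norm x)"] by simp
    qed simp_all
    have "linear (\<lambda>A. blinfun_apply A x)"
      by (rule linearI) (simp_all add: blinfun.add_left blinfun.scaleR_left)
    then have "Bochner_Integration.simple_bochner_integral M (\<lambda>\<theta>. (s n \<theta>) x)
        = (Bochner_Integration.simple_bochner_integral M (s n)) x" for n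
      by (rule simple_bochner_integral_linear[OF _ s(1)])
    moreover have "(\<lambda>n. (Bochner_Integration.simple_bochner_integral M (s n)) x) \<longlonglongrightarrow> I x"
    proof (rule LIM_zero_cancel, rule Lim_null_comparison)
      show "\<forall>\<^sub>F n in sequentially. norm ((Bochner_Integration.simple_bochner_integral M (s n)) x - I x)
          \<le> N (Bochner_Integration.simple_bochner_integral M (s n) - I) * norm x"
        using norm_apply s I
        by (intro always_eventually allI)
           (auto simp flip: blinfun.diff_left intro!: norm_apply diff_mem simple_bochner_integral_mem
             elim: Bochner_Integration.simple_bochner_integrable.cases)
      show "(\<lambda>n. N (Bochner_Integration.simple_bochner_integral M (s n) - I) * norm x) \<longlonglongrightarrow> 0"
        using lim(2) by (rule tendsto_mult_left_zero)
    qed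
    ultimately show "(\<lambda>n. Bochner_Integration.simple_bochner_integral M (\<lambda>\<theta>. (s n \<theta>) x)) \<longlonglongrightarrow> I x"
      by simp
  qed
qed

text \<open>
  The integral in the ideal is determined by the integrals of the functions \<open>\<theta> \<mapsto> g \<theta> x\<close>, to which
  the theory for separable spaces applies. In particular it is unique.
\<close>

theorem bochner_integral_in_modification:
  assumes "finite_measure M" and approx: "approximating_sequence M s g"
    and fin: "(\<integral>\<^sup>+x. ennreal (N (g x)) \<partial>M) < \<infinity>"
    and f: "AE x in M. f x = g x" "f \<in> space M \<rightarrow> J"
  shows "bochner_integrable_in M J N f" "bochner_integral_in M J N f \<in> J"
    "has_bochner_integral M (\<lambda>\<theta>. (g \<theta>) x) (bochner_integral_in M J N f x)"
proof -
  have g: "g \<in> space M \<rightarrow> J"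
    using approximating_sequenceD[OF approx] by blast
  obtain I where I: "has_bochner_integral_in M J N g I"
    using has_bochner_integral_in_exists[OF assms(1-3)] by blast
  have fI: "has_bochner_integral_in M J N f I"
    by (rule has_bochner_integral_in_cong_AE[OF I _ f(2)]) (use f(1) in \<open>auto elim: eventually_mono\<close>)
  note pointwise = has_bochner_integral_in_apply[OF _ approximating_sequence_apply_measurable[OF approx]]
  have "I' = I" if "has_bochner_integral_in M J N f I'" for I'
  proof (rule blinfun_eqI)
    fix x
    have "has_bochner_integral_in M J N g I'"
      by (rule has_bochner_integral_in_cong_AE[OF that f(1) g])
    then show "I' x = I x"
      using pointwise I has_bochner_integral_eq by blast
  qed
  then have eq: "bochner_integral_in M J N f = I"
    unfolding bochner_integral_in_def using fI by blast
  show "bochner_integrable_in M J N f"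
    using fI unfolding bochner_integrable_in_def by blast
  show "bochner_integral_in M J N f \<in> J"
    using fI unfolding eq has_bochner_integral_in_def by blast
  show "has_bochner_integral M (\<lambda>\<theta>. (g \<theta>) x) (bochner_integral_in M J N f x)"
    unfolding eq by (rule pointwise[OF I])
qed

lemma approximating_sequence_scaleC:
  assumes approx: "approximating_sequence M s g" and k: "k \<in> borel_measurable M"
  shows "\<exists>t. approximating_sequence M t (\<lambda>\<theta>. op_scaleC (k \<theta>) (g \<theta>))"
proof -
  note D = approximating_sequenceD[OF approx]
  obtain l where l: "\<And>n. simple_function M (l n)" "\<And>x. x \<in> space M \<Longrightarrow> (\<lambda>n. l n x) \<longlonglongrightarrow> k x"
    using borel_measurable_implies_sequence_metric[OF k, of 0] by blast
  have "(\<lambda>n. N (op_scaleC (k x) (g x) - op_scaleC (l n x) (s n x))) \<longlonglongrightarrow> 0" if x: "x \<in> space M" for x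
  proof (rule Lim_null_comparison)
    show "\<forall>\<^sub>F n in sequentially. norm (N (op_scaleC (k x) (g x) - op_scaleC (l n x) (s n x)))
        \<le> cmod (k x) * N (g x - s n x) + cmod (k x - l n x) * N (s n x)"
    proof (rule always_eventually, rule allI)
      fix n
      have mem: "g x - s n x \<in> J" "s n x \<in> J"
        using D x diff_mem by auto
      have "op_scaleC (k x) (g x) - op_scaleC (l n x) (s n x)
          = op_scaleC (k x) (g x - s n x) + op_scaleC (k x - l n x) (s n x)"
        by (rule blinfun_eqI) (simp add: op_scaleC.rep_eq blinfun.diff_left blinfun.add_left
            scaleC.diff_left scaleC.diff_right)
      then show "norm (N (op_scaleC (k x) (g x) - op_scaleC (l n x) (s n x)))
          \<le> cmod (k x) * N (g x - s n x) + cmod (k x - l n x) * N (s n x)"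
        using triangle[OF op_scaleC_mem op_scaleC_mem, OF mem] scale mem
          nonneg[OF add_mem[OF op_scaleC_mem op_scaleC_mem, OF mem]] by simp
    qed
    have "(\<lambda>n. cmod (k x) * N (g x - s n x) + cmod (k x - l n x) * N (s n x))
        \<longlonglongrightarrow> cmod (k x) * 0 + cmod (k x - k x) * N (g x)"
      by (intro tendsto_intros D(4)[OF x] l(2)[OF x] approximating_sequence_N_tendsto[OF approx x])
    then show "(\<lambda>n. cmod (k x) * N (g x - s n x) + cmod (k x - l n x) * N (s n x)) \<longlonglongrightarrow> 0"
      by simp
  qed
  then have "approximating_sequence M (\<lambda>n x. op_scaleC (l n x) (s n x)) (\<lambda>\<theta>. op_scaleC (k \<theta>) (g \<theta>))"
    unfolding approximating_sequence_def using D l(1) op_scaleC_mem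
    by (auto intro!: simple_function_compose2[where h = op_scaleC])
  then show ?thesis by blast
qed

lemma adjoint_compose_mem: "A \<in> J \<Longrightarrow> B \<in> J \<Longrightarrow> op_adjoint A o\<^sub>L B \<in> J"
  by (intro compose_left_mem op_adjoint_BH mem_BH)

lemma N_adjoint_compose_le:
  assumes "A \<in> J" "B \<in> J"
  shows "N (op_adjoint A o\<^sub>L B) \<le> 2 * N A * N B"
proof -
  have "N (op_adjoint A o\<^sub>L B) \<le> 2 * norm (op_adjoint A) * N B"
    by (intro N_compose_left_le op_adjoint_BH mem_BH assms)
  also have "\<dots> \<le> 2 * N A * N B"
    using norm_op_adjoint_le[OF mem_BH[OF assms(1)]] norm_le_N[OF assms(1)] nonneg[OF assms(2)]
    by (intro mult_right_mono) auto
  finally show ?thesis .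
qed

text \<open>
  The difference is split as \<open>g\<^sup>* (g - s\<^sub>n) + (g - s\<^sub>n)\<^sup>* s\<^sub>n\<close>, where one factor is measured in the
  operator norm.
\<close>

lemma approximating_sequence_adjoint_compose:
  assumes approx: "approximating_sequence M s g"
  shows "approximating_sequence M (\<lambda>n x. op_adjoint (s n x) o\<^sub>L s n x) (\<lambda>x. op_adjoint (g x) o\<^sub>L g x)"
proof -
  note D = approximating_sequenceD[OF approx]
  have "(\<lambda>n. N ((op_adjoint (g x) o\<^sub>L g x) - (op_adjoint (s n x) o\<^sub>L s n x))) \<longlonglongrightarrow> 0"
    if x: "x \<in> space M" for x
  proof (rule Lim_null_comparison)
    show "\<forall>\<^sub>F n in sequentially. norm (N ((op_adjoint (g x) o\<^sub>L g x) - (op_adjoint (s n x) o\<^sub>L s n x)))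
        \<le> 2 * N (g x) * N (g x - s n x) + 2 * N (g x - s n x) * N (s n x)"
    proof (rule always_eventually, rule allI)
      fix n
      have mem: "g x \<in> J" "g x - s n x \<in> J" "s n x \<in> J"
        using D x diff_mem by auto
      have "(op_adjoint (g x) o\<^sub>L g x) - (op_adjoint (s n x) o\<^sub>L s n x)
          = (op_adjoint (g x) o\<^sub>L (g x - s n x)) + (op_adjoint (g x - s n x) o\<^sub>L s n x)"
        using mem by (simp add: op_adjoint_diff mem_BH compose_diff_left compose_diff_right)
      moreover have "N ((op_adjoint (g x) o\<^sub>L (g x - s n x)) + (op_adjoint (g x - s n x) o\<^sub>L s n x))
          \<le> N (op_adjoint (g x) o\<^sub>L (g x - s n x)) + N (op_adjoint (g x - s n x) o\<^sub>L s n x)"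
        by (intro triangle adjoint_compose_mem mem)
      moreover have "0 \<le> N ((op_adjoint (g x) o\<^sub>L g x) - (op_adjoint (s n x) o\<^sub>L s n x))"
        by (intro nonneg diff_mem adjoint_compose_mem mem)
      ultimately show "norm (N ((op_adjoint (g x) o\<^sub>L g x) - (op_adjoint (s n x) o\<^sub>L s n x)))
          \<le> 2 * N (g x) * N (g x - s n x) + 2 * N (g x - s n x) * N (s n x)"
        using N_adjoint_compose_le[OF mem(1,2)] N_adjoint_compose_le[OF mem(2,3)] by simp
    qed
    have "(\<lambda>n. 2 * N (g x) * N (g x - s n x) + 2 * N (g x - s n x) * N (s n x))
        \<longlonglongrightarrow> 2 * N (g x) * 0 + 2 * 0 * N (g x)"
      by (intro tendsto_intros D(4)[OF x] approximating_sequence_N_tendsto[OF approx x])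
    then show "(\<lambda>n. 2 * N (g x) * N (g x - s n x) + 2 * N (g x - s n x) * N (s n x)) \<longlonglongrightarrow> 0"
      by simp
  qed
  then show ?thesis
    unfolding approximating_sequence_def using D adjoint_compose_mem
    by (auto intro: simple_function_compose1[where g = "\<lambda>A. op_adjoint A o\<^sub>L A"])
qed

end

section \<open>Integration on a compact abelian group\<close>

locale compact_group_haar_measure = normalized_haar_measure \<mu>
  for \<mu> :: "'g::{topological_ab_group_add, t2_space} measure" +
  assumes compact_UNIV: "compact (UNIV :: 'g set)"
begin

lemma space_haar [simp]: "space \<mu> = UNIV"
  using sets_eq_imp_space_eq[OF sets_eq] by simp

lemma borel_measurable_haar: "f \<in> borel_measurable borel \<Longrightarrow> f \<in> borel_measurable \<mu>"
  using measurable_cong_sets[OF sets_eq refl] by blast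

sublocale finite_measure \<mu>
  by standard (simp add: normalized)

lemma measure_UNIV [simp]: "measure \<mu> UNIV = 1"
  by (simp add: measure_def normalized)

lemma continuous_translate:
  fixes f :: "'g \<Rightarrow> 'b::topological_space"
  assumes "continuous_on UNIV f"
  shows "continuous_on UNIV (\<lambda>x. f (x + a))"
  by (rule continuous_on_compose2[OF assms]) (auto intro!: continuous_intros)

lemma continuous_reflect:
  fixes f :: "'g \<Rightarrow> 'b::topological_space"
  assumes "continuous_on UNIV f"
  shows "continuous_on UNIV (\<lambda>x. f (a - x))"
  unfolding diff_conv_add_uminus
  by (rule continuous_on_compose2[OF assms]) (auto intro!: continuous_intros)

lemma open_translation:
  fixes a :: 'g
  assumes "open U"
  shows "open ((+) a ` U)"
proof -
  have "(+) a ` U = (\<lambda>x. - a + x) -` U"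
    by (auto simp: image_iff intro!: bexI[of _ "- a + _"])
  then show ?thesis
    using assms by (auto intro!: open_vimage continuous_intros)
qed

lemma continuous_bounded:
  fixes f :: "'g \<Rightarrow> 'b::real_normed_vector"
  assumes "continuous_on UNIV f"
  shows "bounded (range f)"
  by (rule compact_imp_bounded[OF compact_continuous_image[OF assms compact_UNIV]])

lemma continuous_integrable:
  fixes f :: "'g \<Rightarrow> 'b::{banach, second_countable_topology}"
  assumes "continuous_on UNIV f"
  shows "integrable \<mu> f"
proof -
  obtain B where "\<And>x. norm (f x) \<le> B"
    using continuous_bounded[OF assms] by (auto simp: bounded_iff)
  then show ?thesis
    by (intro integrable_const_bound[of _ B] AE_I2 borel_measurable_haar
        borel_measurable_continuous_onI assms)
qed

lemma distr_translation: "distr \<mu> \<mu> ((+) a) = \<mu>"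
proof (rule measure_eqI)
  fix E assume "E \<in> sets (distr \<mu> \<mu> ((+) a))"
  then have E: "E \<in> sets borel"
    by (simp add: sets_eq)
  have meas: "(+) a \<in> measurable \<mu> \<mu>"
    unfolding measurable_cong_sets[OF sets_eq sets_eq]
    by (intro borel_measurable_continuous_onI continuous_intros)
  have "(+) a -` E = (\<lambda>x. - a + x) ` E"
    by (auto simp: image_iff intro!: bexI[of _ "a + _"])
  then show "emeasure (distr \<mu> \<mu> ((+) a)) E = emeasure \<mu> E"
    using translation_inv[OF E, of "- a"] E by (simp add: emeasure_distr[OF meas] sets_eq)
qed simp

lemma integral_translation:
  fixes f :: "'g \<Rightarrow> 'b::{banach, second_countable_topology}"
  assumes "f \<in> borel_measurable borel"
  shows "(\<integral>x. f (x + a) \<partial>\<mu>) = (\<integral>x. f x \<partial>\<mu>)"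
proof -
  have "(+) a \<in> measurable \<mu> \<mu>"
    unfolding measurable_cong_sets[OF sets_eq sets_eq]
    by (intro borel_measurable_continuous_onI continuous_intros)
  then have "(\<integral>x. f x \<partial>distr \<mu> \<mu> ((+) a)) = (\<integral>x. f (a + x) \<partial>\<mu>)"
    using borel_measurable_haar[OF assms] by (rule integral_distr)
  then show ?thesis
    by (simp add: distr_translation add.commute)
qed

lemma continuous_integral_translation:
  fixes f :: "'g \<Rightarrow> 'b::{banach, second_countable_topology}"
  assumes "continuous_on UNIV f"
  shows "(\<integral>x. f (x + a) \<partial>\<mu>) = (\<integral>x. f x \<partial>\<mu>)"
  by (rule integral_translation[OF borel_measurable_continuous_onI[OF assms]])

text \<open>Finitely many translates of a nonempty open set cover the group.\<close>

lemma emeasure_open_pos: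
  assumes "open U" "U \<noteq> {}"
  shows "emeasure \<mu> U > 0"
proof (rule ccontr)
  assume "\<not> emeasure \<mu> U > 0"
  then have null: "emeasure \<mu> U = 0"
    by simp
  obtain u where u: "u \<in> U"
    using assms(2) by blast
  have "UNIV \<subseteq> (\<Union>a\<in>UNIV. (+) a ` U)"
  proof
    fix x :: 'g
    have "x = (x - u) + u" by simp
    then show "x \<in> (\<Union>a\<in>UNIV. (+) a ` U)"
      using u by blast
  qed
  then obtain C where C: "finite C" "UNIV \<subseteq> (\<Union>a\<in>C. (+) a ` U)"
    using compactE_image[OF compact_UNIV, of UNIV "\<lambda>a. (+) a ` U"] open_translation[OF assms(1)]
    by metis
  have "emeasure \<mu> ((+) a ` U) = 0" for a
    using translation_inv[of U a] null assms(1) by simp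
  then have "(+) a ` U \<in> null_sets \<mu>" for a
    using open_translation[OF assms(1), of a] by (intro null_setsI) (simp_all add: sets_eq)
  then have "emeasure \<mu> (\<Union>a\<in>C. (+) a ` U) = 0"
    by (intro null_setsD1 null_sets_UN'[OF countable_finite[OF C(1)]])
  moreover have "(\<Union>a\<in>C. (+) a ` U) = UNIV"
    using C(2) by blast
  ultimately show False
    using normalized by simp
qed

lemma continuous_integral_eq_zero:
  fixes f :: "'g \<Rightarrow> real"
  assumes "continuous_on UNIV f" "\<And>x. 0 \<le> f x" "(\<integral>x. f x \<partial>\<mu>) = 0"
  shows "f x = 0"
proof (rule ccontr)
  assume "f x \<noteq> 0"
  define U where "U = f -` (- {0})"
  have U: "open U" "U \<noteq> {}"
    using assms(1) \<open>f x \<noteq> 0\<close> by (auto simp: U_def intro!: open_vimage)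
  have "AE x in \<mu>. f x = 0"
    using assms integral_nonneg_eq_0_iff_AE[OF continuous_integrable[OF assms(1)]] by simp
  then have "AE x in \<mu>. x \<notin> U"
    by (simp add: U_def)
  then have "emeasure \<mu> U = 0"
    using AE_iff_measurable[of U \<mu> "\<lambda>x. x \<notin> U"] U(1) by (simp add: sets_eq)
  then show False
    using emeasure_open_pos[OF U] by simp
qed

lemma uniformly_continuous_group:
  fixes f :: "'g \<Rightarrow> 'b::real_normed_vector"
  assumes f: "continuous_on UNIV f" and "e > 0"
  shows "\<exists>V. open V \<and> 0 \<in> V \<and> (\<forall>v\<in>V. \<forall>x. norm (f (x + v) - f x) < e)"
proof -
  define W where "W = {p :: 'g \<times> 'g. norm (f (snd p + fst p) - f (snd p)) < e}"
  have "continuous_on UNIV (\<lambda>p :: 'g \<times> 'g. f (snd p + fst p))"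
    by (rule continuous_on_compose2[OF f]) (auto intro!: continuous_intros)
  moreover have "continuous_on UNIV (\<lambda>p :: 'g \<times> 'g. f (snd p))"
    by (rule continuous_on_compose2[OF f]) (auto intro!: continuous_intros)
  ultimately have "open W"
    unfolding W_def
    by (intro open_Collect_less continuous_on_norm continuous_on_diff continuous_on_const)
  have "\<exists>A B. open A \<and> open B \<and> 0 \<in> A \<and> x \<in> B \<and> A \<times> B \<subseteq> W" for x
  proof -
    have "(0, x) \<in> W"
      using \<open>e > 0\<close> by (simp add: W_def)
    then obtain A B where "open A" "open B" "(0, x) \<in> A \<times> B" "A \<times> B \<subseteq> W"
      using open_prod_elim[OF \<open>open W\<close>] by metis
    then show ?thesis by blast
  qed
  then obtain A B where AB: "\<And>x. open (A x)" "\<And>x. open (B x)" "\<And>x. 0 \<in> A x" "\<And>x. x \<in> B x"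
    "\<And>x. A x \<times> B x \<subseteq> W"
    by metis
  have "UNIV \<subseteq> (\<Union>x\<in>UNIV. B x)"
    using AB(4) by blast
  then obtain C where C: "finite C" "UNIV \<subseteq> (\<Union>x\<in>C. B x)"
    using compactE_image[OF compact_UNIV, of UNIV B] AB(2) by metis
  have "norm (f (x + v) - f x) < e" if v: "v \<in> (\<Inter>x\<in>C. A x)" for v x
  proof -
    obtain y where "y \<in> C" "x \<in> B y"
      using C(2) by blast
    then have "(v, x) \<in> W"
      using v AB(5)[of y] by blast
    then show ?thesis
      by (simp add: W_def)
  qed
  moreover have "open (\<Inter>x\<in>C. A x)" "0 \<in> (\<Inter>x\<in>C. A x)"
    using C(1) AB(1,3) by auto
  ultimately show ?thesis by blast
qed

lemma uniformly_continuous_imp_continuous: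
  fixes f :: "'g \<Rightarrow> 'b::real_normed_vector"
  assumes "\<And>e. e > 0 \<Longrightarrow> \<exists>V. open V \<and> 0 \<in> V \<and> (\<forall>v\<in>V. \<forall>x. norm (f (x + v) - f x) < e)"
  shows "continuous_on UNIV f"
proof -
  have "\<exists>B. open B \<and> x \<in> B \<and> (\<forall>y\<in>B. dist (f y) (f x) < e)" if e: "e > 0" for x e
  proof -
    obtain V where V: "open V" "0 \<in> V" "\<And>v x. v \<in> V \<Longrightarrow> norm (f (x + v) - f x) < e"
      using assms[OF e] by blast
    have "dist (f y) (f x) < e" if "y \<in> (+) x ` V" for y
      using that V(3) by (auto simp: dist_norm)
    moreover have "x \<in> (+) x ` V"
      using V(2) by (intro image_eqI[of _ _ 0]) simp_all
    ultimately show ?thesis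
      using open_translation[OF V(1), of x] by blast
  qed
  then have "(f \<longlongrightarrow> f x) (nhds x)" for x
    unfolding tendsto_iff eventually_nhds by blast
  then show ?thesis
    unfolding continuous_on_def using tendsto_mono[OF at_within_le_nhds] by blast
qed

lemma finite_translates_cover:
  fixes V :: "'g set"
  assumes "open V" "0 \<in> V"
  shows "\<exists>F. finite F \<and> (\<forall>x. \<exists>p\<in>F. x - p \<in> V)"
proof -
  have "UNIV \<subseteq> (\<Union>a\<in>UNIV. (+) a ` V)"
  proof
    fix x :: 'g
    have "x = x + 0" by simp
    then show "x \<in> (\<Union>a\<in>UNIV. (+) a ` V)"
      using assms(2) by blast
  qed
  then obtain F where F: "finite F" "UNIV \<subseteq> (\<Union>a\<in>F. (+) a ` V)"
    using compactE_image[OF compact_UNIV, of UNIV "\<lambda>a. (+) a ` V"] open_translation[OF assms(1)]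
    by metis
  have "\<exists>p\<in>F. x - p \<in> V" for x
  proof -
    obtain p where "p \<in> F" "x \<in> (+) p ` V"
      using F(2) by blast
    then show ?thesis
      by (intro bexI[of _ p]) auto
  qed
  then show ?thesis
    using F(1) by blast
qed

text \<open>
  The theorem of Arzela and Ascoli for sequences. The space need not be separable, but the moduli of
  continuity reduce convergence to a countable set of points.
\<close>

lemma equicontinuous_convergent_subsequence:
  fixes f :: "nat \<Rightarrow> 'g \<Rightarrow> complex"
  assumes bound: "\<And>n x. norm (f n x) \<le> B"
    and equi: "\<And>e. e > 0 \<Longrightarrow> \<exists>V. open V \<and> 0 \<in> V \<and> (\<forall>v\<in>V. \<forall>n x. norm (f n (x + v) - f n x) < e)"
  shows "\<exists>r h. strict_mono (r :: nat \<Rightarrow> nat) \<and> uniform_limit UNIV (\<lambda>n. f (r n)) h sequentially"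
proof -
  have "\<exists>F. finite F \<and> (\<forall>x. \<exists>p\<in>F. \<forall>n. norm (f n x - f n p) < e)" if e: "e > 0" for e
  proof -
    obtain V where V: "open V" "0 \<in> V" "\<And>v n x. v \<in> V \<Longrightarrow> norm (f n (x + v) - f n x) < e"
      using equi[OF e] by blast
    obtain F where F: "finite F" "\<And>x. \<exists>p\<in>F. x - p \<in> V"
      using finite_translates_cover[OF V(1,2)] by blast
    have "\<exists>p\<in>F. \<forall>n. norm (f n x - f n p) < e" for x
    proof -
      obtain p where p: "p \<in> F" "x - p \<in> V"
        using F(2) by blast
      have "norm (f n x - f n p) < e" for n
        using V(3)[OF p(2), of n p] by simp
      then show ?thesis
        using p(1) by blast
    qed
    then show ?thesis
      using F(1) by blast
  qed
  then obtain F where F: "\<And>e. e > 0 \<Longrightarrow> finite (F e)"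
    and near: "\<And>e x. e > 0 \<Longrightarrow> \<exists>p\<in>F e. \<forall>n. norm (f n x - f n p) < e"
    by metis
  define S where "S = (\<Union>m::nat. F (1 / real (Suc m)))"
  have "countable S"
    unfolding S_def by (rule countable_UN) (simp_all add: countable_finite F)
  then obtain r :: "nat \<Rightarrow> nat" where r: "strict_mono r"
    and conv: "\<And>x. x \<in> S \<Longrightarrow> \<exists>l. (\<lambda>n. f (r n) x) \<longlonglongrightarrow> l"
    using function_convergent_subsequence[of S f B] bound by metis
  have "uniformly_Cauchy_on UNIV (\<lambda>n. f (r n))"
  proof (rule uniformly_Cauchy_onI)
    fix e :: real assume "e > 0"
    then obtain k where k: "1 / real (Suc k) < e / 3"
      using nat_approx_posE[of "e / 3"] by auto
    define d where "d = 1 / real (Suc k)"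
    have d: "d > 0" "d < e / 3"
      using k by (simp_all add: d_def)
    have "\<exists>M. \<forall>m\<ge>M. \<forall>n\<ge>M. dist (f (r m) p) (f (r n) p) < e / 3" if "p \<in> F d" for p
    proof -
      have "p \<in> S"
        using that by (auto simp: S_def d_def)
      then have "Cauchy (\<lambda>n. f (r n) p)"
        using conv convergentI convergent_Cauchy by blast
      then show ?thesis
        using metric_CauchyD[of _ "e / 3"] \<open>e > 0\<close> by simp
    qed
    then obtain M where M: "\<And>p m n. p \<in> F d \<Longrightarrow> m \<ge> M p \<Longrightarrow> n \<ge> M p \<Longrightarrow> dist (f (r m) p) (f (r n) p) < e / 3"
      by metis
    define K where "K = Max (insert 0 (M ` F d))"
    have K: "M p \<le> K" if "p \<in> F d" for p
      unfolding K_def using F[OF d(1)] that by (intro Max_ge) auto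
    have "dist (f (r m) x) (f (r n) x) < e" if "m \<ge> K" "n \<ge> K" for x m n
    proof -
      obtain p where p: "p \<in> F d" "\<And>n. norm (f n x - f n p) < d"
        using near[OF d(1)] by blast
      have "dist (f (r m) p) (f (r n) p) < e / 3"
        using K[OF p(1)] that by (intro M p(1)) linarith+
      moreover have "dist (f (r m) x) (f (r m) p) < e / 3" "dist (f (r n) p) (f (r n) x) < e / 3"
        using p(2)[of "r m"] p(2)[of "r n"] d(2) by (simp_all add: dist_norm norm_minus_commute)
      ultimately show ?thesis
        using dist_triangle[of "f (r m) x" "f (r n) x" "f (r m) p"]
          dist_triangle[of "f (r m) p" "f (r n) x" "f (r n) p"] by linarith
    qed
    then show "\<exists>K. \<forall>x\<in>UNIV. \<forall>m\<ge>K. \<forall>n\<ge>K. dist (f (r m) x) (f (r n) x) < e"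
      by blast
  qed
  then have "\<exists>h. uniform_limit UNIV (\<lambda>n. f (r n)) h sequentially"
    using Cauchy_uniformly_convergent uniformly_convergent_on_def by blast
  then show ?thesis
    using r by blast
qed

lemma integral_uniform_limit:
  fixes f :: "nat \<Rightarrow> 'g \<Rightarrow> 'b::{banach, second_countable_topology}"
  assumes f: "\<And>n. continuous_on UNIV (f n)" and lim: "uniform_limit UNIV f h sequentially"
  shows "(\<lambda>n. \<integral>x. f n x \<partial>\<mu>) \<longlonglongrightarrow> (\<integral>x. h x \<partial>\<mu>)"
proof (rule tendstoI)
  fix e :: real assume e: "e > 0"
  have h: "continuous_on UNIV h"
    using f by (intro uniform_limit_theorem[OF _ lim]) simp_all
  have "\<forall>\<^sub>F n in sequentially. \<forall>x\<in>UNIV. dist (f n x) (h x) < e / 2"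
    using lim e by (intro uniform_limitD) simp_all
  then show "\<forall>\<^sub>F n in sequentially. dist (\<integral>x. f n x \<partial>\<mu>) (\<integral>x. h x \<partial>\<mu>) < e"
  proof eventually_elim
    case (elim n)
    have int: "integrable \<mu> (\<lambda>x. f n x - h x)"
      by (intro continuous_integrable continuous_intros f h)
    have "dist (\<integral>x. f n x \<partial>\<mu>) (\<integral>x. h x \<partial>\<mu>) = norm (\<integral>x. f n x - h x \<partial>\<mu>)"
      by (simp add: dist_norm Bochner_Integration.integral_diff continuous_integrable f h)
    also have "\<dots> \<le> (\<integral>x. norm (f n x - h x) \<partial>\<mu>)"
      by (rule integral_norm_bound)
    also have "\<dots> \<le> (\<integral>x. e / 2 \<partial>\<mu>)"
      using elim by (intro integral_mono integrable_norm int) (auto simp: dist_norm less_imp_le)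
    also have "\<dots> < e"
      using e by simp
    finally show ?case .
  qed
qed

end

section \<open>Characters\<close>

context compact_group_haar_measure
begin

definition square_norm :: "('g \<Rightarrow> complex) \<Rightarrow> real" where
  "square_norm f = (\<integral>x. (cmod (f x))\<^sup>2 \<partial>\<mu>)"

lemma continuous_square:
  fixes f :: "'g \<Rightarrow> complex"
  shows "continuous_on UNIV f \<Longrightarrow> continuous_on UNIV (\<lambda>x. (cmod (f x))\<^sup>2)"
  by (intro continuous_intros)

lemma square_norm_nonneg: "0 \<le> square_norm f"
  by (simp add: square_norm_def)

lemma square_norm_eq_zero:
  assumes "continuous_on UNIV f" "square_norm f = 0"
  shows "f x = 0"
proof -
  have "(\<integral>x. (cmod (f x))\<^sup>2 \<partial>\<mu>) = 0"
    using assms(2) by (simp only: square_norm_def)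
  then have "(cmod (f x))\<^sup>2 = 0"
    by (rule continuous_integral_eq_zero[OF continuous_square[OF assms(1)] zero_le_power2])
  then show ?thesis by simp
qed

lemma square_norm_scale: "square_norm (\<lambda>x. c * f x) = (cmod c)\<^sup>2 * square_norm f"
  by (simp add: square_norm_def norm_mult power_mult_distrib)

lemma square_norm_translate:
  "continuous_on UNIV f \<Longrightarrow> square_norm (\<lambda>x. f (x + a)) = square_norm f"
  unfolding square_norm_def by (rule continuous_integral_translation[OF continuous_square])

lemma parallelogram:
  fixes f g :: "'g \<Rightarrow> complex"
  assumes [continuous_intros]: "continuous_on UNIV f" "continuous_on UNIV g"
  shows "square_norm (\<lambda>x. f x + g x) + square_norm (\<lambda>x. f x - g x)
    = 2 * square_norm f + 2 * square_norm g"
proof -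
  have pointwise: "(cmod (a + b))\<^sup>2 + (cmod (a - b))\<^sup>2 = 2 * (cmod a)\<^sup>2 + 2 * (cmod b)\<^sup>2" for a b
    unfolding cmod_power2 by (simp add: power2_eq_square algebra_simps)
  have "square_norm (\<lambda>x. f x + g x) + square_norm (\<lambda>x. f x - g x)
      = (\<integral>x. (cmod (f x + g x))\<^sup>2 + (cmod (f x - g x))\<^sup>2 \<partial>\<mu>)"
    unfolding square_norm_def
    by (intro Bochner_Integration.integral_add[symmetric] continuous_integrable continuous_intros)
  also have "\<dots> = (\<integral>x. 2 * (cmod (f x))\<^sup>2 + 2 * (cmod (g x))\<^sup>2 \<partial>\<mu>)"
    by (simp only: pointwise)
  also have "\<dots> = 2 * square_norm f + 2 * square_norm g"
    unfolding square_norm_def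
    by (subst Bochner_Integration.integral_add)
       (auto intro!: continuous_integrable continuous_intros)
  finally show ?thesis .
qed

lemma square_norm_uniform_limit:
  assumes f: "\<And>n. continuous_on UNIV (f n)" and lim: "uniform_limit UNIV f h sequentially"
  shows "(\<lambda>n. square_norm (f n)) \<longlonglongrightarrow> square_norm h"
  unfolding square_norm_def
proof (rule integral_uniform_limit)
  show "continuous_on UNIV (\<lambda>x. (cmod (f n x))\<^sup>2)" for n
    by (rule continuous_square[OF f])
  have h: "continuous_on UNIV h"
    using f by (intro uniform_limit_theorem[OF _ lim]) simp_all
  have b: "bounded ((\<lambda>x. cmod (h x)) ` UNIV)"
    by (rule continuous_bounded, rule continuous_on_norm[OF h])
  have "uniform_limit UNIV (\<lambda>n x. cmod (f n x)) (\<lambda>x. cmod (h x)) sequentially"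
    by (rule uniform_limit_norm[OF lim])
  then show "uniform_limit UNIV (\<lambda>n x. (cmod (f n x))\<^sup>2) (\<lambda>x. (cmod (h x))\<^sup>2) sequentially"
    unfolding power2_eq_square
    by (intro bounded_bilinear.bounded_uniform_limit[OF bounded_bilinear_mult] b)
qed

text \<open>
  Equality in Minkowski's inequality. With \<open>P\<close> and \<open>Q\<close> the norms of \<open>p\<close> and \<open>q\<close>,
  the hypothesis bounds their inner product from below by \<open>P Q\<close>, so that \<open>Q p - P q\<close> has norm 0.
\<close>

lemma Minkowski_equality:
  assumes p: "continuous_on UNIV p" and q: "continuous_on UNIV q"
    and le: "sqrt (square_norm p) + sqrt (square_norm q) \<le> sqrt (square_norm (\<lambda>x. p x + q x))"
  shows "complex_of_real (sqrt (square_norm q)) * p x = complex_of_real (sqrt (square_norm p)) * q x"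
proof -
  define P Q where "P = sqrt (square_norm p)" and "Q = sqrt (square_norm q)"
  have PQ: "0 \<le> P" "0 \<le> Q" "P\<^sup>2 = square_norm p" "Q\<^sup>2 = square_norm q"
    by (simp_all add: P_def Q_def square_norm_nonneg)
  define R where "R = (\<integral>x. Re (p x * cnj (q x)) \<partial>\<mu>)"
  have int: "integrable \<mu> (\<lambda>x. (cmod (p x))\<^sup>2)" "integrable \<mu> (\<lambda>x. (cmod (q x))\<^sup>2)"
    "integrable \<mu> (\<lambda>x. Re (p x * cnj (q x)))"
    by (intro continuous_integrable continuous_intros p q)+
  have combination: "square_norm (\<lambda>x. complex_of_real a * p x + complex_of_real b * q x)
      = a\<^sup>2 * P\<^sup>2 + b\<^sup>2 * Q\<^sup>2 + 2 * a * b * R" for a b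
  proof -
    have "(cmod (complex_of_real a * y + complex_of_real b * z))\<^sup>2
        = a\<^sup>2 * (cmod y)\<^sup>2 + b\<^sup>2 * (cmod z)\<^sup>2 + 2 * a * b * Re (y * cnj z)" for y z
      unfolding cmod_power2 by (simp add: power2_eq_square algebra_simps)
    then have "square_norm (\<lambda>x. complex_of_real a * p x + complex_of_real b * q x)
        = (\<integral>x. a\<^sup>2 * (cmod (p x))\<^sup>2 + b\<^sup>2 * (cmod (q x))\<^sup>2 + 2 * a * b * Re (p x * cnj (q x)) \<partial>\<mu>)"
      by (simp only: square_norm_def)
    also have "\<dots> = a\<^sup>2 * P\<^sup>2 + b\<^sup>2 * Q\<^sup>2 + 2 * a * b * R"
      unfolding PQ square_norm_def R_def using int
      by (simp add: Bochner_Integration.integral_add del: Re_complex_of_real times_complex.sel)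
    finally show ?thesis .
  qed
  have "(P + Q)\<^sup>2 \<le> (sqrt (square_norm (\<lambda>x. p x + q x)))\<^sup>2"
    using le PQ(1,2) by (intro power_mono) (simp_all add: P_def Q_def)
  also have "\<dots> = P\<^sup>2 + Q\<^sup>2 + 2 * R"
    using combination[of 1 1] unfolding real_sqrt_pow2[OF square_norm_nonneg] by simp
  finally have "P * Q \<le> R"
    by (simp add: power2_sum)
  then have "P * Q * (P * Q) \<le> P * Q * R"
    using PQ(1,2) by (intro mult_left_mono) simp_all
  moreover have "square_norm (\<lambda>x. complex_of_real Q * p x + complex_of_real (- P) * q x)
      = 2 * (P * Q * (P * Q)) - 2 * (P * Q * R)"
    unfolding combination by (simp add: power2_eq_square algebra_simps)
  ultimately have "square_norm (\<lambda>x. complex_of_real Q * p x + complex_of_real (- P) * q x) = 0"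
    using square_norm_nonneg[of "\<lambda>x. complex_of_real Q * p x + complex_of_real (- P) * q x"] by linarith
  then have "complex_of_real Q * p x + complex_of_real (- P) * q x = 0"
    by (intro square_norm_eq_zero[of "\<lambda>x. complex_of_real Q * p x + complex_of_real (- P) * q x"]
        continuous_intros p q)
  then show ?thesis
    by (simp add: P_def Q_def)
qed

definition convolve :: "('g \<Rightarrow> complex) \<Rightarrow> ('g \<Rightarrow> complex) \<Rightarrow> 'g \<Rightarrow> complex" where
  "convolve \<phi> u w = (\<integral>y. \<phi> (w - y) * u y \<partial>\<mu>)"

text \<open>
  This is the inner product of \<open>\<phi> * u\<close>, translated by \<open>x\<close>, and \<open>v\<close>. It is sesquilinear in \<open>u\<close>
  and \<open>v\<close>, which may be translated at the expense of translating the result.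
\<close>

definition correlation :: "('g \<Rightarrow> complex) \<Rightarrow> ('g \<Rightarrow> complex) \<Rightarrow> ('g \<Rightarrow> complex) \<Rightarrow> 'g \<Rightarrow> complex" where
  "correlation \<phi> u v x = (\<integral>s. convolve \<phi> u (x + s) * cnj (v s) \<partial>\<mu>)"

lemma convolve_integrable:
  fixes \<phi> u :: "'g \<Rightarrow> complex"
  assumes "continuous_on UNIV \<phi>" "continuous_on UNIV u"
  shows "integrable \<mu> (\<lambda>y. \<phi> (w - y) * u y)"
  by (intro continuous_integrable continuous_on_mult continuous_reflect assms)

lemma norm_convolve_le:
  assumes \<phi>: "continuous_on UNIV \<phi>" and u: "continuous_on UNIV u" and bound: "\<And>w. cmod (\<phi> w) \<le> e"
  shows "cmod (convolve \<phi> u w) \<le> e * (\<integral>y. cmod (u y) \<partial>\<mu>)"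
proof -
  have "cmod (convolve \<phi> u w) \<le> (\<integral>y. cmod (\<phi> (w - y) * u y) \<partial>\<mu>)"
    unfolding convolve_def by (rule integral_norm_bound)
  also have "\<dots> \<le> (\<integral>y. e * cmod (u y) \<partial>\<mu>)"
    using bound
    by (intro integral_mono integrable_norm convolve_integrable \<phi> u continuous_integrable continuous_intros)
       (simp add: norm_mult mult_right_mono)
  finally show ?thesis by simp
qed

lemma convolve_shift: "convolve \<phi> u (w + d) = convolve (\<lambda>w. \<phi> (w + d)) u w"
  by (simp add: convolve_def algebra_simps)

lemma convolve_diff_kernel:
  assumes "continuous_on UNIV \<phi>" "continuous_on UNIV \<psi>" "continuous_on UNIV u"
  shows "convolve (\<lambda>w. \<phi> w - \<psi> w) u w = convolve \<phi> u w - convolve \<psi> u w"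
  unfolding convolve_def left_diff_distrib
  by (intro Bochner_Integration.integral_diff convolve_integrable assms)

lemma convolve_linear:
  assumes "continuous_on UNIV \<phi>" "continuous_on UNIV u" "continuous_on UNIV v"
  shows "convolve \<phi> (\<lambda>x. u x + c * v x) w = convolve \<phi> u w + c * convolve \<phi> v w"
proof -
  have "convolve \<phi> (\<lambda>x. u x + c * v x) w = (\<integral>y. \<phi> (w - y) * u y + c * (\<phi> (w - y) * v y) \<partial>\<mu>)"
    unfolding convolve_def by (simp add: algebra_simps)
  also have "\<dots> = convolve \<phi> u w + c * convolve \<phi> v w"
    unfolding convolve_def using convolve_integrable[OF assms(1)] assms(2,3) by simp
  finally show ?thesis .
qed

lemma convolve_increment_le:
  assumes "continuous_on UNIV \<phi>" "continuous_on UNIV u" "\<And>w. cmod (\<phi> (w + d) - \<phi> w) \<le> e"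
  shows "cmod (convolve \<phi> u (x + d) - convolve \<phi> u x) \<le> e * (\<integral>y. cmod (u y) \<partial>\<mu>)"
  using norm_convolve_le[of "\<lambda>w. \<phi> (w + d) - \<phi> w" u e x] assms
  by (simp add: convolve_diff_kernel continuous_translate convolve_shift continuous_intros)

text \<open>
  A family is equicontinuous if its increments are bounded by those of a single continuous function.
\<close>

lemma equicontinuous_by_increments:
  fixes F :: "'i \<Rightarrow> 'g \<Rightarrow> complex"
  assumes \<phi>: "continuous_on UNIV \<phi>" and "0 \<le> U" and "e > 0"
    and increment: "\<And>i d e x. (\<And>w. cmod (\<phi> (w + d) - \<phi> w) \<le> e) \<Longrightarrow> cmod (F i (x + d) - F i x) \<le> e * U"
  shows "\<exists>V. open V \<and> 0 \<in> V \<and> (\<forall>d\<in>V. \<forall>i x. cmod (F i (x + d) - F i x) < e)"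
proof -
  obtain V where V: "open V" "0 \<in> V" "\<And>d x. d \<in> V \<Longrightarrow> cmod (\<phi> (x + d) - \<phi> x) < e / (U + 1)"
    using uniformly_continuous_group[OF \<phi>, of "e / (U + 1)"] assms(2,3) by auto
  have "cmod (F i (x + d) - F i x) < e" if d: "d \<in> V" for d i x
  proof -
    have "cmod (F i (x + d) - F i x) \<le> e / (U + 1) * U"
      by (rule increment) (rule less_imp_le[OF V(3)[OF d]])
    also have "\<dots> < e"
      using assms(2,3) by (simp add: field_simps)
    finally show ?thesis .
  qed
  then show ?thesis
    using V(1,2) by blast
qed

lemma convolve_continuous:
  assumes \<phi>: "continuous_on UNIV \<phi>" and u: "continuous_on UNIV u"
  shows "continuous_on UNIV (convolve \<phi> u)"
proof (rule uniformly_continuous_imp_continuous)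
  fix e :: real assume e: "e > 0"
  have U: "0 \<le> (\<integral>y. cmod (u y) \<partial>\<mu>)"
    by simp
  show "\<exists>V. open V \<and> 0 \<in> V \<and> (\<forall>v\<in>V. \<forall>x. norm (convolve \<phi> u (x + v) - convolve \<phi> u x) < e)"
    using equicontinuous_by_increments[OF \<phi> U e, of "\<lambda>_::unit. convolve \<phi> u"]
      convolve_increment_le[OF \<phi> u] by simp
qed

lemma convolve_translate:
  assumes "continuous_on UNIV \<phi>" "continuous_on UNIV u"
  shows "convolve \<phi> (\<lambda>y. u (y + a)) w = convolve \<phi> u (w + a)"
proof -
  have "convolve \<phi> (\<lambda>y. u (y + a)) w = (\<integral>y. (\<lambda>y. \<phi> (w + a - y) * u y) (y + a) \<partial>\<mu>)"
    by (simp add: convolve_def)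
  also have "\<dots> = convolve \<phi> u (w + a)"
    unfolding convolve_def
    by (intro continuous_integral_translation continuous_on_mult continuous_reflect assms)
  finally show ?thesis .
qed

lemma correlation_continuous_integrand:
  assumes "continuous_on UNIV \<phi>" "continuous_on UNIV u" "continuous_on UNIV v"
  shows "continuous_on UNIV (\<lambda>s. convolve \<phi> u (x + s) * cnj (v s))"
  using continuous_translate[OF convolve_continuous[OF assms(1,2)], of x]
  by (intro continuous_on_mult continuous_on_cnj assms) (simp add: add.commute)

lemma correlation_integrable:
  assumes "continuous_on UNIV \<phi>" "continuous_on UNIV u" "continuous_on UNIV v"
  shows "integrable \<mu> (\<lambda>s. convolve \<phi> u (x + s) * cnj (v s))"
  by (intro continuous_integrable correlation_continuous_integrand assms)

lemma norm_correlation_le: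
  assumes \<phi>: "continuous_on UNIV \<phi>" and u: "continuous_on UNIV u" and v: "continuous_on UNIV v"
    and bound: "\<And>w. cmod (\<phi> w) \<le> e"
  shows "cmod (correlation \<phi> u v x) \<le> e * (\<integral>y. cmod (u y) \<partial>\<mu>) * (\<integral>y. cmod (v y) \<partial>\<mu>)"
proof -
  have "cmod (correlation \<phi> u v x) \<le> (\<integral>s. cmod (convolve \<phi> u (x + s) * cnj (v s)) \<partial>\<mu>)"
    unfolding correlation_def by (rule integral_norm_bound)
  also have "\<dots> \<le> (\<integral>s. e * (\<integral>y. cmod (u y) \<partial>\<mu>) * cmod (v s) \<partial>\<mu>)"
    using norm_convolve_le[OF \<phi> u bound]
    by (intro integral_mono integrable_norm correlation_integrable \<phi> u v continuous_integrable continuous_intros)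
       (simp add: norm_mult mult_right_mono)
  finally show ?thesis by simp
qed

lemma correlation_shift: "correlation \<phi> u v (x + d) = correlation (\<lambda>w. \<phi> (w + d)) u v x"
  unfolding correlation_def by (simp add: convolve_shift[symmetric] algebra_simps)

lemma correlation_diff_kernel:
  assumes "continuous_on UNIV \<phi>" "continuous_on UNIV \<psi>" "continuous_on UNIV u" "continuous_on UNIV v"
  shows "correlation (\<lambda>w. \<phi> w - \<psi> w) u v x = correlation \<phi> u v x - correlation \<psi> u v x"
  unfolding correlation_def convolve_diff_kernel[OF assms(1-3)] left_diff_distrib
  by (intro Bochner_Integration.integral_diff correlation_integrable assms)

lemma correlation_linear_left:
  assumes "continuous_on UNIV \<phi>" "continuous_on UNIV u" "continuous_on UNIV u'" "continuous_on UNIV v"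
  shows "correlation \<phi> (\<lambda>x. u x + c * u' x) v x = correlation \<phi> u v x + c * correlation \<phi> u' v x"
proof -
  have "correlation \<phi> (\<lambda>x. u x + c * u' x) v x
      = (\<integral>s. convolve \<phi> u (x + s) * cnj (v s) + c * (convolve \<phi> u' (x + s) * cnj (v s)) \<partial>\<mu>)"
    unfolding correlation_def convolve_linear[OF assms(1-3)] by (simp add: algebra_simps)
  also have "\<dots> = correlation \<phi> u v x + c * correlation \<phi> u' v x"
    unfolding correlation_def using correlation_integrable[OF assms(1)] assms(2-4) by simp
  finally show ?thesis .
qed

lemma correlation_linear_right:
  assumes "continuous_on UNIV \<phi>" "continuous_on UNIV u" "continuous_on UNIV v" "continuous_on UNIV v'"
  shows "correlation \<phi> u (\<lambda>x. v x + c * v' x) x = correlation \<phi> u v x + cnj c * correlation \<phi> u v' x"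
proof -
  have "correlation \<phi> u (\<lambda>x. v x + c * v' x) x
      = (\<integral>s. convolve \<phi> u (x + s) * cnj (v s) + cnj c * (convolve \<phi> u (x + s) * cnj (v' s)) \<partial>\<mu>)"
    unfolding correlation_def by (simp add: algebra_simps)
  also have "\<dots> = correlation \<phi> u v x + cnj c * correlation \<phi> u v' x"
    unfolding correlation_def using correlation_integrable[OF assms(1)] assms(2-4) by simp
  finally show ?thesis .
qed

lemma correlation_expand:
  assumes "continuous_on UNIV \<phi>" "continuous_on UNIV u" "continuous_on UNIV v"
  shows "correlation \<phi> (\<lambda>x. u x + c * v x) (\<lambda>x. u x + c * v x) x
    = correlation \<phi> u u x + c * correlation \<phi> v u x + cnj c * correlation \<phi> u v x
      + (cmod c)\<^sup>2 * correlation \<phi> v v x"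
proof -
  have cont: "continuous_on UNIV (\<lambda>x. u x + c * v x)"
    by (intro continuous_intros assms)
  have "correlation \<phi> (\<lambda>x. u x + c * v x) (\<lambda>x. u x + c * v x) x
      = correlation \<phi> u u x + cnj c * correlation \<phi> u v x
        + c * (correlation \<phi> v u x + cnj c * correlation \<phi> v v x)"
    by (simp only: correlation_linear_left[OF assms cont]
        correlation_linear_right[OF assms(1,2,2,3)] correlation_linear_right[OF assms(1,3,2,3)])
  then show ?thesis
    using complex_norm_square[of c] by (simp add: algebra_simps)
qed

lemma correlation_translate_left:
  assumes "continuous_on UNIV \<phi>" "continuous_on UNIV u"
  shows "correlation \<phi> (\<lambda>x. u (x + a)) v x = correlation \<phi> u v (x + a)"
  unfolding correlation_def convolve_translate[OF assms] by (simp add: algebra_simps)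

lemma correlation_translate_right:
  assumes "continuous_on UNIV \<phi>" "continuous_on UNIV u" "continuous_on UNIV v"
  shows "correlation \<phi> u (\<lambda>x. v (x + a)) x = correlation \<phi> u v (x - a)"
proof -
  have "correlation \<phi> u (\<lambda>x. v (x + a)) x
      = (\<integral>s. (\<lambda>s. convolve \<phi> u (x - a + s) * cnj (v s)) (s + a) \<partial>\<mu>)"
    by (simp add: correlation_def algebra_simps)
  also have "\<dots> = correlation \<phi> u v (x - a)"
    unfolding correlation_def
    by (intro continuous_integral_translation correlation_continuous_integrand assms)
  finally show ?thesis .
qed

lemma correlation_increment_le:
  assumes "continuous_on UNIV \<phi>" "continuous_on UNIV u" "continuous_on UNIV v"
    and "\<And>w. cmod (\<phi> (w + d) - \<phi> w) \<le> e"
  shows "cmod (correlation \<phi> u v (x + d) - correlation \<phi> u v x)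
    \<le> e * ((\<integral>y. cmod (u y) \<partial>\<mu>) * (\<integral>y. cmod (v y) \<partial>\<mu>))"
  using norm_correlation_le[of "\<lambda>w. \<phi> (w + d) - \<phi> w" u v e x] assms
  by (simp add: correlation_diff_kernel continuous_translate correlation_shift continuous_intros mult.assoc)

lemma correlation_continuous:
  assumes \<phi>: "continuous_on UNIV \<phi>" and u: "continuous_on UNIV u" and v: "continuous_on UNIV v"
  shows "continuous_on UNIV (correlation \<phi> u v)"
proof (rule uniformly_continuous_imp_continuous)
  fix e :: real assume e: "e > 0"
  have U: "0 \<le> (\<integral>y. cmod (u y) \<partial>\<mu>) * (\<integral>y. cmod (v y) \<partial>\<mu>)"
    by simp
  show "\<exists>V. open V \<and> 0 \<in> V \<and> (\<forall>d\<in>V. \<forall>x. norm (correlation \<phi> u v (x + d) - correlation \<phi> u v x) < e)"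
    using equicontinuous_by_increments[OF \<phi> U e, of "\<lambda>_::unit. correlation \<phi> u v"]
      correlation_increment_le[OF \<phi> u v] by simp
qed

lemma integral_norm_le_one:
  assumes u: "continuous_on UNIV u" and "square_norm u \<le> 1"
  shows "(\<integral>y. cmod (u y) \<partial>\<mu>) \<le> 1"
proof -
  have "(\<integral>y. cmod (u y) \<partial>\<mu>) \<le> (\<integral>y. (1 + (cmod (u y))\<^sup>2) / 2 \<partial>\<mu>)"
  proof (intro integral_mono continuous_integrable continuous_intros u)
    show "cmod (u y) \<le> (1 + (cmod (u y))\<^sup>2) / 2" for y
      using zero_le_power2[of "cmod (u y) - 1"] by (simp add: power2_diff)
  qed simp
  also have "\<dots> = (1 + square_norm u) / 2"
    unfolding square_norm_def
    by (subst integral_divide_zero, subst Bochner_Integration.integral_add)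
       (auto intro!: continuous_integrable continuous_intros u)
  finally show ?thesis
    using assms(2) by simp
qed

abbreviation autocorrelation :: "('g \<Rightarrow> complex) \<Rightarrow> ('g \<Rightarrow> complex) \<Rightarrow> 'g \<Rightarrow> complex" where
  "autocorrelation \<phi> u \<equiv> correlation \<phi> u u"

lemma autocorrelation_scale:
  assumes "continuous_on UNIV \<phi>" "continuous_on UNIV u"
  shows "autocorrelation \<phi> (\<lambda>x. c * u x) x = (cmod c)\<^sup>2 * autocorrelation \<phi> u x"
proof -
  have zero: "correlation \<phi> (\<lambda>x. 0) v x = 0" "correlation \<phi> v (\<lambda>x. 0) x = 0" for v
    by (simp_all add: correlation_def convolve_def)
  show ?thesis
    using correlation_expand[OF assms(1) continuous_on_const assms(2), of 0 c x] by (simp add: zero)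
qed

text \<open>
  If all autocorrelations were 0, then by polarization all correlations and hence the convolution operator
  would be 0, which is seen to be impossible by applying it to the reflected conjugate of \<open>\<phi>\<close>.
\<close>

lemma autocorrelation_nonzero:
  assumes \<phi>: "continuous_on UNIV \<phi>" and "\<phi> w \<noteq> 0"
  shows "\<exists>u x. continuous_on UNIV u \<and> autocorrelation \<phi> u x \<noteq> 0"
proof (rule ccontr)
  assume "\<not> ?thesis"
  then have zero: "continuous_on UNIV u \<Longrightarrow> autocorrelation \<phi> u x = 0" for u x
    by blast
  have polar: "correlation \<phi> u v x = 0"
    if u: "continuous_on UNIV u" and v: "continuous_on UNIV v" for u v x
  proof -
    have "c * correlation \<phi> v u x + cnj c * correlation \<phi> u v x = 0" for c
    proof -
      have "continuous_on UNIV (\<lambda>x. u x + c * v x)"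
        by (intro continuous_intros u v)
      from zero[OF this, of x] show ?thesis
        unfolding correlation_expand[OF \<phi> u v] by (simp add: zero u v)
    qed
    from this[of 1] this[of \<i>] show ?thesis
      by (simp add: algebra_simps)
  qed
  define u where "u y = cnj (\<phi> (w - y))" for y
  have u: "continuous_on UNIV u"
    unfolding u_def by (intro continuous_on_cnj continuous_reflect \<phi>)
  define v where "v = convolve \<phi> u"
  have v: "continuous_on UNIV v"
    unfolding v_def by (rule convolve_continuous[OF \<phi> u])
  have "0 = correlation \<phi> u v 0"
    by (simp add: polar u v)
  also have "\<dots> = (\<integral>s. complex_of_real ((cmod (v s))\<^sup>2) \<partial>\<mu>)"
    unfolding correlation_def v_def[symmetric] by (simp only: complex_norm_square add_0)
  also have "\<dots> = complex_of_real (square_norm v)"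
    unfolding square_norm_def by (rule integral_complex_of_real)
  finally have "square_norm v = 0"
    by simp
  then have "v w = 0"
    by (rule square_norm_eq_zero[OF v])
  then have "(\<integral>y. complex_of_real ((cmod (\<phi> (w - y)))\<^sup>2) \<partial>\<mu>) = 0"
    unfolding v_def convolve_def u_def by (simp only: complex_norm_square)
  then have "square_norm (\<lambda>y. \<phi> (w - y)) = 0"
    unfolding square_norm_def integral_complex_of_real by simp
  then have "\<phi> (w - 0) = 0"
    by (rule square_norm_eq_zero[OF continuous_reflect[OF \<phi>]])
  then show False
    using assms(2) by simp
qed

text \<open>
  A uniform limit of autocorrelations, of maximal norm, exists since the autocorrelations of the
  functions of norm at most 1 are bounded and equicontinuous.
\<close>

lemma extremal_autocorrelation:
  assumes \<phi>: "continuous_on UNIV \<phi>" and "\<phi> w \<noteq> 0"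
  obtains u h where "\<And>n::nat. continuous_on UNIV (u n)" "\<And>n. square_norm (u n) \<le> 1"
    and "uniform_limit UNIV (\<lambda>n. autocorrelation \<phi> (u n)) h sequentially" "square_norm h > 0"
    and "\<And>v. continuous_on UNIV v \<Longrightarrow>
      sqrt (square_norm (autocorrelation \<phi> v)) \<le> sqrt (square_norm h) * square_norm v"
proof -
  let ?h = "autocorrelation \<phi>"
  define S where "S = {square_norm (?h u) | u. continuous_on UNIV u \<and> square_norm u \<le> 1}"
  define M where "M = Sup S"
  obtain B where B: "\<And>w. cmod (\<phi> w) \<le> B"
    using continuous_bounded[OF \<phi>] by (auto simp: bounded_iff)
  have bound: "cmod (?h u x) \<le> B" if u: "continuous_on UNIV u" "square_norm u \<le> 1" for u x
  proof -
    have "0 \<le> B"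
      using B norm_ge_zero order_trans by blast
    moreover have "(\<integral>y. cmod (u y) \<partial>\<mu>) \<le> 1"
      by (rule integral_norm_le_one[OF u])
    ultimately have "B * (\<integral>y. cmod (u y) \<partial>\<mu>) * (\<integral>y. cmod (u y) \<partial>\<mu>) \<le> B * 1 * 1"
      by (intro mult_mono) simp_all
    then show ?thesis
      using norm_correlation_le[OF \<phi> u(1) u(1) B, of x] by simp
  qed
  have "s \<le> B\<^sup>2" if s: "s \<in> S" for s
  proof -
    obtain u where u: "continuous_on UNIV u" "square_norm u \<le> 1" and s: "s = square_norm (?h u)"
      using s by (auto simp: S_def)
    have "s \<le> (\<integral>x. B\<^sup>2 \<partial>\<mu>)"
      unfolding s square_norm_def using bound[OF u]
      by (intro integral_mono continuous_integrable continuous_square correlation_continuous \<phi> u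
          continuous_on_const power_mono) simp_all
    then show ?thesis by simp
  qed
  then have bdd: "bdd_above S"
    by (rule bdd_aboveI)
  have le_M: "square_norm (?h u) \<le> M" if "continuous_on UNIV u" "square_norm u \<le> 1" for u
    unfolding M_def using that by (intro cSup_upper bdd) (auto simp: S_def)
  have M0: "0 \<le> M"
    by (rule order_trans[OF square_norm_nonneg le_M[of "\<lambda>x. 0"]]) (simp_all add: square_norm_def)
  have homogeneous: "sqrt (square_norm (?h v)) \<le> sqrt M * square_norm v" if v: "continuous_on UNIV v" for v
  proof (cases "square_norm v = 0")
    case True
    then have "v x = 0" for x
      by (rule square_norm_eq_zero[OF v])
    then have "?h v x = 0" for x
      by (simp add: correlation_def)
    then show ?thesis
      using True by (simp add: square_norm_def)
  next
    case False
    define t where "t = square_norm v"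
    have t: "t > 0"
      using False square_norm_nonneg[of v] by (simp add: t_def)
    define c where "c = complex_of_real (1 / sqrt t)"
    have c: "(cmod c)\<^sup>2 = 1 / t"
      using t by (simp add: c_def norm_divide power_divide)
    have "square_norm (\<lambda>x. c * v x) \<le> 1"
      unfolding square_norm_scale c using t by (simp add: t_def)
    then have "square_norm (?h (\<lambda>x. c * v x)) \<le> M"
      by (intro le_M continuous_intros v)
    also have "?h (\<lambda>x. c * v x) = (\<lambda>x. complex_of_real (1 / t) * ?h v x)"
      unfolding autocorrelation_scale[OF \<phi> v, of c] c fun_eq_iff by simp
    also have "square_norm \<dots> = (1 / t)\<^sup>2 * square_norm (?h v)"
      unfolding square_norm_scale by (simp add: norm_divide power_divide)
    finally have "square_norm (?h v) \<le> M * t\<^sup>2"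
      using t by (simp add: field_simps)
    then have "sqrt (square_norm (?h v)) \<le> sqrt (M * t\<^sup>2)"
      by (rule real_sqrt_le_mono)
    also have "\<dots> = sqrt M * t"
      using t by (simp add: real_sqrt_mult)
    finally show ?thesis
      by (simp add: t_def)
  qed
  have "\<exists>u. continuous_on UNIV u \<and> square_norm u \<le> 1 \<and> M - 1 / real (Suc n) < square_norm (?h u)" for n
  proof -
    have "square_norm (?h (\<lambda>x. 0)) \<in> S"
      by (auto simp: S_def square_norm_def intro!: exI[of _ "\<lambda>x. 0"])
    then have "\<exists>s\<in>S. M - 1 / real (Suc n) < s"
      unfolding M_def using bdd by (subst less_cSup_iff[symmetric]) auto
    then show ?thesis
      by (auto simp: S_def)
  qed
  then obtain u where u: "\<And>n. continuous_on UNIV (u n)" "\<And>n. square_norm (u n) \<le> 1"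
    and near: "\<And>n. M - 1 / real (Suc n) < square_norm (?h (u n))"
    by metis
  have equi: "\<exists>V. open V \<and> 0 \<in> V \<and> (\<forall>v\<in>V. \<forall>n x. norm (?h (u n) (x + v) - ?h (u n) x) < e)"
    if e: "e > 0" for e
  proof (rule equicontinuous_by_increments[OF \<phi> zero_le_one e])
    fix n d x and e :: real assume increment: "\<And>w. cmod (\<phi> (w + d) - \<phi> w) \<le> e"
    let ?I = "\<integral>y. cmod (u n y) \<partial>\<mu>"
    have "0 \<le> e"
      using increment norm_ge_zero order_trans by blast
    then have "e * (?I * ?I) \<le> e * (1 * 1)"
      using integral_norm_le_one[OF u] by (intro mult_left_mono mult_mono) simp_all
    then show "cmod (?h (u n) (x + d) - ?h (u n) x) \<le> e * 1"
      using correlation_increment_le[OF \<phi> u(1) u(1) increment, of n n x] by simp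
  qed
  obtain r h where r: "strict_mono (r :: nat \<Rightarrow> nat)"
    and lim: "uniform_limit UNIV (\<lambda>n. ?h (u (r n))) h sequentially"
    using equicontinuous_convergent_subsequence[of "\<lambda>n. ?h (u n)" B, OF bound[OF u] equi] by blast
  have "square_norm h = M"
  proof (rule LIMSEQ_unique)
    show "(\<lambda>n. square_norm (?h (u (r n)))) \<longlonglongrightarrow> square_norm h"
      by (intro square_norm_uniform_limit lim correlation_continuous \<phi> u)
    show "(\<lambda>n. square_norm (?h (u (r n)))) \<longlonglongrightarrow> M"
    proof (rule tendsto_sandwich)
      show "\<forall>\<^sub>F n in sequentially. M - 1 / real (Suc (r n)) \<le> square_norm (?h (u (r n)))"
        by (intro always_eventually allI less_imp_le near)
      show "\<forall>\<^sub>F n in sequentially. square_norm (?h (u (r n))) \<le> M"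
        by (intro always_eventually allI le_M u)
      have "(\<lambda>n. 1 / real (Suc n)) \<longlonglongrightarrow> 0"
        by (rule LIMSEQ_Suc[OF lim_1_over_n])
      then have "(\<lambda>n. 1 / real (Suc (r n))) \<longlonglongrightarrow> 0"
        using LIMSEQ_subseq_LIMSEQ[OF _ r] by (fastforce simp: o_def)
      then show "(\<lambda>n. M - 1 / real (Suc (r n))) \<longlonglongrightarrow> M"
        using tendsto_diff[OF tendsto_const[of M]] by fastforce
    qed simp
  qed
  moreover have "M > 0"
  proof -
    obtain v x where v: "continuous_on UNIV v" "?h v x \<noteq> 0"
      using autocorrelation_nonzero[OF assms] by blast
    then have "square_norm (?h v) \<noteq> 0"
      using square_norm_eq_zero[OF correlation_continuous[OF \<phi> v(1,1)]] by blast
    then have "0 < sqrt (square_norm (?h v))"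
      using square_norm_nonneg[of "?h v"] by simp
    then have "0 < sqrt M * square_norm v"
      using homogeneous[OF v(1)] by linarith
    then show ?thesis
      using M0 by (cases "M = 0") auto
  qed
  ultimately show thesis
    using that[of "\<lambda>n. u (r n)" h, OF u(1) u(2) lim] homogeneous by blast
qed

lemma uniform_limit_translate:
  assumes "uniform_limit UNIV f h sequentially"
  shows "uniform_limit UNIV (\<lambda>n x. f n (x + a)) (\<lambda>x. h (x + (a :: 'g))) sequentially"
  using assms unfolding uniform_limit_iff by (auto elim!: eventually_mono)

text \<open>
  With \<open>z\<close> unimodular, the autocorrelations of \<open>u(x) \<plusminus> z u(x + a)\<close> are \<open>2 h(x) \<plusminus> k(x)\<close>, where
  \<open>k(x) = z h(x + a) + cnj z h(x - a)\<close>. By the parallelogram law for \<open>u\<close>, their norms add up to at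
  most 4 times the maximum. Hence if \<open>h\<close> is extremal, there is equality in
  Minkowski's inequality, and \<open>k\<close> is a real multiple of \<open>h\<close>.
\<close>

lemma extremal_eigenfunction:
  assumes \<phi>: "continuous_on UNIV \<phi>"
    and u: "\<And>n::nat. continuous_on UNIV (u n)" "\<And>n. square_norm (u n) \<le> 1"
    and lim: "uniform_limit UNIV (\<lambda>n. autocorrelation \<phi> (u n)) h sequentially"
    and pos: "square_norm h > 0"
    and extremal: "\<And>v. continuous_on UNIV v \<Longrightarrow>
      sqrt (square_norm (autocorrelation \<phi> v)) \<le> sqrt (square_norm h) * square_norm v"
  shows "\<exists>c. \<forall>x. h (x + a) = c * h x"
proof -
  let ?h = "\<lambda>n. autocorrelation \<phi> (u n)"
  have hn: "continuous_on UNIV (?h n)" for n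
    by (rule correlation_continuous[OF \<phi> u(1) u(1)])
  have h: "continuous_on UNIV h"
    using hn by (intro uniform_limit_theorem[OF _ lim]) simp_all
  define m where "m = sqrt (square_norm h)"
  have m: "m > 0"
    using pos by (simp add: m_def)
  have multiple: "\<exists>r. \<forall>x. z * h (x + a) + cnj z * h (x - a) = complex_of_real r * h x"
    if z: "cmod z = 1" for z
  proof -
    define k where "k x = z * h (x + a) + cnj z * h (x - a)" for x
    define K where "K n x = z * ?h n (x + a) + cnj z * ?h n (x - a)" for n x
    have k: "continuous_on UNIV k" and K: "continuous_on UNIV (K n)" for n
      unfolding k_def K_def diff_conv_add_uminus
      by (intro continuous_intros continuous_translate h hn)+
    have K_lim: "uniform_limit UNIV (\<lambda>n x. K n x) k sequentially"
      unfolding k_def K_def diff_conv_add_uminus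
      by (intro uniform_limit_add bounded_linear.uniform_limit[OF bounded_linear_mult_right]
          uniform_limit_translate lim)
    have h2: "uniform_limit UNIV (\<lambda>n x. 2 * ?h n x) (\<lambda>x. 2 * h x) sequentially"
      by (intro bounded_linear.uniform_limit[OF bounded_linear_mult_right] lim)
    define p where "p n x = 2 * ?h n x + K n x" for n x
    define q where "q n x = 2 * ?h n x - K n x" for n x
    have translated: "autocorrelation \<phi> (\<lambda>x. u n x + c * u n (x + a)) x
        = 2 * ?h n x + (c * ?h n (x + a) + cnj c * ?h n (x - a))" if c: "cmod c = 1" for c n x
    proof -
      note un = u(1)[of n]
      note una = continuous_translate[OF un, of a]
      have "correlation \<phi> (\<lambda>x. u n (x + a)) (\<lambda>x. u n (x + a)) x = ?h n (x - a + a)"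
        by (simp only: correlation_translate_right[OF \<phi> una un] correlation_translate_left[OF \<phi> un])
      then show ?thesis
        unfolding correlation_expand[OF \<phi> un una] correlation_translate_left[OF \<phi> un]
          correlation_translate_right[OF \<phi> un un] using c by simp
    qed
    have pn: "autocorrelation \<phi> (\<lambda>x. u n x + z * u n (x + a)) = p n" for n
      unfolding fun_eq_iff translated[OF z] p_def K_def by simp
    have qn: "autocorrelation \<phi> (\<lambda>x. u n x - z * u n (x + a)) = q n" for n
      using translated[of "- z" n] z unfolding fun_eq_iff q_def K_def by (simp add: algebra_simps)
    have "sqrt (square_norm (p n)) + sqrt (square_norm (q n)) \<le> 4 * m" for n
    proof -
      note ua = continuous_translate[OF u(1)[of n], of a]
      have "sqrt (square_norm (p n)) + sqrt (square_norm (q n))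
          \<le> m * square_norm (\<lambda>x. u n x + z * u n (x + a)) + m * square_norm (\<lambda>x. u n x - z * u n (x + a))"
        unfolding pn[symmetric] qn[symmetric] m_def
        by (intro add_mono extremal continuous_intros u(1) ua)
      also have "\<dots> = m * (square_norm (\<lambda>x. u n x + z * u n (x + a))
          + square_norm (\<lambda>x. u n x - z * u n (x + a)))"
        by (rule distrib_left[symmetric])
      also have "\<dots> = m * (2 * square_norm (u n) + 2 * square_norm (u n))"
        using parallelogram[OF u(1) continuous_on_mult_left[OF ua, of z]] z
        by (simp add: square_norm_scale square_norm_translate[OF u(1)])
      also have "\<dots> \<le> m * 4"
        using m u(2)[of n] by (intro mult_left_mono) simp_all
      finally show ?thesis by simp
    qed
    moreover have "(\<lambda>n. sqrt (square_norm (p n)) + sqrt (square_norm (q n)))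
        \<longlonglongrightarrow> sqrt (square_norm (\<lambda>x. 2 * h x + k x)) + sqrt (square_norm (\<lambda>x. 2 * h x - k x))"
      unfolding p_def q_def
      by (intro tendsto_add tendsto_real_sqrt square_norm_uniform_limit continuous_intros hn K
          uniform_limit_add uniform_limit_minus h2 K_lim)
    ultimately have le: "sqrt (square_norm (\<lambda>x. 2 * h x + k x)) + sqrt (square_norm (\<lambda>x. 2 * h x - k x)) \<le> 4 * m"
      by (intro LIMSEQ_le_const2) auto
    define P Q where "P = sqrt (square_norm (\<lambda>x. 2 * h x + k x))"
      and "Q = sqrt (square_norm (\<lambda>x. 2 * h x - k x))"
    have sum: "(\<lambda>x. (2 * h x + k x) + (2 * h x - k x)) = (\<lambda>x. 4 * h x)"
      by (simp add: fun_eq_iff)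
    have four: "sqrt (square_norm (\<lambda>x. 4 * h x)) = 4 * m"
      unfolding square_norm_scale m_def by (simp add: real_sqrt_mult)
    have eq: "complex_of_real Q * (2 * h x + k x) = complex_of_real P * (2 * h x - k x)" for x
      unfolding P_def Q_def using le
      by (intro Minkowski_equality continuous_intros h k) (simp only: sum four)
    have "P + Q > 0"
    proof (rule ccontr)
      assume "\<not> P + Q > 0"
      then have "P = 0" "Q = 0"
        using square_norm_nonneg by (simp_all add: P_def Q_def add_nonneg_eq_0_iff not_less order_antisym_conv)
      then have "2 * h x + k x = 0" "2 * h x - k x = 0" for x
        using square_norm_eq_zero[of "\<lambda>x. 2 * h x + k x" x] square_norm_eq_zero[of "\<lambda>x. 2 * h x - k x" x]
        by (simp_all add: P_def Q_def continuous_intros h k)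
      then have "(2 * h x + k x) + (2 * h x - k x) = 0" for x
        by (simp only: add_0)
      then have "h x = 0" for x
        by simp
      then show False
        using pos by (simp add: square_norm_def)
    qed
    then have "k x = complex_of_real (2 * (P - Q) / (P + Q)) * h x" for x
    proof -
      have "complex_of_real (P + Q) * k x = complex_of_real (2 * (P - Q)) * h x"
        using eq[of x] by (simp add: algebra_simps)
      moreover have "complex_of_real (P + Q) \<noteq> 0"
        using \<open>P + Q > 0\<close> by (metis of_real_eq_0_iff less_irrefl)
      ultimately show ?thesis
        by (simp only: of_real_divide) (simp add: field_simps)
    qed
    then show ?thesis
      unfolding k_def by blast
  qed
  obtain r where r: "\<And>x. h (x + a) + h (x - a) = complex_of_real r * h x"
    using multiple[of 1] by auto
  obtain s where s: "\<And>x. \<i> * h (x + a) - \<i> * h (x - a) = complex_of_real s * h x"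
    using multiple[of \<i>] by auto
  have "h (x + a) = (r - \<i> * s) / 2 * h x" for x
  proof -
    have "h (x + a) - h (x - a) = - \<i> * (\<i> * h (x + a) - \<i> * h (x - a))"
      by (simp add: algebra_simps)
    then have "h (x + a) - h (x - a) = - \<i> * (complex_of_real s * h x)"
      by (simp only: s)
    then have "(h (x + a) + h (x - a)) + (h (x + a) - h (x - a))
        = complex_of_real r * h x - \<i> * (complex_of_real s * h x)"
      by (simp only: r) simp
    then show ?thesis
      by (simp add: field_simps)
  qed
  then show ?thesis by blast
qed

text \<open>Translation preserves the norm, hence the eigenvalues are unimodular.\<close>

lemma translation_eigenfunction_character:
  assumes h: "continuous_on UNIV h" and pos: "square_norm h > 0"
    and eigen: "\<And>a. \<exists>c. \<forall>x. h (x + a) = c * h x"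
  shows "h 0 \<noteq> 0" "(\<lambda>x. h x / h 0) \<in> dual_group"
proof -
  obtain \<eta> where \<eta>: "\<And>a x. h (x + a) = \<eta> a * h x"
    using eigen by metis
  have at_zero: "h a = \<eta> a * h 0" for a
    using \<eta>[of 0 a] by simp
  show h0: "h 0 \<noteq> 0"
  proof
    assume "h 0 = 0"
    then have "h x = 0" for x
      using at_zero[of x] by simp
    then show False
      using pos by (simp add: square_norm_def)
  qed
  have eq: "(\<lambda>x. h x / h 0) = \<eta>"
  proof
    fix x
    show "h x / h 0 = \<eta> x"
      unfolding at_zero[of x] using h0 by (rule nonzero_mult_div_cancel_right)
  qed
  have "square_norm h = (cmod (\<eta> a))\<^sup>2 * square_norm h" for a
  proof -
    have "square_norm h = square_norm (\<lambda>x. h (x + a))"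
      by (rule square_norm_translate[OF h, symmetric])
    also have "(\<lambda>x. h (x + a)) = (\<lambda>x. \<eta> a * h x)"
      using \<eta> by blast
    finally show ?thesis
      unfolding square_norm_scale .
  qed
  then have "(cmod (\<eta> a))\<^sup>2 = 1" for a
    using pos mult_cancel_right[of 1 "square_norm h" "(cmod (\<eta> a))\<^sup>2"] by simp
  then have "cmod (\<eta> a) = 1" for a
    unfolding abs_square_eq_1 by simp
  moreover have "\<eta> (x + y) = \<eta> x * \<eta> y" for x y
    using \<eta>[of x y] at_zero[of "x + y"] at_zero[of x] h0 by (simp add: mult_ac)
  moreover have "continuous_on UNIV \<eta>"
    unfolding eq[symmetric] using h0 by (intro continuous_intros h) simp
  ultimately show "(\<lambda>x. h x / h 0) \<in> dual_group"
    unfolding eq dual_group_def by blast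
qed

lemma compact_Hausdorff_Urysohn:
  fixes A B :: "'g set"
  assumes "closed A" "closed B" "A \<inter> B = {}"
  shows "\<exists>f. continuous_on UNIV f \<and> (\<forall>x. 0 \<le> f x \<and> f x \<le> (1::real)) \<and> (\<forall>x\<in>A. f x = 0) \<and> (\<forall>x\<in>B. f x = 1)"
proof -
  have "Hausdorff_space (euclidean :: 'g topology)"
    unfolding Hausdorff_space_def disjnt_def using hausdorff by (metis open_openin)
  moreover have "compact_space (euclidean :: 'g topology)"
    using compact_UNIV by (simp add: compact_space_def)
  ultimately have "normal_space (euclidean :: 'g topology)"
    by (simp add: compact_Hausdorff_or_regular_imp_normal_space)
  then obtain f where f: "continuous_map (euclidean :: 'g topology) (top_of_set {0..1::real}) f"
    "f ` A \<subseteq> {0}" "f ` B \<subseteq> {1}"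
    by (rule Urysohn_lemma[of _ A B 0 1]) (use assms in \<open>auto simp: disjnt_def\<close>)
  then have "continuous_on UNIV f" "f ` UNIV \<subseteq> {0..1}"
    by (auto simp: continuous_map_in_subtopology)
  then show ?thesis
    using f(2,3) by (intro exI[of _ f]) (auto simp: image_subset_iff)
qed

text \<open>
  The kernel \<open>f - f(\<cdot> + a)\<close> is chosen such that all its correlations are orthogonal to the characters
  which take the value 1 at \<open>a\<close>. Since it does not vanish, it produces a character by the above,
  namely a multiple of a limit of correlations.
\<close>

theorem characters_separate_points:
  fixes a :: 'g
  assumes "a \<noteq> 0"
  shows "\<exists>c\<in>dual_group. c a \<noteq> 1"
proof -
  obtain f0 :: "'g \<Rightarrow> real" where f0: "continuous_on UNIV f0" "f0 a = 0" "f0 0 = 1"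
    using compact_Hausdorff_Urysohn[of "{a}" "{0}"] assms by auto
  define f where "f x = complex_of_real (f0 x)" for x
  have f: "continuous_on UNIV f"
    unfolding f_def by (intro continuous_intros f0)
  note fa = continuous_translate[OF f, of a]
  define \<phi> where "\<phi> x = f x - f (x + a)" for x
  have \<phi>: "continuous_on UNIV \<phi>"
    unfolding \<phi>_def by (intro continuous_intros f fa)
  have "\<phi> 0 \<noteq> 0"
    by (simp add: \<phi>_def f_def f0)
  then obtain u h where u: "\<And>n::nat. continuous_on UNIV (u n)" "\<And>n. square_norm (u n) \<le> 1"
    and lim: "uniform_limit UNIV (\<lambda>n. autocorrelation \<phi> (u n)) h sequentially"
    and pos: "square_norm h > 0"
    and extremal: "\<And>v. continuous_on UNIV v \<Longrightarrow>
      sqrt (square_norm (autocorrelation \<phi> v)) \<le> sqrt (square_norm h) * square_norm v"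
    using extremal_autocorrelation[OF \<phi>] by blast
  have h: "continuous_on UNIV h"
    using correlation_continuous[OF \<phi> u(1) u(1)]
    by (intro uniform_limit_theorem[OF _ lim]) simp_all
  define c where "c = (\<lambda>x. h x / h 0)"
  have c: "c \<in> dual_group" and h0: "h 0 \<noteq> 0"
    using translation_eigenfunction_character[OF h pos extremal_eigenfunction[OF \<phi> u lim pos extremal]]
    unfolding c_def by blast+
  have cont_c: "continuous_on UNIV c" and norm_c: "cmod (c x) = 1" and mult_c: "c (x + y) = c x * c y" for x y
    using c unfolding dual_group_def by blast+
  have "c a \<noteq> 1"
  proof
    assume ca: "c a = 1"
    have "(\<integral>x. autocorrelation \<phi> (u n) x * cnj (c x) \<partial>\<mu>) = 0" for n
    proof -
      let ?g = "\<lambda>x. autocorrelation f (u n) x * cnj (c x)"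
      have g: "continuous_on UNIV ?g"
        by (intro continuous_intros cont_c correlation_continuous f u(1))
      have "autocorrelation \<phi> (u n) x * cnj (c x) = ?g x - ?g (x + a)" for x
        unfolding \<phi>_def correlation_diff_kernel[OF f fa u(1) u(1)] correlation_shift[symmetric] mult_c ca
        by (simp add: algebra_simps)
      then show ?thesis
        by (simp add: Bochner_Integration.integral_diff continuous_integrable g continuous_translate[OF g]
            continuous_integral_translation[OF g])
    qed
    moreover have "(\<lambda>n. \<integral>x. autocorrelation \<phi> (u n) x * cnj (c x) \<partial>\<mu>) \<longlonglongrightarrow> (\<integral>x. h x * cnj (c x) \<partial>\<mu>)"
      by (intro integral_uniform_limit continuous_intros cont_c correlation_continuous \<phi> u(1)
          bounded_bilinear.bounded_uniform_limit[OF bounded_bilinear_mult] lim uniform_limit_const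
          continuous_bounded h)
    ultimately have "(\<integral>x. h x * cnj (c x) \<partial>\<mu>) = 0"
      by (simp add: LIMSEQ_const_iff)
    moreover have "h x * cnj (c x) = h 0" for x
    proof -
      have "c x * cnj (c x) = 1"
        using complex_norm_square[of "c x"] norm_c[of x] by simp
      moreover have "h x = h 0 * c x"
        using h0 by (simp add: c_def)
      ultimately show ?thesis
        by (simp add: mult.assoc)
    qed
    ultimately show False
      using h0 by simp
  qed
  then show ?thesis
    using c by blast
qed

end

section \<open>Parseval's identity for vector-valued functions\<close>

context compact_group_haar_measure
begin

lemma dual_group_continuous: "k \<in> dual_group \<Longrightarrow> continuous_on UNIV (k :: 'g \<Rightarrow> complex)"
  by (simp add: dual_group_def)

lemma dual_group_mult: "k \<in> dual_group \<Longrightarrow> k (x + y) = k x * k (y :: 'g)"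
  by (simp add: dual_group_def)

lemma dual_group_norm: "k \<in> dual_group \<Longrightarrow> cmod (k (x :: 'g)) = 1"
  by (simp add: dual_group_def)

lemma dual_group_times_cnj: "k \<in> dual_group \<Longrightarrow> k (x :: 'g) * cnj (k x) = 1"
  using complex_norm_square[of "k x"] by (simp add: dual_group_norm)

lemma dual_group_product:
  assumes "k \<in> dual_group" "l \<in> dual_group"
  shows "(\<lambda>x :: 'g. k x * l x) \<in> dual_group"
proof -
  have "continuous_on UNIV (\<lambda>x :: 'g. k x * l x)"
    by (intro continuous_on_mult dual_group_continuous assms)
  then show ?thesis
    unfolding dual_group_def using assms
    by (simp add: dual_group_mult dual_group_norm norm_mult mult_ac)
qed

lemma dual_group_cnj:
  assumes "k \<in> dual_group"
  shows "(\<lambda>x :: 'g. cnj (k x)) \<in> dual_group"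
proof -
  have "continuous_on UNIV (\<lambda>x :: 'g. cnj (k x))"
    by (intro continuous_on_cnj dual_group_continuous assms)
  then show ?thesis
    unfolding dual_group_def using assms by (simp add: dual_group_mult dual_group_norm)
qed

lemma dual_group_one: "(\<lambda>x :: 'g. 1) \<in> dual_group"
  by (simp add: dual_group_def)

text \<open>
  A character other than 1 has mean 0, as a translation multiplies its mean by a factor other than 1.
\<close>

lemma characters_orthonormal:
  assumes k: "k \<in> dual_group" and l: "l \<in> dual_group"
  shows "(\<integral>x. k x * cnj (l x) \<partial>\<mu>) = (if k = l then 1 else 0)"
proof (cases "k = l")
  case True
  then show ?thesis
    using l by (simp add: dual_group_times_cnj)
next
  case False
  then obtain a where a: "k a \<noteq> l a"
    by blast
  define m where "m x = k x * cnj (l x)" for x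
  have m: "m \<in> dual_group"
    unfolding m_def by (intro dual_group_product dual_group_cnj k l)
  have "k a = m a * l a"
    using dual_group_times_cnj[OF l, of a] by (simp add: m_def mult_ac)
  then have "m a \<noteq> 1"
    using a by auto
  moreover have "(\<integral>x. m x \<partial>\<mu>) = (\<integral>x. m (x + a) \<partial>\<mu>)"
    by (rule continuous_integral_translation[OF dual_group_continuous[OF m], symmetric])
  then have "(\<integral>x. m x \<partial>\<mu>) = (\<integral>x. m x \<partial>\<mu>) * m a"
    by (simp add: dual_group_mult[OF m])
  ultimately have "(\<integral>x. m x \<partial>\<mu>) = 0"
    by simp
  then show ?thesis
    using False by (simp add: m_def)
qed

inductive_set trigonometric_polynomials :: "('g \<Rightarrow> complex) set" where
  monomial: "k \<in> dual_group \<Longrightarrow> (\<lambda>x. c * k x) \<in> trigonometric_polynomials"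
| add: "p \<in> trigonometric_polynomials \<Longrightarrow> q \<in> trigonometric_polynomials \<Longrightarrow>
    (\<lambda>x. p x + q x) \<in> trigonometric_polynomials"

lemma trigonometric_polynomial_continuous:
  "p \<in> trigonometric_polynomials \<Longrightarrow> continuous_on UNIV p"
  by (induction rule: trigonometric_polynomials.induct)
     (simp_all add: continuous_on_add continuous_on_mult_left dual_group_continuous)

lemma trigonometric_polynomial_const: "(\<lambda>x. c) \<in> trigonometric_polynomials"
  using monomial[OF dual_group_one, of c] by simp

lemma trigonometric_polynomial_mult:
  assumes "p \<in> trigonometric_polynomials" "q \<in> trigonometric_polynomials"
  shows "(\<lambda>x. p x * q x) \<in> trigonometric_polynomials"
  using assms(1)
proof (induction rule: trigonometric_polynomials.induct)
  case (monomial k c)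
  note k = monomial
  show ?case
    using assms(2)
  proof (induction rule: trigonometric_polynomials.induct)
    case (monomial l d)
    then show ?case
      using trigonometric_polynomials.monomial[OF dual_group_product[OF k monomial], of "c * d"]
      by (simp add: mult_ac)
  next
    case (add p q)
    then show ?case
      using trigonometric_polynomials.add[OF add.IH] by (simp add: distrib_left)
  qed
next
  case (add p q)
  then show ?case
    using trigonometric_polynomials.add[OF add.IH] by (simp add: distrib_right)
qed

text \<open>
  The theorem of Stone and Weierstrass applies to the real-valued trigonometric polynomials, which include the
  real and imaginary parts of characters.
\<close>

lemma trigonometric_polynomials_uniformly_dense:
  fixes f :: "'g \<Rightarrow> real"
  assumes f: "continuous_on UNIV f" and "e > 0"
  shows "\<exists>p\<in>trigonometric_polynomials. \<forall>x. cmod (complex_of_real (f x) - p x) < e"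
proof -
  define R where "R = {r :: 'g \<Rightarrow> real. (\<lambda>x. complex_of_real (r x)) \<in> trigonometric_polynomials}"
  interpret function_ring_on R UNIV
  proof
    show "compact (UNIV :: 'g set)"
      by (rule compact_UNIV)
    show "continuous_on UNIV r" if "r \<in> R" for r
    proof -
      have "continuous_on UNIV (\<lambda>x. Re (complex_of_real (r x)))"
        using that unfolding R_def by (intro continuous_on_Re trigonometric_polynomial_continuous) simp
      then show ?thesis by simp
    qed
    show "(\<lambda>x. r x + s x) \<in> R" "(\<lambda>x. r x * s x) \<in> R" if "r \<in> R" "s \<in> R" for r s
      using that trigonometric_polynomials.add trigonometric_polynomial_mult by (simp_all add: R_def)
    show "(\<lambda>_. c) \<in> R" for c
      by (simp add: R_def trigonometric_polynomial_const)
    fix x y :: 'g assume "x \<noteq> y"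
    then obtain c where c: "c \<in> dual_group" "c (x - y) \<noteq> 1"
      using characters_separate_points[of "x - y"] by auto
    have "c x = c (x - y) * c y"
      using dual_group_mult[OF c(1), of "x - y" y] by simp
    moreover have "c y \<noteq> 0"
      using dual_group_norm[OF c(1), of y] by auto
    ultimately have ne: "c x \<noteq> c y"
      using c(2) by simp
    have Re: "(\<lambda>x. Re (c x)) \<in> R"
    proof -
      have "complex_of_real (Re z) = 1/2 * z + 1/2 * cnj z" for z
        by (simp add: complex_eq_iff)
      then show ?thesis
        unfolding R_def using trigonometric_polynomials.add[OF monomial[OF c(1), of "1/2"]
            monomial[OF dual_group_cnj[OF c(1)], of "1/2"]] by simp
    qed
    have Im: "(\<lambda>x. Im (c x)) \<in> R"
    proof -
      have "complex_of_real (Im z) = (- \<i>/2) * z + (\<i>/2) * cnj z" for z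
        by (simp add: complex_eq_iff)
      then show ?thesis
        unfolding R_def using trigonometric_polynomials.add[OF monomial[OF c(1), of "- \<i>/2"]
            monomial[OF dual_group_cnj[OF c(1)], of "\<i>/2"]] by simp
    qed
    show "\<exists>f\<in>R. f x \<noteq> f y"
    proof (cases "Re (c x) = Re (c y)")
      case True
      then have "Im (c x) \<noteq> Im (c y)"
        using ne by (simp add: complex_eq_iff)
      then show ?thesis
        by (rule bexI[OF _ Im])
    next
      case False
      then show ?thesis
        by (rule bexI[OF _ Re])
    qed
  qed
  obtain g where g: "g \<in> R" "\<And>x. \<bar>f x - g x\<bar> < e"
    using Stone_Weierstrass_basic[OF f \<open>e > 0\<close>] by blast
  have "cmod (complex_of_real (f x) - complex_of_real (g x)) < e" for x
    using g(2)[of x] by (simp flip: of_real_diff)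
  then show ?thesis
    using g(1) unfolding R_def by (intro bexI[of _ "\<lambda>x. complex_of_real (g x)"]) auto
qed

lemma norm_add_square_le: "(norm (a + b))\<^sup>2 \<le> 2 * (norm a)\<^sup>2 + 2 * (norm (b :: 'h::real_normed_vector))\<^sup>2"
proof -
  have "(norm (a + b))\<^sup>2 \<le> (norm a + norm b)\<^sup>2"
    by (intro power_mono norm_triangle_ineq) simp
  moreover have "0 \<le> (norm a - norm b)\<^sup>2" by simp
  ultimately show ?thesis
    by (simp add: power2_sum power2_diff)
qed

text \<open>
  Outer regularity, applied to a Borel set and to its complement, yields open sets \<open>U\<close> and \<open>U'\<close> with small
  intersection, outside of which a continuous function agrees with the indicator function.
\<close>

lemma indicator_approximation:
  assumes E: "E \<in> sets borel" and "e > 0"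
  shows "\<exists>p\<in>trigonometric_polynomials. (\<integral>x. (cmod (complex_of_real (indicator E x) - p x))\<^sup>2 \<partial>\<mu>) < e"
proof -
  have outer: "\<exists>U. open U \<and> F \<subseteq> U \<and> measure \<mu> U < measure \<mu> F + d"
    if F: "F \<in> sets borel" and d: "d > 0" for F d
  proof -
    have "emeasure \<mu> F < ennreal (measure \<mu> F + d)"
      unfolding emeasure_eq_measure using d by (intro ennreal_lessI) (simp_all add: add_nonneg_pos)
    then obtain U where U: "open U" "F \<subseteq> U" "emeasure \<mu> U < ennreal (measure \<mu> F + d)"
      unfolding outer_regular[OF F] INF_less_iff by blast
    then have "measure \<mu> U < measure \<mu> F + d"
      unfolding emeasure_eq_measure by (simp only: ennreal_less_iff[OF measure_nonneg])
    then show ?thesis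
      using U by blast
  qed
  obtain U where U: "open U" "E \<subseteq> U" "measure \<mu> U < measure \<mu> E + e / 8"
    using outer[OF E, of "e / 8"] \<open>e > 0\<close> by auto
  obtain U' where U': "open U'" "- E \<subseteq> U'" "measure \<mu> U' < measure \<mu> (- E) + e / 8"
    using outer[of "- E" "e / 8"] E \<open>e > 0\<close> by auto
  have sets: "U \<in> sets \<mu>" "U' \<in> sets \<mu>" "E \<in> sets \<mu>"
    using U(1) U'(1) E by (simp_all add: sets_eq)
  have "measure \<mu> (- E) = 1 - measure \<mu> E"
    using finite_measure_compl[OF sets(3)] by (simp add: Compl_eq_Diff_UNIV)
  moreover have "measure \<mu> U + measure \<mu> U' = measure \<mu> (U \<union> U') + measure \<mu> (U \<inter> U')"
    using measure_Un3[of U \<mu> U'] sets by (simp add: fmeasurable_eq_sets)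
  moreover have "U \<union> U' = UNIV"
    using U(2) U'(2) by blast
  ultimately have small: "measure \<mu> (U \<inter> U') < e / 4"
    using U(3) U'(3) by simp
  have "closed (- U)" "closed (- U')" "- U \<inter> - U' = {}"
    using U U' by (auto simp: closed_Compl)
  then obtain f where f: "continuous_on UNIV f" "\<And>x. 0 \<le> f x \<and> f x \<le> (1::real)"
    "\<And>x. x \<in> - U \<Longrightarrow> f x = 0" "\<And>x. x \<in> - U' \<Longrightarrow> f x = 1"
    using compact_Hausdorff_Urysohn[of "- U" "- U'"] by blast
  define d where "d = min 1 (e / 8)"
  have d: "d > 0" "d \<le> 1" "d \<le> e / 8"
    using \<open>e > 0\<close> by (simp_all add: d_def)
  obtain p where p: "p \<in> trigonometric_polynomials" "\<And>x. cmod (complex_of_real (f x) - p x) < d"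
    using trigonometric_polynomials_uniformly_dense[OF f(1) d(1)] by blast
  have pm: "p \<in> borel_measurable \<mu>"
    by (intro borel_measurable_haar borel_measurable_continuous_onI trigonometric_polynomial_continuous p)
  have pointwise: "(cmod (complex_of_real (indicator E x) - p x))\<^sup>2 \<le> 2 * indicator (U \<inter> U') x + 2 * d" for x
  proof -
    have "\<bar>indicator E x - f x\<bar> \<le> indicator (U \<inter> U') x"
      using f(2)[of x] f(3)[of x] f(4)[of x] U(2) U'(2) by (auto simp: indicator_def)
    then have "(cmod (complex_of_real (indicator E x - f x)))\<^sup>2 \<le> (indicator (U \<inter> U') x)\<^sup>2"
      unfolding norm_of_real by (rule power_mono) simp
    also have "\<dots> = indicator (U \<inter> U') x"
      by (simp add: indicator_def power2_eq_square)
    finally have 1: "(cmod (complex_of_real (indicator E x - f x)))\<^sup>2 \<le> indicator (U \<inter> U') x" .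
    have "(cmod (complex_of_real (f x) - p x))\<^sup>2 \<le> d\<^sup>2"
      using p(2)[of x] by (intro power_mono) simp_all
    also have "\<dots> \<le> d"
      using d by (simp add: power2_eq_square mult_left_le)
    finally have 2: "(cmod (complex_of_real (f x) - p x))\<^sup>2 \<le> d" .
    have "complex_of_real (indicator E x) - p x
        = complex_of_real (indicator E x - f x) + (complex_of_real (f x) - p x)"
      by simp
    then show ?thesis
      using norm_add_square_le[of "complex_of_real (indicator E x - f x)" "complex_of_real (f x) - p x"] 1 2
      by (simp only:)
  qed
  have int: "integrable \<mu> (\<lambda>x. 2 * indicator (U \<inter> U') x + 2 * d :: real)"
    using sets by (intro integrable_const_bound[of _ "2 + 2 * d"] AE_I2) (auto simp: indicator_def d(1) less_imp_le)
  have ind: "(\<lambda>x. complex_of_real (indicator E x)) \<in> borel_measurable \<mu>"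
    by (rule measurable_compose[OF borel_measurable_indicator[OF sets(3)]]) simp
  have "integrable \<mu> (\<lambda>x. (cmod (complex_of_real (indicator E x) - p x))\<^sup>2)"
    using ind pm by (intro Bochner_Integration.integrable_bound[OF int] AE_I2)
      (auto intro: order_trans[OF pointwise abs_ge_self])
  then have "(\<integral>x. (cmod (complex_of_real (indicator E x) - p x))\<^sup>2 \<partial>\<mu>)
      \<le> (\<integral>x. 2 * indicator (U \<inter> U') x + 2 * d \<partial>\<mu>)"
    by (intro integral_mono int pointwise)
  also have "\<dots> = 2 * measure \<mu> (U \<inter> U') + 2 * d"
  proof -
    have "integrable \<mu> (indicator (U \<inter> U') :: 'g \<Rightarrow> real)"
      using sets by (intro integrable_real_indicator) (auto simp: emeasure_eq_measure)
    then show ?thesis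
      using sets by simp
  qed
  also have "\<dots> < e"
    using small d(3) \<open>e > 0\<close> by simp
  finally show ?thesis
    using p(1) by blast
qed

definition square_integrable :: "('g \<Rightarrow> 'h::separable_chilbert_space) \<Rightarrow> bool" where
  "square_integrable f \<longleftrightarrow> f \<in> borel_measurable \<mu> \<and> integrable \<mu> (\<lambda>x. (norm (f x))\<^sup>2)"

lemma square_integrable_add:
  assumes "square_integrable f" "square_integrable g"
  shows "square_integrable (\<lambda>x. f x + g x)"
proof -
  have "integrable \<mu> (\<lambda>x. 2 * (norm (f x))\<^sup>2 + 2 * (norm (g x))\<^sup>2)"
    using assms by (simp add: square_integrable_def)
  then have "integrable \<mu> (\<lambda>x. (norm (f x + g x))\<^sup>2)"
    by (rule Bochner_Integration.integrable_bound)
       (use assms norm_add_square_le in \<open>auto simp: square_integrable_def\<close>)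
  moreover have "(\<lambda>x. f x + g x) \<in> borel_measurable \<mu>"
    using assms unfolding square_integrable_def by (intro borel_measurable_add) blast+
  ultimately show ?thesis
    by (simp add: square_integrable_def)
qed

lemma square_integrable_minus: "square_integrable f \<Longrightarrow> square_integrable (\<lambda>x. - f x)"
  by (simp add: square_integrable_def)

lemma square_integrable_diff:
  assumes "square_integrable f" "square_integrable g"
  shows "square_integrable (\<lambda>x. f x - g x)"
  using square_integrable_add[OF assms(1) square_integrable_minus[OF assms(2)]] by simp

lemma square_integrable_bounded:
  assumes "f \<in> borel_measurable \<mu>" "\<And>x. norm (f x) \<le> B"
  shows "square_integrable f"
proof -
  have "integrable \<mu> (\<lambda>x. (norm (f x))\<^sup>2)"
    using assms by (intro integrable_const_bound[of _ "B\<^sup>2"] AE_I2) (auto intro: power_mono)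
  then show ?thesis
    using assms(1) by (simp add: square_integrable_def)
qed

lemma square_integrable_continuous:
  assumes "continuous_on UNIV f"
  shows "square_integrable f"
proof -
  obtain B where "\<And>x. norm (f x) \<le> B"
    using continuous_bounded[OF assms] by (auto simp: bounded_iff)
  then show ?thesis
    by (intro square_integrable_bounded borel_measurable_haar borel_measurable_continuous_onI assms)
qed

lemma square_integrable_integrable:
  assumes "square_integrable f"
  shows "integrable \<mu> f"
proof -
  have "integrable \<mu> (\<lambda>x. 1 + (norm (f x))\<^sup>2)"
    using assms by (simp add: square_integrable_def)
  then show ?thesis
  proof (rule Bochner_Integration.integrable_bound)
    show "f \<in> borel_measurable \<mu>"
      using assms by (simp add: square_integrable_def)
    have "norm (f x) \<le> 1 + (norm (f x))\<^sup>2" for x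
    proof -
      have "0 \<le> (norm (f x))\<^sup>2 - 2 * norm (f x) + 1"
        using zero_le_power2[of "norm (f x) - 1"] by (simp add: power2_diff)
      then show ?thesis
        using norm_ge_zero[of "f x"] by linarith
    qed
    then show "AE x in \<mu>. norm (f x) \<le> norm (1 + (norm (f x))\<^sup>2)"
      by (intro AE_I2) simp
  qed
qed

definition fourier_sum :: "('g \<Rightarrow> complex) set \<Rightarrow> (('g \<Rightarrow> complex) \<Rightarrow> 'h) \<Rightarrow> 'g \<Rightarrow> 'h::separable_chilbert_space" where
  "fourier_sum \<Delta> c x = (\<Sum>k\<in>\<Delta>. k x *\<^sub>C c k)"

lemma fourier_sum_continuous:
  assumes "\<Delta> \<subseteq> dual_group"
  shows "continuous_on UNIV (fourier_sum \<Delta> c)"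
  unfolding fourier_sum_def[abs_def] using assms dual_group_continuous
  by (intro continuous_on_sum scaleC.continuous_on continuous_on_const) blast

lemma fourier_sum_superset:
  "finite \<Delta>' \<Longrightarrow> \<Delta> \<subseteq> \<Delta>' \<Longrightarrow> fourier_sum \<Delta> c x = fourier_sum \<Delta>' (\<lambda>k. if k \<in> \<Delta> then c k else 0) x"
  unfolding fourier_sum_def by (intro sum.mono_neutral_cong_left) (auto simp: scaleC.zero_right)

lemma fourier_sum_add:
  assumes "finite \<Delta>" "finite \<Gamma>"
  shows "\<exists>e. \<forall>x. fourier_sum \<Delta> c x + fourier_sum \<Gamma> d x = fourier_sum (\<Delta> \<union> \<Gamma>) e x"
proof (intro exI allI)
  fix x
  show "fourier_sum \<Delta> c x + fourier_sum \<Gamma> d x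
      = fourier_sum (\<Delta> \<union> \<Gamma>) (\<lambda>k. (if k \<in> \<Delta> then c k else 0) + (if k \<in> \<Gamma> then d k else 0)) x"
    unfolding fourier_sum_superset[of "\<Delta> \<union> \<Gamma>" \<Delta>, OF finite_UnI[OF assms] Un_upper1]
      fourier_sum_superset[of "\<Delta> \<union> \<Gamma>" \<Gamma>, OF finite_UnI[OF assms] Un_upper2]
    by (simp only: fourier_sum_def scaleC_add_right sum.distrib)
qed

lemma trigonometric_polynomial_times_vector:
  assumes "p \<in> trigonometric_polynomials"
  shows "\<exists>\<Delta> c. finite \<Delta> \<and> \<Delta> \<subseteq> dual_group \<and> (\<forall>x. p x *\<^sub>C v = fourier_sum \<Delta> c x)"
  using assms
proof (induction rule: trigonometric_polynomials.induct)
  case (monomial k c)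
  then show ?case
    by (intro exI[of _ "{k}"] exI[of _ "\<lambda>_. c *\<^sub>C v"])
       (simp add: fourier_sum_def scaleC_scaleC mult.commute)
next
  case (add p q)
  then obtain \<Delta> c \<Gamma> d where "finite \<Delta>" "\<Delta> \<subseteq> dual_group" "\<And>x. p x *\<^sub>C v = fourier_sum \<Delta> c x"
    "finite \<Gamma>" "\<Gamma> \<subseteq> dual_group" "\<And>x. q x *\<^sub>C v = fourier_sum \<Gamma> d x"
    by blast
  moreover obtain e where "\<And>x. fourier_sum \<Delta> c x + fourier_sum \<Gamma> d x = fourier_sum (\<Delta> \<union> \<Gamma>) e x"
    using fourier_sum_add[OF \<open>finite \<Delta>\<close> \<open>finite \<Gamma>\<close>] by blast
  ultimately show ?case
    by (intro exI[of _ "\<Delta> \<union> \<Gamma>"] exI[of _ e]) (simp add: scaleC_add_left)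
qed

definition fourier_approximable :: "('g \<Rightarrow> 'h::separable_chilbert_space) \<Rightarrow> bool" where
  "fourier_approximable f \<longleftrightarrow> square_integrable f \<and>
     (\<forall>e>0. \<exists>\<Delta> c. finite \<Delta> \<and> \<Delta> \<subseteq> dual_group \<and> (\<integral>x. (norm (f x - fourier_sum \<Delta> c x))\<^sup>2 \<partial>\<mu>) < e)"

lemma integral_norm_square_add_le:
  assumes "square_integrable f" "square_integrable g"
  shows "(\<integral>x. (norm (f x + g x))\<^sup>2 \<partial>\<mu>)
    \<le> 2 * (\<integral>x. (norm (f x))\<^sup>2 \<partial>\<mu>) + 2 * (\<integral>x. (norm (g x))\<^sup>2 \<partial>\<mu>)"
proof -
  have "(\<integral>x. (norm (f x + g x))\<^sup>2 \<partial>\<mu>) \<le> (\<integral>x. 2 * (norm (f x))\<^sup>2 + 2 * (norm (g x))\<^sup>2 \<partial>\<mu>)"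
    using assms square_integrable_add[OF assms]
    by (intro integral_mono norm_add_square_le) (simp_all add: square_integrable_def)
  then show ?thesis
    using assms by (simp add: square_integrable_def)
qed

lemma fourier_approximable_near:
  assumes f: "square_integrable f"
    and near: "\<And>e. e > 0 \<Longrightarrow> \<exists>g. fourier_approximable g \<and> (\<integral>x. (norm (f x - g x))\<^sup>2 \<partial>\<mu>) < e"
  shows "fourier_approximable f"
  unfolding fourier_approximable_def
proof (intro conjI allI impI f)
  fix e :: real assume e: "e > 0"
  obtain g where g: "fourier_approximable g" "(\<integral>x. (norm (f x - g x))\<^sup>2 \<partial>\<mu>) < e / 4"
    using near[of "e / 4"] e by auto
  obtain \<Delta> c where \<Delta>: "finite \<Delta>" "\<Delta> \<subseteq> dual_group"
    and c: "(\<integral>x. (norm (g x - fourier_sum \<Delta> c x))\<^sup>2 \<partial>\<mu>) < e / 4"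
    using g(1) e unfolding fourier_approximable_def by (metis zero_less_divide_iff zero_less_numeral)
  have gs: "square_integrable g"
    using g(1) by (simp add: fourier_approximable_def)
  note ps = square_integrable_continuous[OF fourier_sum_continuous[OF \<Delta>(2), of c]]
  have "(\<integral>x. (norm (f x - fourier_sum \<Delta> c x))\<^sup>2 \<partial>\<mu>)
      = (\<integral>x. (norm ((f x - g x) + (g x - fourier_sum \<Delta> c x)))\<^sup>2 \<partial>\<mu>)"
    by simp
  also have "\<dots> \<le> 2 * (\<integral>x. (norm (f x - g x))\<^sup>2 \<partial>\<mu>) + 2 * (\<integral>x. (norm (g x - fourier_sum \<Delta> c x))\<^sup>2 \<partial>\<mu>)"
    by (intro integral_norm_square_add_le square_integrable_diff f gs ps)
  also have "\<dots> < e"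
    using g(2) c by simp
  finally show "\<exists>\<Delta> c. finite \<Delta> \<and> \<Delta> \<subseteq> dual_group \<and> (\<integral>x. (norm (f x - fourier_sum \<Delta> c x))\<^sup>2 \<partial>\<mu>) < e"
    using \<Delta> by blast
qed

lemma fourier_approximable_add:
  assumes "fourier_approximable f" "fourier_approximable g"
  shows "fourier_approximable (\<lambda>x. f x + g x)"
  unfolding fourier_approximable_def
proof (intro conjI allI impI)
  have s: "square_integrable f" "square_integrable g"
    using assms by (simp_all add: fourier_approximable_def)
  then show "square_integrable (\<lambda>x. f x + g x)"
    by (rule square_integrable_add)
  fix e :: real assume "e > 0"
  then have e: "e / 4 > 0" by simp
  obtain \<Delta> c where \<Delta>: "finite \<Delta>" "\<Delta> \<subseteq> dual_group"
    and c: "(\<integral>x. (norm (f x - fourier_sum \<Delta> c x))\<^sup>2 \<partial>\<mu>) < e / 4"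
    using assms(1) e unfolding fourier_approximable_def by blast
  obtain \<Gamma> d where \<Gamma>: "finite \<Gamma>" "\<Gamma> \<subseteq> dual_group"
    and d: "(\<integral>x. (norm (g x - fourier_sum \<Gamma> d x))\<^sup>2 \<partial>\<mu>) < e / 4"
    using assms(2) e unfolding fourier_approximable_def by blast
  obtain b where b: "\<And>x. fourier_sum \<Delta> c x + fourier_sum \<Gamma> d x = fourier_sum (\<Delta> \<union> \<Gamma>) b x"
    using fourier_sum_add[OF \<Delta>(1) \<Gamma>(1)] by blast
  note ps = square_integrable_continuous[OF fourier_sum_continuous[OF \<Delta>(2), of c]]
    square_integrable_continuous[OF fourier_sum_continuous[OF \<Gamma>(2), of d]]
  have "(\<integral>x. (norm (f x + g x - fourier_sum (\<Delta> \<union> \<Gamma>) b x))\<^sup>2 \<partial>\<mu>)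
      = (\<integral>x. (norm ((f x - fourier_sum \<Delta> c x) + (g x - fourier_sum \<Gamma> d x)))\<^sup>2 \<partial>\<mu>)"
    unfolding b[symmetric] by (simp add: algebra_simps)
  also have "\<dots> \<le> 2 * (\<integral>x. (norm (f x - fourier_sum \<Delta> c x))\<^sup>2 \<partial>\<mu>)
      + 2 * (\<integral>x. (norm (g x - fourier_sum \<Gamma> d x))\<^sup>2 \<partial>\<mu>)"
    by (intro integral_norm_square_add_le square_integrable_diff s ps)
  also have "\<dots> < e"
    using c d by simp
  finally show "\<exists>\<Delta> c. finite \<Delta> \<and> \<Delta> \<subseteq> dual_group
      \<and> (\<integral>x. (norm (f x + g x - fourier_sum \<Delta> c x))\<^sup>2 \<partial>\<mu>) < e"
    using \<Delta> \<Gamma> by (intro exI[of _ "\<Delta> \<union> \<Gamma>"] exI[of _ b]) simp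
qed

lemma fourier_approximable_indicator:
  assumes E: "E \<in> sets borel"
  shows "fourier_approximable (\<lambda>x. indicator E x *\<^sub>R (v :: 'h::separable_chilbert_space))"
  unfolding fourier_approximable_def
proof (intro conjI allI impI)
  have "E \<in> sets \<mu>"
    using E by (simp add: sets_eq)
  then show "square_integrable (\<lambda>x. indicator E x *\<^sub>R v)"
    by (intro square_integrable_bounded[of _ "norm v"] borel_measurable_scaleR borel_measurable_indicator)
       (auto simp: indicator_def)
  fix e :: real assume e: "e > 0"
  define q where "q = (norm v)\<^sup>2 + 1"
  have q: "q > 0" by (simp add: q_def add_nonneg_pos)
  obtain p where p: "p \<in> trigonometric_polynomials"
    and small: "(\<integral>x. (cmod (complex_of_real (indicator E x) - p x))\<^sup>2 \<partial>\<mu>) < e / q"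
    using indicator_approximation[OF E, of "e / q"] e q by auto
  obtain \<Delta> c where \<Delta>: "finite \<Delta>" "\<Delta> \<subseteq> dual_group" and c: "\<And>x. p x *\<^sub>C v = fourier_sum \<Delta> c x"
    using trigonometric_polynomial_times_vector[OF p, of v] by blast
  have "(norm (indicator E x *\<^sub>R v - fourier_sum \<Delta> c x))\<^sup>2
      = (cmod (complex_of_real (indicator E x) - p x))\<^sup>2 * (norm v)\<^sup>2" for x
    unfolding c[symmetric] scaleR_scaleC scaleC.diff_left[symmetric] norm_scaleC power_mult_distrib ..
  then have "(\<integral>x. (norm (indicator E x *\<^sub>R v - fourier_sum \<Delta> c x))\<^sup>2 \<partial>\<mu>)
      = (\<integral>x. (cmod (complex_of_real (indicator E x) - p x))\<^sup>2 \<partial>\<mu>) * (norm v)\<^sup>2"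
    by simp
  also have "\<dots> \<le> e / q * (norm v)\<^sup>2"
    using small by (intro mult_right_mono) simp_all
  also have "\<dots> < e"
    using e q by (simp add: q_def field_simps)
  finally show "\<exists>\<Delta> c. finite \<Delta> \<and> \<Delta> \<subseteq> dual_group
      \<and> (\<integral>x. (norm (indicator E x *\<^sub>R v - fourier_sum \<Delta> c x))\<^sup>2 \<partial>\<mu>) < e"
    using \<Delta> by blast
qed

lemma fourier_approximable_simple:
  fixes s :: "'g \<Rightarrow> 'h::separable_chilbert_space"
  assumes s: "simple_function \<mu> s"
  shows "fourier_approximable s"
proof -
  have fin: "finite (range s)"
    using simple_functionD(1)[OF s] by simp
  have "fourier_approximable (\<lambda>x. \<Sum>y\<in>Y. indicator (s -` {y}) x *\<^sub>R y)" if "finite Y" for Y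
    using that
  proof (induction Y)
    case empty
    then show ?case
      using fourier_approximable_indicator[of "{}" "0 :: 'h"] by simp
  next
    case (insert y Y)
    have "s -` {y} \<in> sets borel"
      using simple_functionD(2)[OF s, of "{y}"] by (simp add: sets_eq)
    then show ?case
      unfolding sum.insert[OF insert.hyps]
      by (intro fourier_approximable_add fourier_approximable_indicator insert.IH)
  qed
  from this[OF fin] have "fourier_approximable (\<lambda>x. \<Sum>y\<in>range s. indicator (s -` {y}) x *\<^sub>R y)" .
  moreover have "(\<Sum>y\<in>range s. indicator (s -` {y}) x *\<^sub>R y) = s x" for x
  proof -
    have "(\<Sum>y\<in>range s. indicator (s -` {y}) x *\<^sub>R y) = (\<Sum>y\<in>{s x}. indicator (s -` {y}) x *\<^sub>R y)"
      using fin by (intro sum.mono_neutral_right) (auto simp: indicator_def)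
    then show ?thesis by simp
  qed
  ultimately show ?thesis by simp
qed

theorem square_integrable_fourier_approximable:
  fixes f :: "'g \<Rightarrow> 'h::separable_chilbert_space"
  assumes f: "square_integrable f"
  shows "fourier_approximable f"
proof (rule fourier_approximable_near[OF f])
  have meas: "f \<in> borel_measurable \<mu>" and int: "integrable \<mu> (\<lambda>x. (norm (f x))\<^sup>2)"
    using f by (simp_all add: square_integrable_def)
  obtain F where F: "\<And>i. simple_function \<mu> (F i)" "\<And>x. (\<lambda>i. F i x) \<longlonglongrightarrow> f x"
    "\<And>i x. norm (F i x) \<le> 2 * norm (f x)"
    using borel_measurable_implies_sequence_metric[OF meas, of 0] by auto
  have "(\<lambda>i. \<integral>x. (norm (f x - F i x))\<^sup>2 \<partial>\<mu>) \<longlonglongrightarrow> (\<integral>x. 0 \<partial>\<mu>)"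
  proof (rule integral_dominated_convergence[where w = "\<lambda>x. 9 * (norm (f x))\<^sup>2"])
    show "AE x in \<mu>. norm ((norm (f x - F i x))\<^sup>2) \<le> 9 * (norm (f x))\<^sup>2" for i
    proof (rule AE_I2)
      fix x
      have "norm (f x - F i x) \<le> 3 * norm (f x)"
        using norm_triangle_ineq4[of "f x" "F i x"] F(3)[of i x] by linarith
      then have "(norm (f x - F i x))\<^sup>2 \<le> (3 * norm (f x))\<^sup>2"
        by (intro power_mono) simp_all
      then show "norm ((norm (f x - F i x))\<^sup>2) \<le> 9 * (norm (f x))\<^sup>2"
        by (simp add: power_mult_distrib)
    qed
    show "AE x in \<mu>. (\<lambda>i. (norm (f x - F i x))\<^sup>2) \<longlonglongrightarrow> 0"
    proof (rule AE_I2)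
      fix x
      have "(\<lambda>i. (norm (f x - F i x))\<^sup>2) \<longlonglongrightarrow> (norm (f x - f x))\<^sup>2"
        by (intro tendsto_intros F(2))
      then show "(\<lambda>i. (norm (f x - F i x))\<^sup>2) \<longlonglongrightarrow> 0" by simp
    qed
    show "(\<lambda>x. (norm (f x - F i x))\<^sup>2) \<in> borel_measurable \<mu>" for i
      using meas borel_measurable_simple_function[OF F(1)[of i]] by measurable
  qed (use int in simp_all)
  then have lim: "(\<lambda>i. \<integral>x. (norm (f x - F i x))\<^sup>2 \<partial>\<mu>) \<longlonglongrightarrow> 0"
    by simp
  fix e :: real assume "e > 0"
  then obtain i where "(\<integral>x. (norm (f x - F i x))\<^sup>2 \<partial>\<mu>) < e"
    using order_tendstoD(2)[OF lim, of e] by (auto simp: eventually_sequentially)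
  then show "\<exists>g. fourier_approximable g \<and> (\<integral>x. (norm (f x - g x))\<^sup>2 \<partial>\<mu>) < e"
    using fourier_approximable_simple[OF F(1)] by blast
qed

definition vector_fourier_coefficient :: "('g \<Rightarrow> 'h) \<Rightarrow> ('g \<Rightarrow> complex) \<Rightarrow> 'h::separable_chilbert_space" where
  "vector_fourier_coefficient f k = (\<integral>x. cnj (k x) *\<^sub>C f x \<partial>\<mu>)"

lemma character_times_integrable:
  assumes k: "k \<in> dual_group" and f: "integrable \<mu> f"
  shows "integrable \<mu> (\<lambda>x. cnj (k x) *\<^sub>C (f x :: 'h::separable_chilbert_space))"
proof (rule Bochner_Integration.integrable_bound[OF f])
  have "(\<lambda>x. cnj (k x)) \<in> borel_measurable \<mu>"
    by (intro borel_measurable_haar borel_measurable_continuous_onI dual_group_continuous dual_group_cnj k)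
  then show "(\<lambda>x. cnj (k x) *\<^sub>C f x) \<in> borel_measurable \<mu>"
    by (rule borel_measurable_continuous_Pair[OF _ borel_measurable_integrable[OF f]])
       (intro scaleC.continuous_on continuous_on_fst continuous_on_snd continuous_on_id)
  show "AE x in \<mu>. norm (cnj (k x) *\<^sub>C f x) \<le> norm (f x)"
    by (intro AE_I2) (simp add: norm_scaleC dual_group_norm[OF k])
qed

lemma integral_diff_character:
  fixes f :: "'g \<Rightarrow> 'h::separable_chilbert_space"
  assumes f: "square_integrable f" and k: "k \<in> dual_group"
  shows "(\<integral>x. (norm (f x - k x *\<^sub>C c))\<^sup>2 \<partial>\<mu>) = (\<integral>x. (norm (f x))\<^sup>2 \<partial>\<mu>)
    - (norm (vector_fourier_coefficient f k))\<^sup>2 + (norm (vector_fourier_coefficient f k - c))\<^sup>2"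
proof -
  have expand: "(norm (a - b))\<^sup>2 = (norm a)\<^sup>2 + (norm b)\<^sup>2 - 2 * Re (cinner a b)" for a b :: 'h
  proof -
    have "(norm (a + - b))\<^sup>2 = (norm a)\<^sup>2 + (norm (- b))\<^sup>2 + 2 * Re (cinner a (- b))"
      by (rule norm_add_square)
    then show ?thesis
      unfolding cinner.minus_right by simp
  qed
  define g where "g x = cnj (k x) *\<^sub>C f x" for x
  have g: "integrable \<mu> g"
    unfolding g_def by (intro character_times_integrable k square_integrable_integrable f)
  have lin: "bounded_linear (\<lambda>y. Re (cinner y c))"
    by (rule bounded_linear_compose[OF bounded_linear_Re cinner.bounded_linear_left])
  have "(norm (f x - k x *\<^sub>C c))\<^sup>2 = (norm (f x))\<^sup>2 + (norm c)\<^sup>2 - 2 * Re (cinner (g x) c)" for x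
    unfolding expand g_def cinner_scaleC_right cinner_scaleC_left norm_scaleC dual_group_norm[OF k] by simp
  then have "(\<integral>x. (norm (f x - k x *\<^sub>C c))\<^sup>2 \<partial>\<mu>)
      = (\<integral>x. (norm (f x))\<^sup>2 + (norm c)\<^sup>2 - 2 * Re (cinner (g x) c) \<partial>\<mu>)"
    by (simp only:)
  also have "\<dots> = (\<integral>x. (norm (f x))\<^sup>2 \<partial>\<mu>) + (norm c)\<^sup>2 - 2 * (\<integral>x. Re (cinner (g x) c) \<partial>\<mu>)"
    using f integrable_bounded_linear[OF lin g] by (simp add: square_integrable_def)
  also have "(\<integral>x. Re (cinner (g x) c) \<partial>\<mu>) = Re (cinner (vector_fourier_coefficient f k) c)"
    unfolding vector_fourier_coefficient_def g_def[symmetric] by (rule integral_bounded_linear[OF lin g])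
  finally show ?thesis
    unfolding expand[of "vector_fourier_coefficient f k"] by simp
qed

lemma vector_fourier_coefficient_diff_fourier_sum:
  fixes f :: "'g \<Rightarrow> 'h::separable_chilbert_space"
  assumes f: "integrable \<mu> f" and \<Delta>: "finite \<Delta>" "\<Delta> \<subseteq> dual_group" and k: "k \<in> dual_group" "k \<notin> \<Delta>"
  shows "vector_fourier_coefficient (\<lambda>x. f x - fourier_sum \<Delta> c x) k = vector_fourier_coefficient f k"
proof -
  have int: "integrable \<mu> (\<lambda>x. (l x * cnj (k x)) *\<^sub>C c l)" if "l \<in> \<Delta>" for l
    using that \<Delta>(2) k(1)
    by (intro continuous_integrable scaleC.continuous_on continuous_on_const
        dual_group_continuous dual_group_product dual_group_cnj) blast+
  have zero: "(\<integral>x. (l x * cnj (k x)) *\<^sub>C c l \<partial>\<mu>) = 0" if l: "l \<in> \<Delta>" for l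
  proof -
    have l': "l \<in> dual_group" "l \<noteq> k"
      using l \<Delta>(2) k(2) by blast+
    have "integrable \<mu> (\<lambda>x. l x * cnj (k x))"
      by (intro continuous_integrable dual_group_continuous dual_group_product dual_group_cnj l' k)
    then have "(\<integral>x. (l x * cnj (k x)) *\<^sub>C c l \<partial>\<mu>) = (\<integral>x. l x * cnj (k x) \<partial>\<mu>) *\<^sub>C c l"
      by (rule integral_bounded_linear[OF scaleC.bounded_linear_left])
    then show ?thesis
      using characters_orthonormal[OF l'(1) k(1)] l'(2) by (simp add: scaleC.zero_left)
  qed
  have "cnj (k x) *\<^sub>C (f x - fourier_sum \<Delta> c x)
      = cnj (k x) *\<^sub>C f x - (\<Sum>l\<in>\<Delta>. (l x * cnj (k x)) *\<^sub>C c l)" for x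
    by (simp add: fourier_sum_def scaleC.diff_right scaleC.sum_right scaleC_scaleC mult.commute)
  then have "vector_fourier_coefficient (\<lambda>x. f x - fourier_sum \<Delta> c x) k
      = (\<integral>x. cnj (k x) *\<^sub>C f x - (\<Sum>l\<in>\<Delta>. (l x * cnj (k x)) *\<^sub>C c l) \<partial>\<mu>)"
    by (simp only: vector_fourier_coefficient_def)
  also have "\<dots> = (\<integral>x. cnj (k x) *\<^sub>C f x \<partial>\<mu>) - (\<integral>x. (\<Sum>l\<in>\<Delta>. (l x * cnj (k x)) *\<^sub>C c l) \<partial>\<mu>)"
    using int by (intro Bochner_Integration.integral_diff character_times_integrable k f
        Bochner_Integration.integrable_sum)
  also have "(\<integral>x. (\<Sum>l\<in>\<Delta>. (l x * cnj (k x)) *\<^sub>C c l) \<partial>\<mu>) = (\<Sum>l\<in>\<Delta>. (\<integral>x. (l x * cnj (k x)) *\<^sub>C c l \<partial>\<mu>))"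
    by (rule Bochner_Integration.integral_sum[OF int])
  also have "\<dots> = 0"
    by (simp add: zero)
  finally show ?thesis
    by (simp add: vector_fourier_coefficient_def)
qed

text \<open>
  Characters are subtracted one at a time. By orthogonality, this does not affect the coefficients with
  respect to other characters.
\<close>

lemma integral_diff_fourier_sum:
  fixes f :: "'g \<Rightarrow> 'h::separable_chilbert_space"
  assumes f: "square_integrable f" and "finite \<Delta>" "\<Delta> \<subseteq> dual_group"
  shows "(\<integral>x. (norm (f x - fourier_sum \<Delta> c x))\<^sup>2 \<partial>\<mu>) = (\<integral>x. (norm (f x))\<^sup>2 \<partial>\<mu>)
    - (\<Sum>k\<in>\<Delta>. (norm (vector_fourier_coefficient f k))\<^sup>2)
    + (\<Sum>k\<in>\<Delta>. (norm (vector_fourier_coefficient f k - c k))\<^sup>2)"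
  using assms(2,3)
proof (induction \<Delta>)
  case empty
  then show ?case by (simp add: fourier_sum_def)
next
  case (insert k \<Delta>)
  let ?g = "\<lambda>x. f x - fourier_sum \<Delta> c x"
  have k: "k \<in> dual_group" and \<Delta>: "\<Delta> \<subseteq> dual_group"
    using insert.prems by blast+
  have g: "square_integrable ?g"
    by (intro square_integrable_diff f square_integrable_continuous fourier_sum_continuous \<Delta>)
  have "f x - fourier_sum (insert k \<Delta>) c x = ?g x - k x *\<^sub>C c k" for x
    using insert.hyps by (simp add: fourier_sum_def)
  then have "(\<integral>x. (norm (f x - fourier_sum (insert k \<Delta>) c x))\<^sup>2 \<partial>\<mu>)
      = (\<integral>x. (norm (?g x - k x *\<^sub>C c k))\<^sup>2 \<partial>\<mu>)"
    by (simp only:)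
  also have "\<dots> = (\<integral>x. (norm (?g x))\<^sup>2 \<partial>\<mu>) - (norm (vector_fourier_coefficient ?g k))\<^sup>2
      + (norm (vector_fourier_coefficient ?g k - c k))\<^sup>2"
    by (rule integral_diff_character[OF g k])
  finally show ?case
    unfolding vector_fourier_coefficient_diff_fourier_sum[OF square_integrable_integrable[OF f]
        insert.hyps(1) \<Delta> k insert.hyps(2)] insert.IH[OF \<Delta>]
    using insert.hyps by simp
qed

lemma Bessel_inequality:
  assumes "square_integrable f" "finite \<Delta>" "\<Delta> \<subseteq> dual_group"
  shows "(\<Sum>k\<in>\<Delta>. (norm (vector_fourier_coefficient f k))\<^sup>2) \<le> (\<integral>x. (norm (f x))\<^sup>2 \<partial>\<mu>)"
proof -
  have "0 \<le> (\<integral>x. (norm (f x - fourier_sum \<Delta> (vector_fourier_coefficient f) x))\<^sup>2 \<partial>\<mu>)"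
    by simp
  then show ?thesis
    unfolding integral_diff_fourier_sum[OF assms] by simp
qed

text \<open>The partial sums with the Fourier coefficients are the best approximations in mean square.\<close>

theorem Parseval_identity:
  assumes f: "square_integrable f"
  shows "((\<lambda>\<Delta>. \<Sum>k\<in>\<Delta>. (norm (vector_fourier_coefficient f k))\<^sup>2) \<longlongrightarrow> (\<integral>x. (norm (f x))\<^sup>2 \<partial>\<mu>))
    (finite_subsets_at_top dual_group)"
proof (rule tendstoI)
  fix e :: real assume "e > 0"
  then obtain \<Gamma> c where \<Gamma>: "finite \<Gamma>" "\<Gamma> \<subseteq> dual_group"
    and small: "(\<integral>x. (norm (f x - fourier_sum \<Gamma> c x))\<^sup>2 \<partial>\<mu>) < e"
    using square_integrable_fourier_approximable[OF f] unfolding fourier_approximable_def by blast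
  have "dist (\<Sum>k\<in>\<Delta>. (norm (vector_fourier_coefficient f k))\<^sup>2) (\<integral>x. (norm (f x))\<^sup>2 \<partial>\<mu>) < e"
    if \<Delta>: "finite \<Delta>" "\<Gamma> \<subseteq> \<Delta>" "\<Delta> \<subseteq> dual_group" for \<Delta>
  proof -
    define d where "d k = (if k \<in> \<Gamma> then c k else 0)" for k
    have "(\<integral>x. (norm (f x - fourier_sum \<Delta> d x))\<^sup>2 \<partial>\<mu>) < e"
      using small unfolding fourier_sum_superset[OF \<Delta>(1,2), of c] d_def[abs_def] .
    moreover have "0 \<le> (\<Sum>k\<in>\<Delta>. (norm (vector_fourier_coefficient f k - d k))\<^sup>2)"
      by (intro sum_nonneg) simp
    ultimately have "(\<integral>x. (norm (f x))\<^sup>2 \<partial>\<mu>) - (\<Sum>k\<in>\<Delta>. (norm (vector_fourier_coefficient f k))\<^sup>2) < e"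
      unfolding integral_diff_fourier_sum[OF f \<Delta>(1,3)] by linarith
    then show ?thesis
      using Bessel_inequality[OF f \<Delta>(1,3)] by (simp add: dist_real_def)
  qed
  then show "\<forall>\<^sub>F \<Delta> in finite_subsets_at_top dual_group.
      dist (\<Sum>k\<in>\<Delta>. (norm (vector_fourier_coefficient f k))\<^sup>2) (\<integral>x. (norm (f x))\<^sup>2 \<partial>\<mu>) < e"
    unfolding eventually_finite_subsets_at_top using \<Gamma> by blast
qed

end

section \<open>The operator identity\<close>

lemma limitin_strong_operator_topology:
  fixes f :: "'i \<Rightarrow> 'a::real_normed_vector \<Rightarrow>\<^sub>L 'b::real_normed_vector"
    and l :: "'a \<Rightarrow>\<^sub>L 'b"
  assumes "\<And>x. ((\<lambda>i. (f i) x) \<longlongrightarrow> l x) F"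
  shows "limitin strong_operator_topology f l F"
proof -
  have lim: "limitin euclidean (\<lambda>i. blinfun_apply (f i)) (blinfun_apply l) F"
    unfolding euclidean_product_topology[symmetric] limitin_componentwise using assms by simp
  show ?thesis
    unfolding limitin_def
  proof (intro conjI allI impI)
    show "l \<in> topspace strong_operator_topology"
      by (simp add: strong_operator_topology_topspace)
    fix U assume U: "openin strong_operator_topology U \<and> l \<in> U"
    then obtain V where V: "openin euclidean V" "U = blinfun_apply -` V \<inter> UNIV"
      unfolding strong_operator_topology_def openin_pullback_topology by blast
    then have "blinfun_apply l \<in> V"
      using U by blast
    then have "\<forall>\<^sub>F i in F. blinfun_apply (f i) \<in> V"
      using lim V(1) unfolding limitin_def by blast
    then show "\<forall>\<^sub>F i in F. f i \<in> U"
      by (rule eventually_mono) (simp add: V(2))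
  qed
qed

lemma cinner_op_abs_compose_self:
  assumes "A \<in> BH"
  shows "cinner ((op_abs A o\<^sub>L op_abs A) x) x
    = complex_of_real ((norm (A x))\<^sup>2)"
  unfolding op_abs_compose_self[OF assms] by (rule cinner_adjoint_compose_self[OF assms])

lemma sum_BH: "(\<And>i. i \<in> I \<Longrightarrow> f i \<in> BH) \<Longrightarrow> sum f I \<in> BH"
  by (induction I rule: infinite_finite_induct) (simp_all add: add_BH)

text \<open>
  For a positive operator \<open>R \<le> D\<close>, Cauchy and Schwarz give \<open>\<parallel>R x\<parallel>\<^sup>2 \<le> \<parallel>D\<parallel> \<langle>R x, x\<rangle>\<close>. With \<open>R\<close> the remainder
  of the series, convergence of the quadratic forms turns into strong convergence.
\<close>

lemma strong_limit_of_forms: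
  fixes D :: "'h::separable_chilbert_space \<Rightarrow>\<^sub>L 'h"
  assumes D: "D \<in> BH" and P: "\<forall>\<^sub>F i in F. P i \<in> BH"
    and formD: "\<And>x. cinner (D x) x = complex_of_real (d x)"
    and formP: "\<forall>\<^sub>F i in F. \<forall>x. cinner (P i x) x = complex_of_real (p i x)
      \<and> 0 \<le> p i x \<and> p i x \<le> d x"
    and lim: "\<And>x. ((\<lambda>i. p i x) \<longlongrightarrow> d x) F"
  shows "limitin strong_operator_topology P D F"
proof (rule limitin_strong_operator_topology)
  fix x
  have bound: "\<forall>\<^sub>F i in F. norm ((P i) x - D x) \<le> sqrt (norm D * (d x - p i x))"
    using P formP
  proof eventually_elim
    case (elim i)
    define R where "R = D - P i"
    have R_BH: "R \<in> BH"
      unfolding R_def by (intro minus_BH D elim)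
    have R: "cinner (R y) y = complex_of_real (d y - p i y)" for y
      using elim formD by (simp add: R_def blinfun.diff_left cinner.diff_left)
    have "op_positive R"
      unfolding op_positive_def R using R_BH elim by (simp add: complex_nonneg_Reals_iff)
    moreover have "Re (cinner (R y) y) \<le> norm D * (norm y)\<^sup>2" for y
    proof -
      have "d y - p i y \<le> d y"
        using elim by simp
      also have "d y = Re (cinner (D y) y)"
        by (simp add: formD)
      also have "\<dots> \<le> norm D * (norm y)\<^sup>2"
        by (rule Re_cinner_blinfun_le)
      finally show ?thesis
        by (simp add: R)
    qed
    ultimately have "(norm (R x))\<^sup>2 \<le> norm D * Re (cinner (R x) x)"
      by (rule op_positive_norm_square_le)
    then have "norm (R x) \<le> sqrt (norm D * (d x - p i x))"
      unfolding R by (simp add: real_le_rsqrt)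
    then show ?case
      by (simp add: R_def blinfun.diff_left norm_minus_commute)
  qed
  have "((\<lambda>i. sqrt (norm D * (d x - p i x))) \<longlongrightarrow> sqrt (norm D * (d x - d x))) F"
    by (intro tendsto_intros lim)
  then have "((\<lambda>i. sqrt (norm D * (d x - p i x))) \<longlongrightarrow> 0) F"
    by simp
  from Lim_null_comparison[OF bound this]
  show "((\<lambda>i. (P i) x) \<longlongrightarrow> D x) F"
    by (rule LIM_zero_cancel)
qed

theorem theorem3p1:
  fixes \<mu> :: "'g::{topological_ab_group_add, t2_space} measure"
    and J :: "('h::separable_chilbert_space \<Rightarrow>\<^sub>L 'h) set"
    and N :: "('h \<Rightarrow>\<^sub>L 'h) \<Rightarrow> real"
    and A :: "'g \<Rightarrow> 'h \<Rightarrow>\<^sub>L 'h"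
  assumes "compact (UNIV :: 'g set)"
    and "normalized_haar_measure \<mu>"
    and "unitarily_invariant_norm J N"
    and "A \<in> L2_in \<mu> J N"
  shows "(\<forall>k\<in>dual_group. bochner_integrable_in \<mu> J N (\<lambda>\<theta>. op_scaleC (cnj (k \<theta>)) (A \<theta>))) \<and>
    bochner_integrable_in \<mu> J N (\<lambda>\<theta>. op_abs (A \<theta>) o\<^sub>L op_abs (A \<theta>)) \<and>
    limitin strong_operator_topology
      (\<lambda>\<Delta>. \<Sum>k\<in>\<Delta>. op_abs (fourier_coefficient \<mu> J N A k) o\<^sub>L op_abs (fourier_coefficient \<mu> J N A k))
      (bochner_integral_in \<mu> J N (\<lambda>\<theta>. op_abs (A \<theta>) o\<^sub>L op_abs (A \<theta>)))
      (finite_subsets_at_top dual_group)"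
proof -
  interpret G: compact_group_haar_measure \<mu>
    using assms(1,2) by (simp add: compact_group_haar_measure_def compact_group_haar_measure_axioms_def)
  interpret unitarily_invariant_norm J N
    by (rule assms(3))
  have finite: "finite_measure \<mu>"
    by (rule G.finite_measure_axioms)
  have meas: "strongly_measurable_in \<mu> J N A" and fin_A: "(\<integral>\<^sup>+\<theta>. ennreal ((N (A \<theta>))\<^sup>2) \<partial>\<mu>) < \<infinity>"
    using assms(4) by (simp_all add: L2_in_def)
  have A: "A \<theta> \<in> J" for \<theta>
    using meas by (auto simp: strongly_measurable_in_def)
  \<comment> \<open>\<open>A\<close> itself may fail to be Borel measurable. A version \<open>g\<close> of it has the same integrals.\<close>
  obtain g s where AE: "AE \<theta> in \<mu>. A \<theta> = g \<theta>" and approx: "approximating_sequence \<mu> s g"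
    using strongly_measurable_modification[OF meas] by blast
  have g: "g \<theta> \<in> J" for \<theta>
    using approximating_sequenceD(1)[OF approx] by simp
  have N_meas: "(\<lambda>\<theta>. N (g \<theta>)) \<in> borel_measurable \<mu>"
    by (rule approximating_sequence_N_measurable[OF approx])
  have "(\<integral>\<^sup>+\<theta>. ennreal ((N (A \<theta>))\<^sup>2) \<partial>\<mu>) = (\<integral>\<^sup>+\<theta>. ennreal ((N (g \<theta>))\<^sup>2) \<partial>\<mu>)"
    using AE by (intro nn_integral_cong_AE) (auto elim: eventually_mono)
  then have N2: "integrable \<mu> (\<lambda>\<theta>. (N (g \<theta>))\<^sup>2)"
    using fin_A N_meas by (intro integrableI_nonneg) simp_all
  have N1: "integrable \<mu> (\<lambda>\<theta>. N (g \<theta>))"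
  proof (rule Bochner_Integration.integrable_bound[OF _ N_meas])
    show "integrable \<mu> (\<lambda>\<theta>. 1 + (N (g \<theta>))\<^sup>2)"
      using N2 by simp
    have "N (g \<theta>) \<le> 1 + (N (g \<theta>))\<^sup>2" for \<theta>
    proof -
      have "0 \<le> (N (g \<theta>))\<^sup>2 - 2 * N (g \<theta>) + 1"
        using zero_le_power2[of "N (g \<theta>) - 1"] by (simp add: power2_diff)
      then show ?thesis
        using nonneg[OF g[of \<theta>]] by linarith
    qed
    then show "AE \<theta> in \<mu>. norm (N (g \<theta>)) \<le> norm (1 + (N (g \<theta>))\<^sup>2)"
      using nonneg[OF g] by (intro AE_I2) simp
  qed

  have coefficient:
    "bochner_integrable_in \<mu> J N (\<lambda>\<theta>. op_scaleC (cnj (k \<theta>)) (A \<theta>)) \<and>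
     fourier_coefficient \<mu> J N A k \<in> J \<and>
     (\<forall>x. (fourier_coefficient \<mu> J N A k) x
        = G.vector_fourier_coefficient (\<lambda>\<theta>. (g \<theta>) x) k)"
    if k: "k \<in> dual_group" for k
  proof -
    let ?f = "\<lambda>\<theta>. op_scaleC (cnj (k \<theta>)) (A \<theta>)" and ?g = "\<lambda>\<theta>. op_scaleC (cnj (k \<theta>)) (g \<theta>)"
    have "(\<lambda>\<theta>. cnj (k \<theta>)) \<in> borel_measurable \<mu>"
      by (intro G.borel_measurable_haar borel_measurable_continuous_onI G.dual_group_continuous
          G.dual_group_cnj k)
    then obtain t where t: "approximating_sequence \<mu> t ?g"
      using approximating_sequence_scaleC[OF approx] by blast
    have "N (?g \<theta>) = N (g \<theta>)" for \<theta>
      by (simp add: scale[OF g] G.dual_group_norm[OF k])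
    then have fin: "(\<integral>\<^sup>+\<theta>. ennreal (N (?g \<theta>)) \<partial>\<mu>) < \<infinity>"
      using N1 nonneg[OF g] by (simp add: nn_integral_eq_integral)
    have f: "AE \<theta> in \<mu>. ?f \<theta> = ?g \<theta>" "?f \<in> space \<mu> \<rightarrow> J"
      using AE op_scaleC_mem[OF A] by (auto elim: eventually_mono)
    note integral = bochner_integral_in_modification[OF finite t fin f, folded fourier_coefficient_def]
    have "(fourier_coefficient \<mu> J N A k) x
        = G.vector_fourier_coefficient (\<lambda>\<theta>. (g \<theta>) x) k" for x
      using has_bochner_integral_integral_eq[OF integral(3), of x]
      by (simp add: G.vector_fourier_coefficient_def op_scaleC.rep_eq)
    then show ?thesis
      using integral(1,2) by blast
  qed

  let ?f = "\<lambda>\<theta>. op_abs (A \<theta>) o\<^sub>L op_abs (A \<theta>)" and ?g = "\<lambda>\<theta>. op_adjoint (g \<theta>) o\<^sub>L g \<theta>"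
  define D where "D = bochner_integral_in \<mu> J N ?f"
  have abs_A: "?f \<theta> = op_adjoint (A \<theta>) o\<^sub>L A \<theta>" for \<theta>
    by (rule op_abs_compose_self[OF mem_BH[OF A]])
  have "N (?g \<theta>) \<le> 2 * (N (g \<theta>))\<^sup>2" for \<theta>
    using N_adjoint_compose_le[OF g g, of \<theta> \<theta>] by (simp add: power2_eq_square)
  then have "(\<integral>\<^sup>+\<theta>. ennreal (N (?g \<theta>)) \<partial>\<mu>) \<le> (\<integral>\<^sup>+\<theta>. ennreal (2 * (N (g \<theta>))\<^sup>2) \<partial>\<mu>)"
    by (intro nn_integral_mono ennreal_leI)
  also have "\<dots> < \<infinity>"
    using N2 by (subst nn_integral_eq_integral) simp_all
  finally have fin: "(\<integral>\<^sup>+\<theta>. ennreal (N (?g \<theta>)) \<partial>\<mu>) < \<infinity>" .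
  have f: "AE \<theta> in \<mu>. ?f \<theta> = ?g \<theta>" "?f \<in> space \<mu> \<rightarrow> J"
    unfolding abs_A using AE adjoint_compose_mem[OF A A] by (auto elim: eventually_mono)
  note integral = bochner_integral_in_modification[OF finite
      approximating_sequence_adjoint_compose[OF approx] fin f, folded D_def]

  \<comment> \<open>Parseval's identity is applied to the functions \<open>\<theta> \<mapsto> g \<theta> x\<close>, whose coefficients are \<open>B\<^sub>k x\<close>.\<close>
  have square: "G.square_integrable (\<lambda>\<theta>. (g \<theta>) x)" for x
  proof -
    have gx: "(\<lambda>\<theta>. (g \<theta>) x) \<in> borel_measurable \<mu>"
      by (rule approximating_sequence_apply_measurable[OF approx])
    have "integrable \<mu> (\<lambda>\<theta>. (norm (g \<theta> x))\<^sup>2)"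
    proof (rule Bochner_Integration.integrable_bound)
      show "integrable \<mu> (\<lambda>\<theta>. (N (g \<theta>))\<^sup>2 * (norm x)\<^sup>2)"
        using N2 by simp
      have "norm (g \<theta> x) \<le> N (g \<theta>) * norm x" for \<theta>
        using norm_blinfun[of "g \<theta>" x] mult_right_mono[OF norm_le_N[OF g[of \<theta>]], of "norm x"] by simp
      then have "(norm (g \<theta> x))\<^sup>2 \<le> (N (g \<theta>) * norm x)\<^sup>2" for \<theta>
        by (intro power_mono) simp_all
      then show "AE \<theta> in \<mu>. norm ((norm (g \<theta> x))\<^sup>2) \<le> norm ((N (g \<theta>))\<^sup>2 * (norm x)\<^sup>2)"
        by (intro AE_I2) (simp add: power_mult_distrib)
    qed (use gx in measurable)
    then show ?thesis
      using gx by (simp add: G.square_integrable_def)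
  qed

  have "limitin strong_operator_topology
      (\<lambda>\<Delta>. \<Sum>k\<in>\<Delta>. op_abs (fourier_coefficient \<mu> J N A k) o\<^sub>L op_abs (fourier_coefficient \<mu> J N A k))
      D (finite_subsets_at_top dual_group)"
  proof (rule strong_limit_of_forms)
    let ?B = "fourier_coefficient \<mu> J N A"
    let ?d = "\<lambda>x. \<integral>\<theta>. (norm (g \<theta> x))\<^sup>2 \<partial>\<mu>"
      and ?p = "\<lambda>\<Delta> x. \<Sum>k\<in>\<Delta>. (norm (G.vector_fourier_coefficient (\<lambda>\<theta>. (g \<theta>) x) k))\<^sup>2"
    have B_BH: "?B k \<in> BH" and B: "(?B k) x
        = G.vector_fourier_coefficient (\<lambda>\<theta>. (g \<theta>) x) k"
      if "k \<in> dual_group" for k x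
      using coefficient[OF that] mem_BH by blast+
    have in_dual: "\<forall>\<^sub>F \<Delta> in finite_subsets_at_top dual_group. finite \<Delta> \<and> \<Delta> \<subseteq> dual_group"
      by (rule eventually_finite_subsets_at_top_weakI) simp
    show "D \<in> BH"
      using integral(2) by (rule mem_BH)
    show "\<forall>\<^sub>F \<Delta> in finite_subsets_at_top dual_group. (\<Sum>k\<in>\<Delta>. op_abs (?B k) o\<^sub>L op_abs (?B k)) \<in> BH"
      using in_dual
    proof eventually_elim
      case (elim \<Delta>)
      show ?case
      proof (rule sum_BH)
        fix k assume "k \<in> \<Delta>"
        then have "k \<in> dual_group"
          using elim by blast
        then show "op_abs (?B k) o\<^sub>L op_abs (?B k) \<in> BH"
          unfolding op_abs_compose_self[OF B_BH[OF \<open>k \<in> dual_group\<close>]]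
          by (intro compose_BH op_adjoint_BH B_BH)
      qed
    qed
    show "cinner (D x) x = complex_of_real (?d x)" for x
    proof -
      have "cinner (D x) x = (\<integral>\<theta>. cinner (?g \<theta> x) x \<partial>\<mu>)"
        using has_bochner_integral_bounded_linear[OF cinner.bounded_linear_left integral(3), of x x]
        by (rule has_bochner_integral_integral_eq[symmetric])
      also have "\<dots> = (\<integral>\<theta>. complex_of_real ((norm (g \<theta> x))\<^sup>2) \<partial>\<mu>)"
        unfolding cinner_adjoint_compose_self[OF mem_BH[OF g]] ..
      also have "\<dots> = complex_of_real (?d x)"
        by (rule integral_complex_of_real)
      finally show ?thesis .
    qed
    show "\<forall>\<^sub>F \<Delta> in finite_subsets_at_top dual_group. \<forall>x.
        cinner ((\<Sum>k\<in>\<Delta>. op_abs (?B k) o\<^sub>L op_abs (?B k)) x) x = complex_of_real (?p \<Delta> x)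
        \<and> 0 \<le> ?p \<Delta> x \<and> ?p \<Delta> x \<le> ?d x"
      using in_dual
    proof eventually_elim
      case (elim \<Delta>)
      show ?case
      proof (intro allI conjI)
        fix x
        have "cinner ((\<Sum>k\<in>\<Delta>. op_abs (?B k) o\<^sub>L op_abs (?B k)) x) x
            = (\<Sum>k\<in>\<Delta>. cinner ((op_abs (?B k) o\<^sub>L op_abs (?B k)) x) x)"
          by (simp only: blinfun.sum_left cinner.sum_left)
        also have "\<dots> = (\<Sum>k\<in>\<Delta>. complex_of_real
            ((norm (G.vector_fourier_coefficient (\<lambda>\<theta>. (g \<theta>) x) k))\<^sup>2))"
        proof (rule sum.cong[OF refl])
          fix k assume "k \<in> \<Delta>"
          then have k: "k \<in> dual_group"
            using elim by blast
          show "cinner ((op_abs (?B k) o\<^sub>L op_abs (?B k)) x) x = complex_of_real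
              ((norm (G.vector_fourier_coefficient (\<lambda>\<theta>. (g \<theta>) x) k))\<^sup>2)"
            unfolding cinner_op_abs_compose_self[OF B_BH[OF k]] B[OF k] ..
        qed
        also have "\<dots> = complex_of_real (?p \<Delta> x)"
          by (rule of_real_sum[symmetric])
        finally show "cinner ((\<Sum>k\<in>\<Delta>. op_abs (?B k) o\<^sub>L op_abs (?B k)) x) x
            = complex_of_real (?p \<Delta> x)" .
        show "0 \<le> ?p \<Delta> x"
          by (intro sum_nonneg) simp
        show "?p \<Delta> x \<le> ?d x"
          using elim by (intro G.Bessel_inequality square) blast+
      qed
    qed
    show "((\<lambda>\<Delta>. ?p \<Delta> x) \<longlongrightarrow> ?d x) (finite_subsets_at_top dual_group)" for x
      by (rule G.Parseval_identity[OF square])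
  qed
  then show ?thesis
    unfolding D_def using coefficient integral(1) by blast
qed

end
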